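(* Let $n\ge 1$ and let $F_k$ denote the free group of rank $k$. There is a Lipschitz retraction from $\mathsf{Out}(F_n)$ to a subgroup of $\mathsf{Out}(F_n)$ isomorphic to $\mathsf{Aut}(F_{n-1})$, which is therefore undistorted in $\mathsf{Out}(F_n)$.
   Context: Finitely generated groups are equipped with the word metric of any finite generating set. For a finitely generated group $G$ and a finitely generated subgroup $H<G$: a Lipschitz retraction from $G$ to $H$ is a function $\pi\colon G\to H$ (not necessarily a homomorphism) that restricts to the identity on $H$ and for which there is a constant $K\ge 1$ such that $d_H(\pi(a),\pi(b))\le K\,d_G(a,b)$ for all $a,b\in G$; $H$ is undistorted in $G$ if the inclusion $H\hookrightarrow G$ is a quasi-isometric embedding with respect to word metrics. *)

theory Defs
  imports Complex_Main "HOL-Algebra.Algebra"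
begin

section \<open>Free groups of finite rank\<close>

text \<open>The letter \<open>(i, True)\<close> stands for the \<open>i\<close>-th basis element and \<open>(i, False)\<close> for its
  inverse. Group elements are reduced words.\<close>

type_synonym letter = "nat \<times> bool"

definition inv_letter :: "letter \<Rightarrow> letter" where
  "inv_letter x = (fst x, \<not> snd x)"

definition reduced :: "letter list \<Rightarrow> bool" where
  "reduced w \<longleftrightarrow> successively (\<lambda>x y. y \<noteq> inv_letter x) w"

fun push_letter :: "letter \<Rightarrow> letter list \<Rightarrow> letter list" where
  "push_letter x [] = [x]"
| "push_letter x (y # w) = (if y = inv_letter x then w else x # y # w)"

definition free_group :: "nat \<Rightarrow> letter list monoid" where
  "free_group k =
    \<lparr>carrier = {w. reduced w \<and> fst ` set w \<subseteq> {..<k}},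
     monoid.mult = foldr push_letter,
     one = []\<rparr>"

lemma inv_letter_simps [simp]:
  "fst (inv_letter x) = fst x" "inv_letter (inv_letter x) = x"
  "inv_letter x = inv_letter y \<longleftrightarrow> x = y"
  by (auto simp: inv_letter_def prod_eq_iff)

lemma reduced_Cons:
  "reduced (x # w) \<longleftrightarrow> reduced w \<and> (w = [] \<or> hd w \<noteq> inv_letter x)"
  by (cases w) (auto simp: reduced_def)

lemma reduced_push: "reduced w \<Longrightarrow> reduced (push_letter x w)"
  by (cases w) (auto simp: reduced_Cons)

lemma push_push_inv: "reduced w \<Longrightarrow> push_letter (inv_letter x) (push_letter x w) = w"
  by (cases w; cases "tl w") (auto simp: reduced_Cons)

lemma reduced_foldr_push: "reduced w \<Longrightarrow> reduced (foldr push_letter u w)"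
  by (induction u) (auto intro: reduced_push)

lemma foldr_push_push:
  assumes "reduced w"
  shows "foldr push_letter (push_letter x v) w = push_letter x (foldr push_letter v w)"
proof (cases v)
  case (Cons y v')
  have "push_letter x (push_letter (inv_letter x) (foldr push_letter v' w))
        = foldr push_letter v' w"
    using push_push_inv[of _ "inv_letter x"] reduced_foldr_push[OF assms] by simp
  then show ?thesis using Cons by auto
qed simp

lemma foldr_push_assoc:
  "reduced w \<Longrightarrow>
    foldr push_letter (foldr push_letter u v) w = foldr push_letter u (foldr push_letter v w)"
  by (induction u) (simp_all add: foldr_push_push)

lemma set_push: "set (push_letter x w) \<subseteq> insert x (set w)"
  by (cases w) auto

lemma set_foldr_push: "set (foldr push_letter u w) \<subseteq> set u \<union> set w"
  by (induction u) (use set_push in fastforce)+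

lemma foldr_push_Nil: "reduced w \<Longrightarrow> foldr push_letter w [] = w"
proof (induction w)
  case (Cons x w)
  then show ?case by (cases w) (auto simp: reduced_Cons)
qed simp

lemma foldr_push_rev_inv:
  "reduced v \<Longrightarrow> foldr push_letter (rev (map inv_letter w)) (foldr push_letter w v) = v"
  by (induction w) (simp_all add: push_push_inv reduced_foldr_push)

lemma group_free_group: "group (free_group k)"
proof (rule groupI)
  fix x y assume "x \<in> carrier (free_group k)" "y \<in> carrier (free_group k)"
  then show "x \<otimes>\<^bsub>free_group k\<^esub> y \<in> carrier (free_group k)"
    using set_foldr_push[of x y] by (fastforce simp: free_group_def reduced_foldr_push)
next
  fix x assume x: "x \<in> carrier (free_group k)"
  let ?r = "rev (map inv_letter x)"
  let ?y = "foldr push_letter ?r []"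
  have "?y \<in> carrier (free_group k)"
    using x set_foldr_push[of ?r "[]"] reduced_foldr_push[of "[]" ?r]
    by (fastforce simp: free_group_def reduced_def)
  moreover have "foldr push_letter ?y x = []"
    using x foldr_push_assoc[of x ?r "[]"] foldr_push_rev_inv[of "[]" x]
    by (simp add: free_group_def reduced_def foldr_push_Nil)
  ultimately show "\<exists>y\<in>carrier (free_group k). y \<otimes>\<^bsub>free_group k\<^esub> x = \<one>\<^bsub>free_group k\<^esub>"
    by (auto simp: free_group_def)
qed (auto simp: free_group_def foldr_push_assoc reduced_def)


section \<open>Outer automorphism groups\<close>

definition inner_automorphism :: "('a, 'b) monoid_scheme \<Rightarrow> 'a \<Rightarrow> 'a \<Rightarrow> 'a" where
  "inner_automorphism G g = (\<lambda>x\<in>carrier G. g \<otimes>\<^bsub>G\<^esub> x \<otimes>\<^bsub>G\<^esub> inv\<^bsub>G\<^esub> g)"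

definition Inn :: "('a, 'b) monoid_scheme \<Rightarrow> ('a \<Rightarrow> 'a) set" where
  "Inn G = inner_automorphism G ` carrier G"

definition OutGroup :: "('a, 'b) monoid_scheme \<Rightarrow> ('a \<Rightarrow> 'a) set monoid" where
  "OutGroup G = AutoGroup G Mod Inn G"

lemma (in group) inner_automorphism_auto:
  assumes g: "g \<in> carrier G"
  shows "inner_automorphism G g \<in> auto G"
proof -
  have "inner_automorphism G g \<in> hom G G"
    using g by (auto simp: hom_def inner_automorphism_def m_assoc inv_solve_left)
  moreover have "bij_betw (inner_automorphism G g) (carrier G) (carrier G)"
    using g by (intro bij_betw_byWitness[where f' = "inner_automorphism G (inv g)"])
      (auto simp: inner_automorphism_def m_assoc
        simp flip: m_assoc[of "inv g" g] m_assoc[of g "inv g"])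
  ultimately show ?thesis
    by (simp add: auto_def Bij_def inner_automorphism_def)
qed

lemma (in group) normal_Inn: "Inn G \<lhd> AutoGroup G"
proof -
  interpret A: group "AutoGroup G" by (rule AutoGroup)
  have carrier: "carrier (AutoGroup G) = auto G"
    by (simp add: AutoGroup_def)
  have mult: "f \<otimes>\<^bsub>AutoGroup G\<^esub> h = compose (carrier G) f h"
    if "f \<in> auto G" "h \<in> auto G" for f h
    using that by (simp add: AutoGroup_def BijGroup_def auto_def)
  have hom: "inner_automorphism G \<in> hom G (AutoGroup G)"
  proof (rule homI)
    fix x y assume "x \<in> carrier G" "y \<in> carrier G"
    then show "inner_automorphism G (x \<otimes> y)
        = inner_automorphism G x \<otimes>\<^bsub>AutoGroup G\<^esub> inner_automorphism G y"
      by (simp add: mult inner_automorphism_auto)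
        (auto simp: inner_automorphism_def compose_def m_assoc inv_mult_group fun_eq_iff)
  qed (simp add: carrier inner_automorphism_auto)
  have "subgroup (Inn G) (AutoGroup G)"
    unfolding Inn_def
    by (rule group_hom.img_is_subgroup)
      (simp add: group_hom_def group_hom_axioms_def hom A.is_group is_group)
  moreover have "f \<otimes>\<^bsub>AutoGroup G\<^esub> i \<otimes>\<^bsub>AutoGroup G\<^esub> inv\<^bsub>AutoGroup G\<^esub> f \<in> Inn G"
    if f: "f \<in> carrier (AutoGroup G)" and i: "i \<in> Inn G" for f i
  proof -
    obtain g where g: "g \<in> carrier G" "i = inner_automorphism G g"
      using i by (auto simp: Inn_def)
    have fa: "f \<in> auto G" using f by (simp add: carrier)
    then have fh: "f \<in> hom G G" by (simp add: auto_def)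
    interpret f: group_hom G G f
      by (simp add: group_hom_def group_hom_axioms_def fh is_group)
    have "f \<otimes>\<^bsub>AutoGroup G\<^esub> i = inner_automorphism G (f g) \<otimes>\<^bsub>AutoGroup G\<^esub> f"
      using g fa by (simp add: mult inner_automorphism_auto)
        (auto simp: compose_def fun_eq_iff inner_automorphism_def)
    then have "f \<otimes>\<^bsub>AutoGroup G\<^esub> i \<otimes>\<^bsub>AutoGroup G\<^esub> inv\<^bsub>AutoGroup G\<^esub> f
        = inner_automorphism G (f g)"
      using f g inner_automorphism_auto[of "f g"] by (simp add: A.m_assoc flip: carrier)
    then show ?thesis using g by (simp add: Inn_def)
  qed
  ultimately show ?thesis by (simp add: A.normal_inv_iff)
qed

lemma group_OutGroup: "group G \<Longrightarrow> group (OutGroup G)"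
  by (simp add: OutGroup_def normal.factorgroup_is_group group.normal_Inn)


section \<open>Word metrics, Lipschitz retractions and distortion\<close>

definition finite_generating_set :: "('a, 'b) monoid_scheme \<Rightarrow> 'a set \<Rightarrow> bool" where
  "finite_generating_set G S \<longleftrightarrow> finite S \<and> S \<subseteq> carrier G \<and> generate G S = carrier G"

definition finitely_generated :: "('a, 'b) monoid_scheme \<Rightarrow> bool" where
  "finitely_generated G \<longleftrightarrow> (\<exists>S. finite_generating_set G S)"

definition word_length :: "('a, 'b) monoid_scheme \<Rightarrow> 'a set \<Rightarrow> 'a \<Rightarrow> nat" where
  "word_length G S g =
    (LEAST n. \<exists>w. length w = n \<and> set w \<subseteq> S \<union> m_inv G ` S \<and> foldr (monoid.mult G) w \<one>\<^bsub>G\<^esub> = g)"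

definition word_dist :: "('a, 'b) monoid_scheme \<Rightarrow> 'a set \<Rightarrow> 'a \<Rightarrow> 'a \<Rightarrow> real" where
  "word_dist G S a b = real (word_length G S (inv\<^bsub>G\<^esub> a \<otimes>\<^bsub>G\<^esub> b))"

text \<open>Metric notions below are required for every choice of finite generating sets; as finite
  generation is also required, this is not vacuous.\<close>

definition lipschitz_retraction ::
    "('a, 'b) monoid_scheme \<Rightarrow> 'a set \<Rightarrow> ('a \<Rightarrow> 'a) \<Rightarrow> bool" where
  "lipschitz_retraction G H \<pi> \<longleftrightarrow>
    finitely_generated G \<and> subgroup H G \<and> finitely_generated (G\<lparr>carrier := H\<rparr>) \<and>
    \<pi> \<in> carrier G \<rightarrow> H \<and> (\<forall>h\<in>H. \<pi> h = h) \<and>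
    (\<forall>S T. finite_generating_set G S \<and> finite_generating_set (G\<lparr>carrier := H\<rparr>) T \<longrightarrow>
      (\<exists>K\<ge>1. \<forall>a\<in>carrier G. \<forall>b\<in>carrier G.
        word_dist (G\<lparr>carrier := H\<rparr>) T (\<pi> a) (\<pi> b) \<le> K * word_dist G S a b))"

definition quasi_isometric_embedding ::
    "'a set \<Rightarrow> ('a \<Rightarrow> 'a \<Rightarrow> real) \<Rightarrow> ('b \<Rightarrow> 'b \<Rightarrow> real) \<Rightarrow> ('a \<Rightarrow> 'b) \<Rightarrow> bool" where
  "quasi_isometric_embedding A dA dB f \<longleftrightarrow>
    (\<exists>L\<ge>1. \<exists>C\<ge>0. \<forall>a\<in>A. \<forall>b\<in>A.
      dA a b / L - C \<le> dB (f a) (f b) \<and> dB (f a) (f b) \<le> L * dA a b + C)"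

definition undistorted :: "('a, 'b) monoid_scheme \<Rightarrow> 'a set \<Rightarrow> bool" where
  "undistorted G H \<longleftrightarrow>
    finitely_generated G \<and> subgroup H G \<and> finitely_generated (G\<lparr>carrier := H\<rparr>) \<and>
    (\<forall>S T. finite_generating_set G S \<and> finite_generating_set (G\<lparr>carrier := H\<rparr>) T \<longrightarrow>
      quasi_isometric_embedding H (word_dist (G\<lparr>carrier := H\<rparr>) T) (word_dist G S) (\<lambda>h. h))"

end

theory Submission
  imports Defs "HOL-Library.Z2"
begin

text \<open>Write \<open>n = a + 1\<close>. The subgroup is the image of the map that extends an
automorphism of \<open>A = F a\<close> to \<open>F n = A * \<langle>t\<rangle>\<close>, \<open>t = gen
a\<close>, by fixing \<open>t\<close>, and then takes the outer class. For word metrics, a map is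
Lipschitz as soon as, for each fixed \<open>s\<close>, right multiplication of the argument by
\<open>s\<close> changes the value by an element of a finite set
(\<open>lipschitz_of_finite_differences\<close>); and a retraction with this property makes the subgroup
undistorted. So it suffices to attach to every outer class \<open>c\<close> an automorphism of
\<open>A\<close>, equal to the given one if \<open>c\<close> comes from \<open>A\<close>, such that
these differences lie in finite sets. An automorphism of a free group of finite rank is determined by
finitely many words, so finiteness means that the difference moves the generators to words of bounded
length. The construction has two stages.

Outer classes to automorphisms. View \<open>\<Phi>\<close> through the preimages \<open>H\<close> of
\<open>A\<close> and \<open>t'\<close> of \<open>t\<close> in the Cayley tree of \<open>F n\<close>.
Conjugation of \<open>\<Phi>\<close> translates this picture, so a representative of an outer class can
be fixed by choosing a vertex. Let \<open>\<xi>\<close> be the end of the tree to which the powers of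
\<open>t'\<close> converge, and \<open>\<xi>'\<close> the end of the negative powers. The lines from
\<open>\<xi>\<close> to \<open>\<xi>'\<close> and to the translates \<open>h \<xi>\<close>, \<open>h
\<in> H - {0}\<close>, share a ray towards \<open>\<xi>\<close>, and the vertex where this ray starts is
the gate. Automorphisms are quasi-isometries of the tree with bounded cancellation, so they move gates a
bounded distance from gates, and gates are unique up to bounded distance (\<open>gate_aut\<close>,
\<open>gate_unique\<close>, \<open>gate_exists\<close>). Hence representatives with gate at the base
vertex change by a conjugation of bounded length (\<open>normalized_conjugator_bounded\<close>). An
automorphism that extends one of \<open>A\<close> has its gate at the base vertex
(\<open>gate_standard\<close>).

Automorphisms to automorphisms of the factor. \<open>\<Phi>\<close> maps \<open>H\<close> isomorphically
to \<open>A\<close>; composing with a Schreier basis of \<open>H\<close> gives an automorphism of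
\<open>A\<close>. The coordinates of an element of \<open>H\<close> in the Schreier basis are read off
from the crossings of non-tree edges of the coset graph. A Schreier generator visits each vertex of that
graph boundedly often, an automorphism \<open>\<sigma>\<close> spreads each edge over boundedly many
edges, so the \<open>\<sigma>\<close>-image of a Schreier generator of \<open>H\<close> crosses
boundedly many non-tree edges of the coset graph of \<open>\<sigma> H\<close>, uniformly in
\<open>H\<close> (\<open>marking_change_bounded\<close>).

The groups are finitely generated by Nielsen's theorem (\<open>finitely_generated_AutF\<close>): Nielsen
moves reduce every automorphism to one that does not shorten words, and the inverse of such an
automorphism maps generators to words of length at most one.\<close>

section \<open>The free group as a type\<close>

text \<open>Reduced words in all letters, without a bound on the rank, form a type, so that the group
laws need no carrier conditions. The group is written additively because that is the type class for
groups which need not be commutative; \<open>x + y\<close> is the product of words.\<close>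

typedef freegrp = "{w. reduced w}"
  morphisms letters of_letters
  by (rule exI[of _ "[]"]) (simp add: reduced_def)

lemma reduced_letters [simp]: "reduced (letters x)"
  using letters by simp

lemma letters_of_letters [simp]: "reduced w \<Longrightarrow> letters (of_letters w) = w"
  by (simp add: of_letters_inverse)

lemma reduced_Nil [simp]: "reduced []" and reduced_single [simp]: "reduced [x]"
  by (simp_all add: reduced_def)

lemma reduced_append:
  "reduced (u @ v) \<longleftrightarrow>
    reduced u \<and> reduced v \<and> (u = [] \<or> v = [] \<or> hd v \<noteq> inv_letter (last u))"
  by (auto simp: reduced_def successively_append_iff)

lemma inv_letter_eq_iff: "inv_letter x = y \<longleftrightarrow> x = inv_letter y"
  by (metis inv_letter_simps(2))

lemma reduced_inverse_word: "reduced w \<Longrightarrow> reduced (rev (map inv_letter w))"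
  by (induction w) (auto simp: reduced_append reduced_Cons last_rev hd_map inv_letter_eq_iff)

lemma foldr_push_append: "reduced (u @ v) \<Longrightarrow> foldr push_letter u v = u @ v"
  using foldr_push_Nil[of "u @ v"] foldr_push_Nil[of v] by (simp add: reduced_append)

instantiation freegrp :: group_add
begin

definition "0 = of_letters []"
definition "x + y = of_letters (foldr push_letter (letters x) (letters y))"
definition "- x = of_letters (rev (map inv_letter (letters x)))"
definition "x - y = x + - (y::freegrp)"

instance
proof
  fix x y z :: freegrp
  show "x + y + z = x + (y + z)"
    by (simp add: plus_freegrp_def reduced_foldr_push foldr_push_assoc)
  show "0 + x = x" "x + 0 = x"
    by (simp_all add: plus_freegrp_def zero_freegrp_def foldr_push_Nil letters_inverse)
  show "- x + x = 0"
    using foldr_push_rev_inv[of "[]" "letters x"]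
    by (simp add: plus_freegrp_def uminus_freegrp_def zero_freegrp_def reduced_inverse_word
        foldr_push_Nil)
  show "x + - y = x - y"
    by (simp add: minus_freegrp_def)
qed

end

lemma diff_add_cancel_left [simp]: "a - b + (b + c) = a + (c :: 'a :: group_add)"
  by (metis add.assoc diff_add_cancel)

lemma letters_zero [simp]: "letters 0 = []"
  by (simp add: zero_freegrp_def)

lemma letters_add: "letters (x + y) = foldr push_letter (letters x) (letters y)"
  by (simp add: plus_freegrp_def reduced_foldr_push)

lemma letters_uminus: "letters (- x) = rev (map inv_letter (letters x))"
  by (simp add: uminus_freegrp_def reduced_inverse_word)

lemma letters_eq_Nil [simp]: "letters x = [] \<longleftrightarrow> x = 0"
  by (metis letters_inverse letters_zero)

lemma letters_add_reduced:
  "reduced (letters x @ letters y) \<Longrightarrow> letters (x + y) = letters x @ letters y"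
  by (simp add: letters_add foldr_push_append)

lemma of_letters_append:
  "reduced (u @ v) \<Longrightarrow> of_letters (u @ v) = of_letters u + of_letters v"
  by (simp add: plus_freegrp_def foldr_push_append reduced_append)

definition letter :: "letter \<Rightarrow> freegrp" where
  "letter x = of_letters [x]"

abbreviation gen :: "nat \<Rightarrow> freegrp" where
  "gen i \<equiv> letter (i, True)"

lemma letters_letter [simp]: "letters (letter x) = [x]"
  by (simp add: letter_def)

lemma letter_inv_letter: "letter (inv_letter x) = - letter x"
  by (simp add: letter_def uminus_freegrp_def)

lemma letter_False: "letter (i, False) = - gen i"
  using letter_inv_letter[of "(i, True)"] by (simp add: inv_letter_def)

text \<open>The product of a list of letters, reduced or not; paths in the Cayley tree may backtrack.\<close>

definition word :: "letter list \<Rightarrow> freegrp" where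
  "word w = sum_list (map letter w)"

lemma word_simps [simp]:
  "word [] = 0" "word (x # w) = letter x + word w" "word (u @ v) = word u + word v"
  by (simp_all add: word_def)

lemma of_letters_eq_word: "reduced w \<Longrightarrow> of_letters w = word w"
proof (induction w)
  case (Cons x w)
  then show ?case
    using of_letters_append[of "[x]" w] by (simp add: letter_def reduced_Cons)
qed (simp add: zero_freegrp_def)

lemma word_letters [simp]: "word (letters x) = x"
  by (metis letters_inverse of_letters_eq_word reduced_letters)

lemma letters_word: "reduced w \<Longrightarrow> letters (word w) = w"
  by (metis letters_of_letters of_letters_eq_word)

section \<open>The word metric as a tree metric\<close>

abbreviation len :: "freegrp \<Rightarrow> nat" where
  "len x \<equiv> length (letters x)"

text \<open>The length of the longest common prefix. Among reduced words it is the Gromov product at the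
base vertex of the Cayley tree, and its ultrametric inequality is the only form in which the tree
property is used.\<close>

fun lcp :: "'a list \<Rightarrow> 'a list \<Rightarrow> nat" where
  "lcp (x # xs) (y # ys) = (if x = y then Suc (lcp xs ys) else 0)"
| "lcp _ _ = 0"

lemma lcp_ultra: "min (lcp u v) (lcp v w) \<le> lcp u w"
proof (induction u w arbitrary: v rule: lcp.induct)
  case (1 x xs y ys)
  then show ?case by (cases v) auto
next
  case ("2_1" w)
  then show ?case by simp
next
  case ("2_2" u)
  then show ?case by (cases v) auto
qed

lemma lcp_commute: "lcp u v = lcp v u"
  by (induction u v rule: lcp.induct) auto

lemma lcp_split:
  obtains p u' v' where "u = p @ u'" "v = p @ v'" "length p = lcp u v"
    "u' = [] \<or> v' = [] \<or> hd u' \<noteq> hd v'"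
proof (induction u v arbitrary: thesis rule: lcp.induct)
  case (1 x xs y ys)
  show ?case
  proof (cases "x = y")
    case True
    show ?thesis
    proof (rule 1(1)[OF True])
      fix p u' v'
      assume "xs = p @ u'" "ys = p @ v'" "length p = lcp xs ys"
        "u' = [] \<or> v' = [] \<or> hd u' \<noteq> hd v'"
      then show thesis using 1(2)[of "x # p" u' v'] True by simp
    qed
  next
    case False
    then show ?thesis using 1(2)[of "[]" "x # xs" "y # ys"] by simp
  qed
qed auto

lemma lcp_zero: "u = [] \<or> v = [] \<or> hd u \<noteq> hd v \<Longrightarrow> lcp u v = 0"
  by (cases u; cases v) auto

lemma lcp_le: "lcp u v \<le> length u" "lcp u v \<le> length v"
  by (induction u v rule: lcp.induct) auto

lemma letters_split:
  assumes "letters x = p @ u"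
  shows "x = word p + word u" "letters (word p) = p" "letters (word u) = u"
    "reduced p" "reduced u"
proof -
  show "reduced p" "reduced u"
    using assms reduced_letters[of x] by (simp_all add: reduced_append)
  then show "letters (word p) = p" "letters (word u) = u"
    by (simp_all add: letters_word)
  show "x = word p + word u"
    by (metis assms word_letters word_simps(3))
qed

lemma len_uminus [simp]: "len (- x) = len x"
  by (simp add: letters_uminus)

text \<open>Only the common prefix cancels in \<open>- x + y\<close>, because the two remainders start
with different letters.\<close>

lemma len_diff: "len (- x + y) + 2 * lcp (letters x) (letters y) = len x + len y"
proof -
  obtain p u v where *: "letters x = p @ u" "letters y = p @ v"
      "length p = lcp (letters x) (letters y)" "u = [] \<or> v = [] \<or> hd u \<noteq> hd v"
    by (rule lcp_split)
  have "- x + y = - word u + word v"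
    by (simp add: letters_split(1)[OF *(1)] letters_split(1)[OF *(2)] minus_add add.assoc)
  moreover have "reduced (letters (- word u) @ letters (word v))"
    using *(4) unfolding reduced_append
    by (auto simp: letters_uminus letters_split[OF *(1)] letters_split[OF *(2)] last_rev hd_map
        reduced_inverse_word)
  ultimately have "letters (- x + y) = rev (map inv_letter u) @ v"
    by (simp add: letters_add_reduced letters_uminus letters_split[OF *(1)] letters_split[OF *(2)])
  then show ?thesis using * by simp
qed

lemma len_add_le: "len (x + y) \<le> len x + len y"
  using len_diff[of "- x" y] by simp

definition dist_len :: "freegrp \<Rightarrow> freegrp \<Rightarrow> nat" where
  "dist_len x y = len (- x + y)"

text \<open>The Gromov product of \<open>x\<close> and \<open>y\<close> at \<open>v\<close>: the
distance from \<open>v\<close> to the geodesic from \<open>x\<close> to \<open>y\<close>.\<close>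

definition gp :: "freegrp \<Rightarrow> freegrp \<Rightarrow> freegrp \<Rightarrow> nat" where
  "gp v x y = lcp (letters (- v + x)) (letters (- v + y))"

lemma gp_dist: "dist_len x y + 2 * gp v x y = dist_len v x + dist_len v y"
  using len_diff[of "- v + x" "- v + y"]
  by (simp add: dist_len_def gp_def minus_add add.assoc)

lemma gp_ultra: "min (gp v x y) (gp v y z) \<le> gp v x z"
  by (simp only: gp_def lcp_ultra)

lemma gp_commute: "gp v x y = gp v y x"
  by (simp add: gp_def lcp_commute)

lemma dist_len_commute: "dist_len x y = dist_len y x"
  using len_uminus[of "- x + y"] by (simp add: dist_len_def minus_add)

lemma dist_len_self [simp]: "dist_len x x = 0"
  by (simp add: dist_len_def)

lemma dist_len_zero [simp]: "dist_len 0 x = len x" "dist_len x 0 = len x"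
  by (simp_all add: dist_len_def)

lemma dist_len_eq_0 [simp]: "dist_len x y = 0 \<longleftrightarrow> x = y"
  by (metis add.right_neutral add_minus_cancel dist_len_def dist_len_self length_0_conv letters_eq_Nil)

lemma dist_len_triangle: "dist_len x z \<le> dist_len x y + dist_len y z"
  using len_add_le[of "- x + y" "- y + z"] by (simp add: dist_len_def add.assoc)

lemma dist_len_translate [simp]: "dist_len (g + x) (g + y) = dist_len x y"
  by (simp add: dist_len_def minus_add add.assoc)

lemma gp_translate [simp]: "gp (g + v) (g + x) (g + y) = gp v x y"
  by (simp add: gp_def minus_add add.assoc)

text \<open>A point far from \<open>v\<close> may be moved by a small amount: both positions lie in the
same direction from \<open>v\<close>. This allows ends of the tree to be replaced by sequences that tend
to them.\<close>

lemma gp_absorb: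
  assumes "gp v x y \<le> C" "dist_len v x > C + dist_len x x'"
  shows "gp v x' y \<le> C"
  using gp_ultra[of v x x' y] gp_dist[of x x' v] dist_len_triangle[of v x x']
    dist_len_triangle[of v x' x] dist_len_commute[of x x'] assms by linarith

section \<open>Products with limited cancellation\<close>

text \<open>The number of letters that are lost at the end of \<open>x\<close> in the product \<open>x +
y\<close>.\<close>

definition cancel :: "freegrp \<Rightarrow> freegrp \<Rightarrow> nat" where
  "cancel x y = gp 0 (- x) y"

lemma len_add: "len (x + y) + 2 * cancel x y = len x + len y"
  using gp_dist[of "- x" y 0] by (simp add: cancel_def dist_len_def)

lemma cancel_inverse: "cancel (- y) (- x) = cancel x y"
  by (simp add: cancel_def gp_commute)

lemma lcp_nth: "i < lcp u v \<Longrightarrow> u ! i = v ! i"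
  by (induction u v arbitrary: i rule: lcp.induct) (auto split: if_splits simp: nth_Cons')

text \<open>If at least half of \<open>x\<close> cancelled against \<open>x\<close> itself, the middle
letter of \<open>x\<close> would be its own inverse, or the two middle letters would be inverse to each
other.\<close>

lemma two_cancel_self_less:
  assumes "x \<noteq> 0"
  shows "2 * cancel x x < len x"
proof (rule ccontr)
  assume neg: "\<not> 2 * cancel x x < len x"
  define w where "w = letters x"
  have red: "reduced w" and ne: "w \<noteq> []"
    using assms by (simp_all add: w_def)
  have *: "inv_letter (w ! (length w - Suc i)) = w ! i" if "2 * i < length w" for i
  proof -
    have "i < lcp (rev (map inv_letter w)) w"
      using that neg by (simp add: cancel_def gp_def letters_uminus w_def)
    then have "rev (map inv_letter w) ! i = w ! i"
      by (rule lcp_nth)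
    then show ?thesis
      using that by (simp add: rev_nth)
  qed
  show False
  proof (cases "even (length w)")
    case True
    then obtain j where j: "length w = 2 * j" by (elim evenE)
    have "j \<noteq> 0" using ne j by (metis length_0_conv mult_0_right)
    then have "j > 0" by simp
    then have "inv_letter (w ! j) = w ! (j - 1)"
      using *[of "j - 1"] j by simp
    moreover have "w ! Suc (j - 1) \<noteq> inv_letter (w ! (j - 1))"
      using red j \<open>j > 0\<close> unfolding reduced_def successively_conv_nth
      by (metis Suc_pred' One_nat_def less_add_same_cancel1 mult_2)
    ultimately show False using \<open>j > 0\<close> by (simp add: inv_letter_eq_iff)
  next
    case False
    then obtain j where j: "length w = 2 * j + 1" by (elim oddE)
    then show False using *[of j] by (simp add: inv_letter_def prod_eq_iff)
  qed
qed

fun cancel_next :: "freegrp \<Rightarrow> freegrp list \<Rightarrow> nat" where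
  "cancel_next y [] = 0"
| "cancel_next y (z # zs) = cancel y z"

text \<open>In a thin product the cancellations on the two sides of each factor do not meet, so every
factor contributes a letter to the product.\<close>

fun thin :: "freegrp list \<Rightarrow> bool" where
  "thin [] \<longleftrightarrow> True"
| "thin [y] \<longleftrightarrow> 0 < len y"
| "thin (y # z # zs) \<longleftrightarrow>
    cancel y z < len y \<and> cancel y z + cancel_next z zs < len z \<and> thin (z # zs)"

text \<open>The parameter \<open>k\<close> stands for the cancellation caused by a factor in front of
\<open>y\<close>. The second conjunct says that the product still starts with more than \<open>k\<close>
letters of \<open>y\<close>, so that this cancellation does not see the rest of the product; it makes
the induction work.\<close>

lemma thin_sum_list:
  assumes "thin (y # zs)" "k + cancel_next y zs < len y"
  shows "Suc (length zs) + k \<le> len (sum_list (y # zs)) \<and> k < gp 0 y (sum_list (y # zs))"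
  using assms
proof (induction zs arbitrary: y k)
  case Nil
  then show ?case using gp_dist[of y y 0] by (simp add: dist_len_def)
next
  case (Cons z zs)
  define P where "P = sum_list (z # zs)"
  have IH: "Suc (length zs) + cancel y z \<le> len P" "cancel y z < gp 0 z P"
    using Cons.IH[of z "cancel y z"] Cons.prems by (auto simp: P_def)
  have c: "cancel y P = cancel y z"
    using gp_ultra[of 0 "- y" P z] gp_ultra[of 0 "- y" z P] IH(2)
    by (simp add: cancel_def gp_commute)
  have "len (y + P) + 2 * cancel y z = len y + len P"
    using len_add[of y P] c by simp
  moreover have "dist_len y (y + P) = len P"
    by (simp add: dist_len_def flip: add.assoc)
  then have "len P + 2 * gp 0 y (y + P) = len y + len (y + P)"
    using gp_dist[of y "y + P" 0] by simp
  ultimately show ?case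
    using IH(1) Cons.prems(2) by (simp add: P_def)
qed

lemma length_le_thin_sum_list: "thin ys \<Longrightarrow> length ys \<le> len (sum_list ys)"
proof (cases ys rule: thin.cases)
  case (2 y)
  then show "thin ys \<Longrightarrow> ?thesis" by (simp add: Suc_le_eq)
next
  case (3 y z zs)
  then show "thin ys \<Longrightarrow> ?thesis"
    using thin_sum_list[of y "z # zs" 0] by simp
qed simp

primrec multiple :: "nat \<Rightarrow> 'a :: group_add \<Rightarrow> 'a" where
  "multiple 0 x = 0"
| "multiple (Suc m) x = x + multiple m x"

lemma multiple_add: "multiple (m + k) x = multiple m x + multiple k x"
  by (induction m) (simp_all add: add.assoc)

lemma multiple_conj: "multiple m (g + x - g) = g + multiple m x - g"
  by (induction m) (simp_all add: add.assoc diff_conv_add_uminus del: add_uminus_conv_diff)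

lemma multiple_eq_sum_list: "multiple m x = sum_list (replicate m x)"
  by (induction m) simp_all

text \<open>Powers of a nontrivial element leave every ball, since a repeated factor gives a thin
product.\<close>

lemma le_len_multiple:
  assumes "x \<noteq> 0"
  shows "m \<le> len (multiple m x)"
proof -
  have "thin (replicate m x)"
  proof (induction m)
    case (Suc m)
    then show ?case
      using two_cancel_self_less[OF assms] assms by (cases m; cases "m - 1") auto
  qed simp
  then show ?thesis
    using length_le_thin_sum_list[of "replicate m x"] by (simp add: multiple_eq_sum_list)
qed

text \<open>The powers of a cyclically reduced element lie on a geodesic through the base vertex.\<close>

lemma len_multiple_cyclically_reduced:
  assumes "cancel x x = 0"
  shows "len (multiple m x) = m * len x"
proof (cases "x = 0")
  case True
  then show ?thesis by (induction m) auto
next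
  case False
  have "len (multiple m x) = m * len x \<and> (m > 0 \<longrightarrow> gp 0 x (multiple m x) = len x)"
  proof (induction m)
    case (Suc m)
    have c: "cancel x (multiple m x) = 0"
    proof (cases m)
      case 0
      then show ?thesis by (simp add: cancel_def gp_def)
    next
      case (Suc k)
      then show ?thesis
        using Suc.IH assms False gp_ultra[of 0 "- x" "multiple m x" x]
        by (auto simp: cancel_def gp_commute min_def split: if_splits)
    qed
    have "len (x + multiple m x) = len x + m * len x"
      using len_add[of x "multiple m x"] c Suc.IH by simp
    moreover have "dist_len x (x + multiple m x) = m * len x"
      using Suc.IH by (simp add: dist_len_def flip: add.assoc)
    ultimately show ?case
      using gp_dist[of x "x + multiple m x" 0] by simp
  qed simp
  then show ?thesis by simp
qed

section \<open>Free groups of finite rank and their homomorphisms\<close>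

text \<open>The free group of rank \<open>n\<close>, as a subset of the group of all reduced words.\<close>

definition F :: "nat \<Rightarrow> freegrp set" where
  "F n = {x. fst ` set (letters x) \<subseteq> {..<n}}"

lemma F_zero [simp]: "0 \<in> F n"
  by (simp add: F_def)

lemma F_uminus [simp]: "- x \<in> F n \<longleftrightarrow> x \<in> F n"
  by (simp add: F_def letters_uminus image_image)

lemma F_add [simp]: "x \<in> F n \<Longrightarrow> y \<in> F n \<Longrightarrow> x + y \<in> F n"
  using set_foldr_push[of "letters x" "letters y"] by (fastforce simp: F_def letters_add)

lemma F_diff [simp]: "x \<in> F n \<Longrightarrow> y \<in> F n \<Longrightarrow> x - y \<in> F n"
  by (metis F_add F_uminus add_uminus_conv_diff)

lemma F_letter [simp]: "letter l \<in> F n \<longleftrightarrow> fst l < n"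
  by (simp add: F_def)

lemma F_word: "fst ` set w \<subseteq> {..<n} \<Longrightarrow> word w \<in> F n"
  by (induction w) auto

lemma F_mono: "m \<le> n \<Longrightarrow> F m \<subseteq> F n"
  by (force simp: F_def)

lemma F_multiple [simp]: "x \<in> F n \<Longrightarrow> multiple m x \<in> F n"
  by (induction m) auto

lemma F_induct [consumes 1, case_names zero add]:
  assumes "x \<in> F n" "P 0"
    and "\<And>l y. fst l < n \<Longrightarrow> y \<in> F n \<Longrightarrow> P y \<Longrightarrow> P (letter l + y)"
  shows "P x"
proof -
  have "P (word w)" if "fst ` set w \<subseteq> {..<n}" for w
    using that by (induction w) (auto intro!: assms F_word)
  then show ?thesis
    using assms(1) by (metis (mono_tags) F_def mem_Collect_eq word_letters)
qed

lemma finite_ball: "finite {x \<in> F n. len x \<le> C}"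
proof -
  have "finite {w. set w \<subseteq> {..<n} \<times> (UNIV :: bool set) \<and> length w \<le> C}"
    by (rule finite_lists_length_le) simp
  moreover have "letters ` {x \<in> F n. len x \<le> C}
      \<subseteq> {w. set w \<subseteq> {..<n} \<times> (UNIV :: bool set) \<and> length w \<le> C}"
    by (force simp: F_def)
  ultimately have "finite (letters ` {x \<in> F n. len x \<le> C})"
    by (rule finite_subset[rotated])
  then show ?thesis
    by (rule finite_imageD) (simp add: inj_on_def letters_inject)
qed

definition letter_value :: "(nat \<Rightarrow> 'k :: group_add) \<Rightarrow> letter \<Rightarrow> 'k" where
  "letter_value f l = (if snd l then f (fst l) else - f (fst l))"

text \<open>The homomorphism that is given by its values on the generators.\<close>

definition extend :: "(nat \<Rightarrow> 'k :: group_add) \<Rightarrow> freegrp \<Rightarrow> 'k" where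
  "extend f x = sum_list (map (letter_value f) (letters x))"

lemma letter_value_inv: "letter_value f (inv_letter l) = - letter_value f l"
  by (simp add: letter_value_def inv_letter_def)

lemma extend_add: "extend f (x + y) = extend f x + extend f y"
proof -
  have push: "sum_list (map (letter_value f) (push_letter l w))
      = letter_value f l + sum_list (map (letter_value f) w)" for l w
    by (cases w) (auto simp: letter_value_inv add.assoc[symmetric])
  have "sum_list (map (letter_value f) (foldr push_letter u w))
      = sum_list (map (letter_value f) u) + sum_list (map (letter_value f) w)" for u w
    by (induction u) (simp_all add: push add.assoc)
  then show ?thesis by (simp add: extend_def letters_add)
qed

text \<open>Maps are homomorphisms only on \<open>F n\<close>; their values elsewhere are arbitrary. The
target may be any group, since homomorphisms to the group of order two are used to count generators.\<close>

definition hom_on :: "nat \<Rightarrow> (freegrp \<Rightarrow> 'k :: group_add) \<Rightarrow> bool" where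
  "hom_on n f \<longleftrightarrow> (\<forall>x\<in>F n. \<forall>y\<in>F n. f (x + y) = f x + f y)"

lemma hom_on_add: "hom_on n f \<Longrightarrow> x \<in> F n \<Longrightarrow> y \<in> F n \<Longrightarrow> f (x + y) = f x + f y"
  by (simp add: hom_on_def)

lemma hom_on_zero: "hom_on n f \<Longrightarrow> f 0 = 0"
  using hom_on_add[of n f 0 0] add_left_cancel[of "f 0" "f 0" 0] by simp

lemma hom_on_uminus:
  assumes "hom_on n f" "x \<in> F n" shows "f (- x) = - f x"
  using hom_on_add[OF assms(1), of "- x" x] assms(2) hom_on_zero[OF assms(1)]
  by (simp add: eq_neg_iff_add_eq_0)

lemma hom_on_diff:
  assumes "hom_on n f" "x \<in> F n" "y \<in> F n" shows "f (x - y) = f x - f y"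
  using hom_on_add[OF assms(1), of x "- y"] hom_on_uminus[OF assms(1,3)] assms
  by simp

lemma hom_on_multiple:
  "hom_on n f \<Longrightarrow> x \<in> F n \<Longrightarrow> f (multiple m x) = multiple m (f x)"
  by (induction m) (simp_all add: hom_on_zero hom_on_add)

lemma hom_on_mono: "hom_on n f \<Longrightarrow> m \<le> n \<Longrightarrow> hom_on m f"
  using F_mono[of m n] by (auto simp: hom_on_def)

lemma hom_on_comp:
  "hom_on n f \<Longrightarrow> hom_on m g \<Longrightarrow> g ` F m \<subseteq> F n \<Longrightarrow> hom_on m (\<lambda>x. f (g x))"
  by (simp add: hom_on_def image_subset_iff)

lemma hom_on_letter:
  assumes "hom_on n f" "fst l < n" shows "f (letter l) = letter_value (\<lambda>i. f (gen i)) l"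
  using hom_on_uminus[OF assms(1), of "gen (fst l)"] assms(2)
  by (cases l; cases "snd l") (auto simp: letter_value_def letter_False)

lemma hom_on_eqI:
  assumes "hom_on n f" "hom_on n g" "\<And>i. i < n \<Longrightarrow> f (gen i) = g (gen i)" "x \<in> F n"
  shows "f x = g x"
  using assms(4)
proof (induction x rule: F_induct)
  case zero
  then show ?case by (simp add: hom_on_zero[OF assms(1)] hom_on_zero[OF assms(2)])
next
  case (add l y)
  then have "f (letter l) = g (letter l)"
    using hom_on_letter[OF assms(1) add(1)] hom_on_letter[OF assms(2) add(1)]
    by (simp add: assms(3) letter_value_def)
  with add show ?case
    by (simp add: hom_on_add[OF assms(1)] hom_on_add[OF assms(2)])
qed

lemma hom_on_extend: "hom_on n (extend f)"
  by (simp add: hom_on_def extend_add)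

lemma extend_gen [simp]: "extend f (gen i) = f i"
  by (simp add: extend_def letter_value_def)

lemma extend_closed:
  assumes "x \<in> F n" "\<And>i. i < n \<Longrightarrow> f i \<in> H" "0 \<in> H"
    and "\<And>a b. a \<in> H \<Longrightarrow> b \<in> H \<Longrightarrow> a + b \<in> H" "\<And>a. a \<in> H \<Longrightarrow> - a \<in> H"
  shows "extend f x \<in> H"
  using assms(1)
proof (induction x rule: F_induct)
  case zero
  then show ?case using assms(3) hom_on_zero[OF hom_on_extend] by metis
next
  case (add l y)
  then have "extend f (letter l) \<in> H"
    using assms(2,5) hom_on_letter[OF hom_on_extend add(1), of f] by (simp add: letter_value_def)
  then show ?case using add assms(4) by (simp add: extend_add)
qed

lemma hom_on_lipschitz:
  fixes f :: "freegrp \<Rightarrow> freegrp"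
  assumes "hom_on n f"
  obtains L where "\<And>x. x \<in> F n \<Longrightarrow> len (f x) \<le> L * len x"
proof
  define L where "L = (\<Sum>i<n. len (f (gen i)))"
  have gen: "len (f (letter l)) \<le> L" if "fst l < n" for l
  proof -
    have "len (f (letter l)) = len (f (gen (fst l)))"
      using hom_on_letter[OF assms that] by (auto simp: letter_value_def)
    also have "\<dots> \<le> L"
      unfolding L_def using that by (intro member_le_sum) auto
    finally show ?thesis .
  qed
  fix x assume x: "x \<in> F n"
  have "len (f (word w)) \<le> L * length w" if "fst ` set w \<subseteq> {..<n}" for w
    using that
  proof (induction w)
    case Nil
    then show ?case by (simp add: hom_on_zero[OF assms])
  next
    case (Cons l w)
    have "f (word (l # w)) = f (letter l) + f (word w)"
      using Cons.prems by (simp add: hom_on_add[OF assms] F_word)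
    then show ?case
      using len_add_le[of "f (letter l)" "f (word w)"] gen[of l] Cons by fastforce
  qed
  then show "len (f x) \<le> L * len x"
    using x by (metis (mono_tags) F_def mem_Collect_eq word_letters)
qed

definition aut_on :: "nat \<Rightarrow> (freegrp \<Rightarrow> freegrp) \<Rightarrow> bool" where
  "aut_on n f \<longleftrightarrow> hom_on n f \<and> bij_betw f (F n) (F n)"

lemma aut_on_hom: "aut_on n f \<Longrightarrow> hom_on n f"
  by (simp add: aut_on_def)

lemma aut_on_bij: "aut_on n f \<Longrightarrow> bij_betw f (F n) (F n)"
  by (simp add: aut_on_def)

lemma aut_on_image: "aut_on n f \<Longrightarrow> f ` F n = F n"
  by (simp add: aut_on_def bij_betw_def)

lemma aut_on_closed: "aut_on n f \<Longrightarrow> x \<in> F n \<Longrightarrow> f x \<in> F n"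
  using aut_on_image by blast

lemma aut_on_inj: "aut_on n f \<Longrightarrow> x \<in> F n \<Longrightarrow> y \<in> F n \<Longrightarrow> f x = f y \<longleftrightarrow> x = y"
  by (auto simp: aut_on_def bij_betw_def inj_on_def)

lemma aut_on_eq_0: "aut_on n f \<Longrightarrow> x \<in> F n \<Longrightarrow> f x = 0 \<longleftrightarrow> x = 0"
  using aut_on_inj[of n f x 0] hom_on_zero[of n f] by (simp add: aut_on_def)

lemma aut_on_byWitness:
  assumes "hom_on n f" "\<And>x. x \<in> F n \<Longrightarrow> f x \<in> F n" "\<And>x. x \<in> F n \<Longrightarrow> g x \<in> F n"
    "\<And>x. x \<in> F n \<Longrightarrow> f (g x) = x" "\<And>x. x \<in> F n \<Longrightarrow> g (f x) = x"
  shows "aut_on n f"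
  using assms by (auto simp: aut_on_def intro!: bij_betw_byWitness[where f' = g])

definition inverse_on :: "nat \<Rightarrow> (freegrp \<Rightarrow> freegrp) \<Rightarrow> freegrp \<Rightarrow> freegrp" where
  "inverse_on n f = inv_into (F n) f"

lemma inverse_on:
  assumes "aut_on n f" "x \<in> F n"
  shows "f (inverse_on n f x) = x" "inverse_on n f (f x) = x" "inverse_on n f x \<in> F n"
  using assms unfolding inverse_on_def aut_on_def
  by (auto simp: bij_betw_def f_inv_into_f inv_into_into)

lemma aut_on_inverse: "aut_on n f \<Longrightarrow> aut_on n (inverse_on n f)"
proof (rule aut_on_byWitness[where g = f])
  assume f: "aut_on n f"
  show "hom_on n (inverse_on n f)"
    unfolding hom_on_def
  proof (intro ballI)
    fix x y assume xy: "x \<in> F n" "y \<in> F n"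
    let ?g = "inverse_on n f"
    have "f (?g (x + y)) = f (?g x + ?g y)"
      using xy by (simp add: inverse_on[OF f] hom_on_add[OF aut_on_hom[OF f]])
    then show "?g (x + y) = ?g x + ?g y"
      using xy by (simp add: aut_on_inj[OF f] inverse_on[OF f])
  qed
qed (simp_all add: inverse_on aut_on_closed)

lemma aut_on_comp: "aut_on n f \<Longrightarrow> aut_on n g \<Longrightarrow> aut_on n (\<lambda>x. f (g x))"
  using bij_betw_trans[of g "F n" "F n" f "F n"] hom_on_comp[of n f n g]
  by (auto simp: aut_on_def comp_def bij_betw_def)

lemma aut_on_conj: "g \<in> F n \<Longrightarrow> aut_on n (\<lambda>x. g + x - g)"
  by (rule aut_on_byWitness[where g = "\<lambda>x. - g + x + g"])
    (simp_all add: hom_on_def add.assoc diff_conv_add_uminus del: add_uminus_conv_diff)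

section \<open>Bounded cancellation\<close>

definition prefix_elem :: "nat \<Rightarrow> freegrp \<Rightarrow> freegrp" where
  "prefix_elem i x = word (take i (letters x))"

lemma letters_prefix_elem [simp]: "letters (prefix_elem i x) = take i (letters x)"
  using letters_split(2)[of x "take i (letters x)" "drop i (letters x)"]
  by (simp add: prefix_elem_def)

lemma prefix_elem_eq [simp]: "prefix_elem (len x) x = x" "prefix_elem 0 x = 0"
  by (simp_all add: prefix_elem_def)

lemma F_prefix_elem [simp]: "x \<in> F n \<Longrightarrow> prefix_elem i x \<in> F n"
  by (auto simp: F_def dest: in_set_takeD)

lemma lcp_take: "lcp (take i u) v = min i (lcp u v)"
  by (induction u v arbitrary: i rule: lcp.induct) (auto simp: take_Cons' min_def)

lemma gp_prefix_elem: "gp 0 (prefix_elem i x) y = min i (gp 0 x y)"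
  by (simp add: gp_def lcp_take)

lemma gp_prefix_elem': "gp 0 x (prefix_elem i y) = min i (gp 0 x y)"
  by (metis gp_commute gp_prefix_elem)

lemma gp_0_self [simp]: "gp 0 x x = len x"
  using gp_dist[of x x 0] by simp

lemma gp_0_le: "gp 0 x y \<le> len x" "gp 0 x y \<le> len y"
  by (simp_all add: gp_def lcp_le)

lemma dist_len_prefix_elem: "dist_len (prefix_elem i x) (prefix_elem (Suc i) x) \<le> 1"
  using gp_dist[of "prefix_elem i x" "prefix_elem (Suc i) x" 0]
  by (simp add: gp_prefix_elem gp_commute[of 0 x] min_def split: if_splits)

lemma dist_len_hom:
  assumes "hom_on n f" "x \<in> F n" "y \<in> F n"
  shows "dist_len (f x) (f y) = len (f (- x + y))"
  using assms by (simp add: dist_len_def hom_on_add hom_on_uminus)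

text \<open>The image of the geodesic from \<open>0\<close> to \<open>x\<close> is a path with steps of
length at most \<open>L\<close> that ends beyond the vertex \<open>W\<close>. In a tree it has to pass
through \<open>W\<close>, and the first vertex of the image beyond \<open>W\<close> is at distance at
most \<open>L\<close>.\<close>

lemma image_path_near_prefix:
  assumes f: "hom_on n f" and L: "\<And>x. x \<in> F n \<Longrightarrow> len (f x) \<le> L * len x"
    and x: "x \<in> F n" and W: "gp 0 (f x) W = len W"
  obtains i where "i \<le> len x" "dist_len W (f (prefix_elem i x)) \<le> L"
proof -
  define P where "P i \<longleftrightarrow> len W \<le> gp 0 (f (prefix_elem i x)) W" for i
  have "P (len x)" using W by (simp add: P_def)
  then obtain i where i: "i \<le> len x" "P i" "\<And>j. j < i \<Longrightarrow> \<not> P j"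
    by (metis LeastI Least_le not_less_Least)
  have "dist_len W (f (prefix_elem i x)) \<le> L"
  proof (cases i)
    case 0
    then have "len W = 0"
      using i(2) hom_on_zero[OF f] gp_0_le(1)[of 0 W] by (simp add: P_def)
    then show ?thesis using 0 hom_on_zero[OF f] by simp
  next
    case (Suc j)
    define a b where "a = f (prefix_elem j x)" and "b = f (prefix_elem i x)"
    have "gp 0 a W < len W" "gp 0 b W = len W"
      using i(2) i(3)[of j] Suc gp_0_le(2)[of b W] by (auto simp: P_def a_def b_def)
    then have "gp 0 a b < len W"
      using gp_ultra[of 0 a b W] by simp
    moreover have "dist_len a b \<le> L"
    proof -
      have "dist_len a b = len (f (- prefix_elem j x + prefix_elem i x))"
        unfolding a_def b_def using x by (intro dist_len_hom[OF f]) simp_all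
      also have "\<dots> \<le> L * len (- prefix_elem j x + prefix_elem i x)"
        using x by (intro L) simp
      also have "\<dots> \<le> L * 1"
        using dist_len_prefix_elem[of j x] Suc by (intro mult_le_mono2) (simp add: dist_len_def)
      finally show ?thesis by simp
    qed
    ultimately show ?thesis
      using gp_dist[of a b 0] gp_dist[of W b 0] gp_0_le(1)[of a b] \<open>gp 0 b W = len W\<close>
      by (simp add: gp_commute b_def)
  qed
  with i(1) that show thesis by blast
qed

text \<open>Suppose that \<open>W\<close> is the branch point of the images of \<open>x\<close> and
\<open>y\<close>. Both image paths pass near \<open>W\<close>, at points with preimages on the geodesics
to \<open>x\<close> and \<open>y\<close>. These preimages are close to each other because the inverse of
\<open>f\<close> is Lipschitz, and the two geodesics separate after \<open>k\<close> steps, so the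
preimages are close to \<open>0\<close>.\<close>

lemma bounded_cancellation_at_0:
  assumes f: "hom_on n f" and L: "\<And>x. x \<in> F n \<Longrightarrow> len (f x) \<le> L * len x"
    and L': "\<And>x. x \<in> F n \<Longrightarrow> len x \<le> L * len (f x)"
    and x: "x \<in> F n" and y: "y \<in> F n" and k: "gp 0 x y \<le> k"
  shows "gp 0 (f x) (f y) \<le> L * (2 * L * L + 2 * k) + L"
proof -
  define W where "W = prefix_elem (gp 0 (f x) (f y)) (f x)"
  have W: "len W = gp 0 (f x) (f y)"
    by (simp add: W_def gp_0_le min_absorb2)
  have "gp 0 (f x) W = len W" "gp 0 (f y) W = len W"
    using W gp_0_le(1)[of "f x" "f y"]
    by (simp_all add: W_def gp_prefix_elem' gp_commute[of 0 "f y"])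
  then obtain i j where
    i: "i \<le> len x" "dist_len W (f (prefix_elem i x)) \<le> L" and
    j: "j \<le> len y" "dist_len W (f (prefix_elem j y)) \<le> L"
    using image_path_near_prefix[OF f L x] image_path_near_prefix[OF f L y] by metis
  define a b where "a = prefix_elem i x" and "b = prefix_elem j y"
  have ab: "a \<in> F n" "b \<in> F n" "len a = i" "len b = j"
    using x y i(1) j(1) by (simp_all add: a_def b_def)
  have "dist_len (f a) (f b) \<le> 2 * L"
    using dist_len_triangle[of "f a" "f b" W] dist_len_commute[of W "f a"] i(2) j(2)
    by (simp add: a_def b_def)
  moreover have "dist_len a b \<le> L * dist_len (f a) (f b)"
    using ab L'[of "- a + b"] by (simp add: dist_len_hom[OF f]) (simp add: dist_len_def)
  ultimately have "dist_len a b \<le> L * (2 * L)"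
    by (meson le_trans mult_le_mono2)
  moreover have "gp 0 a b \<le> k"
    using k by (simp add: a_def b_def gp_prefix_elem gp_prefix_elem')
  ultimately have "i \<le> 2 * L * L + 2 * k"
    using gp_dist[of a b 0] ab by (simp add: algebra_simps)
  then have "L * len a \<le> L * (2 * L * L + 2 * k)"
    using ab(3) by simp
  moreover have "len (f a) \<le> L * len a"
    using L[OF ab(1)] .
  moreover have "len W \<le> L + len (f a)"
    using dist_len_triangle[of W 0 "f a"] i(2) by (simp add: a_def)
  ultimately show ?thesis using W by linarith
qed

lemma aut_on_bilipschitz:
  assumes "aut_on n f"
  obtains L where "\<And>x. x \<in> F n \<Longrightarrow> len (f x) \<le> L * len x"
    "\<And>x. x \<in> F n \<Longrightarrow> len x \<le> L * len (f x)"
proof -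
  obtain A where A: "\<And>x. x \<in> F n \<Longrightarrow> len (f x) \<le> A * len x"
    using hom_on_lipschitz[OF aut_on_hom[OF assms]] by blast
  obtain B where B: "\<And>x. x \<in> F n \<Longrightarrow> len (inverse_on n f x) \<le> B * len x"
    using hom_on_lipschitz[OF aut_on_hom[OF aut_on_inverse[OF assms]]] by blast
  show thesis
  proof (rule that)
    fix x assume x: "x \<in> F n"
    show "len (f x) \<le> max A B * len x"
      using A[OF x] mult_le_mono1[of A "max A B" "len x"] by linarith
    have "len x \<le> B * len (f x)"
      using B[OF aut_on_closed[OF assms x]] x by (simp add: inverse_on[OF assms])
    then show "len x \<le> max A B * len (f x)"
      using mult_le_mono1[of B "max A B" "len (f x)"] by linarith
  qed
qed

lemma bounded_cancellation:
  assumes "aut_on n f"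
  obtains D where "\<And>v x y. v \<in> F n \<Longrightarrow> x \<in> F n \<Longrightarrow> y \<in> F n \<Longrightarrow> gp v x y \<le> k \<Longrightarrow>
    gp (f v) (f x) (f y) \<le> D"
proof -
  obtain L where L: "\<And>x. x \<in> F n \<Longrightarrow> len (f x) \<le> L * len x"
      "\<And>x. x \<in> F n \<Longrightarrow> len x \<le> L * len (f x)"
    using aut_on_bilipschitz[OF assms] by blast
  note f = aut_on_hom[OF assms]
  show thesis
  proof (rule that)
    fix v x y assume *: "v \<in> F n" "x \<in> F n" "y \<in> F n" "gp v x y \<le> k"
    have "gp 0 (- v + x) (- v + y) \<le> k"
      using *(4) by (simp add: gp_def)
    then have "gp 0 (f (- v + x)) (f (- v + y)) \<le> L * (2 * L * L + 2 * k) + L"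
      using * by (intro bounded_cancellation_at_0[OF f L]) simp_all
    then show "gp (f v) (f x) (f y) \<le> L * (2 * L * L + 2 * k) + L"
      using * by (simp add: hom_on_add[OF f] hom_on_uminus[OF f] gp_def)
  qed
qed

section \<open>The gate of a free splitting\<close>

text \<open>A vertex \<open>v\<close> at distance at most \<open>C\<close> from the lines from
\<open>\<xi>\<close> to \<open>\<xi>'\<close> and to all \<open>h \<xi>\<close>, \<open>h \<in> H -
{0}\<close>, where \<open>\<xi>\<close> and \<open>\<xi>'\<close> are the limits of the positive and
negative powers of \<open>t\<close>, and also from one of the lines from \<open>\<xi>'\<close> to
\<open>h \<xi>\<close>: the first two conditions hold along a ray to \<open>\<xi>\<close>, and the third
keeps \<open>v\<close> at its start. An end is expressed by powers of \<open>t\<close> with large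
exponents. In the third condition arbitrarily large exponents are enough for uniqueness and are easier
to produce than all large ones.\<close>

definition gate :: "nat \<Rightarrow> freegrp set \<Rightarrow> freegrp \<Rightarrow> freegrp \<Rightarrow> bool" where
  "gate C H t v \<longleftrightarrow>
    (\<exists>N. \<forall>m\<ge>N. \<forall>k\<ge>N. gp v (multiple m t) (- multiple k t) \<le> C) \<and>
    (\<forall>h\<in>H - {0}. \<exists>N. \<forall>m\<ge>N. \<forall>k\<ge>N. gp v (multiple m t) (h + multiple k t) \<le> C) \<and>
    (\<exists>h\<in>H - {0}. \<forall>N. \<exists>m\<ge>N. \<exists>k\<ge>N. gp v (h + multiple m t) (- multiple k t) \<le> C)"

lemma gateD:
  assumes "gate C H t v"
  shows "\<exists>N. \<forall>m\<ge>N. \<forall>k\<ge>N. gp v (multiple m t) (- multiple k t) \<le> C"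
    and "h \<in> H - {0} \<Longrightarrow> \<exists>N. \<forall>m\<ge>N. \<forall>k\<ge>N. gp v (multiple m t) (h + multiple k t) \<le> C"
    and "\<exists>h\<in>H - {0}. \<forall>N. \<exists>m\<ge>N. \<exists>k\<ge>N. gp v (h + multiple m t) (- multiple k t) \<le> C"
proof -
  note gate = assms[unfolded gate_def]
  show "\<exists>N. \<forall>m\<ge>N. \<forall>k\<ge>N. gp v (multiple m t) (- multiple k t) \<le> C"
    by (rule conjunct1[OF gate])
  show "\<exists>N. \<forall>m\<ge>N. \<forall>k\<ge>N. gp v (multiple m t) (h + multiple k t) \<le> C" if "h \<in> H - {0}"
    by (rule bspec[OF conjunct1[OF conjunct2[OF gate]] that])
  show "\<exists>h\<in>H - {0}. \<forall>N. \<exists>m\<ge>N. \<exists>k\<ge>N. gp v (h + multiple m t) (- multiple k t) \<le> C"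
    by (rule conjunct2[OF conjunct2[OF gate]])
qed

text \<open>Both \<open>v\<close> and \<open>w\<close> are near centres of tripods with one common end
\<open>x\<close>: \<open>x, a, b\<close> for \<open>v\<close> and \<open>x, c, d\<close> for
\<open>w\<close>. If \<open>v\<close> and \<open>w\<close> were far apart, each would lie between the
other and \<open>x\<close>.\<close>

lemma tree_center_unique:
  assumes v: "gp v x a \<le> C" "gp v x b \<le> C" "gp v x c \<le> C" "gp v x d \<le> C" "gp v a b \<le> C"
    and w: "gp w x a \<le> C" "gp w x b \<le> C" "gp w x c \<le> C" "gp w x d \<le> C" "gp w c d \<le> C"
  shows "dist_len v w \<le> 2 * C"
proof -
  \<comment> \<open>If \<open>v\<close> is not near the geodesic from \<open>w\<close> to \<open>x\<close>, then \<open>c\<close> and \<open>d\<close> are seen from \<open>w\<close> in the direction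
    of \<open>v\<close>, so \<open>w\<close> cannot be near the geodesic between them unless it is near \<open>v\<close>.\<close>
  have side: "dist_len v w \<le> 2 * C \<or> gp v x w \<le> C"
    if "gp v x c \<le> C" "gp v x d \<le> C" "gp w c d \<le> C" for v w c d
  proof (rule ccontr)
    assume neg: "\<not> ?thesis"
    then have "gp v w c \<le> C" "gp v w d \<le> C"
      using gp_ultra[of v x w c] gp_ultra[of v x w d] that by auto
    moreover have "gp w c v \<le> C \<or> gp w v d \<le> C"
      using gp_ultra[of w c v d] that by auto
    ultimately show False
      using neg gp_dist[of w c v] gp_dist[of c v w] gp_dist[of w d v] gp_dist[of v d w]
        dist_len_commute[of v w] dist_len_commute[of c v] dist_len_commute[of d v] by auto
  qed
  have "dist_len v w \<le> 2 * C \<or> gp v x w \<le> C"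
    using side[of v c d w] v w by blast
  moreover have "dist_len w v \<le> 2 * C \<or> gp w x v \<le> C"
    using side[of w a b v] v w by blast
  ultimately show ?thesis
    using gp_dist[of x w v] gp_dist[of x v w] dist_len_commute[of v w]
      dist_len_commute[of v x] dist_len_commute[of w x] by linarith
qed

lemma gate_unique:
  assumes v: "gate C H t v" and w: "gate C H t w"
  shows "dist_len v w \<le> 2 * C"
proof -
  obtain h where h: "h \<in> H - {0}"
    "\<forall>N. \<exists>m\<ge>N. \<exists>k\<ge>N. gp v (h + multiple m t) (- multiple k t) \<le> C"
    using gateD(3)[OF v] by (rule bexE)
  obtain h' where h': "h' \<in> H - {0}"
    "\<forall>N. \<exists>m\<ge>N. \<exists>k\<ge>N. gp w (h' + multiple m t) (- multiple k t) \<le> C"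
    using gateD(3)[OF w] by (rule bexE)
  have line: "\<exists>N. \<forall>m\<ge>N. \<forall>k\<ge>N. gp u (multiple m t) (- multiple k t) \<le> C \<and>
      gp u (multiple m t) (h + multiple k t) \<le> C \<and> gp u (multiple m t) (h' + multiple k t) \<le> C"
    if u: "gate C H t u" for u
  proof -
    obtain N1 N2 N3 where N:
      "\<forall>m\<ge>N1. \<forall>k\<ge>N1. gp u (multiple m t) (- multiple k t) \<le> C"
      "\<forall>m\<ge>N2. \<forall>k\<ge>N2. gp u (multiple m t) (h + multiple k t) \<le> C"
      "\<forall>m\<ge>N3. \<forall>k\<ge>N3. gp u (multiple m t) (h' + multiple k t) \<le> C"
      using gateD(1)[OF u] gateD(2)[OF u h(1)] gateD(2)[OF u h'(1)] by (elim exE) rule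
    show ?thesis by (rule exI[of _ "max N1 (max N2 N3)"]) (use N in simp)
  qed
  obtain N N' where
    N: "\<And>m k. m \<ge> N \<Longrightarrow> k \<ge> N \<Longrightarrow> gp v (multiple m t) (- multiple k t) \<le> C \<and>
      gp v (multiple m t) (h + multiple k t) \<le> C \<and> gp v (multiple m t) (h' + multiple k t) \<le> C" and
    N': "\<And>m k. m \<ge> N' \<Longrightarrow> k \<ge> N' \<Longrightarrow> gp w (multiple m t) (- multiple k t) \<le> C \<and>
      gp w (multiple m t) (h + multiple k t) \<le> C \<and> gp w (multiple m t) (h' + multiple k t) \<le> C"
    using line[OF v] line[OF w] by metis
  define M where "M = max N N'"
  obtain m k where mk: "m \<ge> M" "k \<ge> M" "gp v (h + multiple m t) (- multiple k t) \<le> C"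
    using h(2) by blast
  obtain m' k' where mk': "m' \<ge> M" "k' \<ge> M" "gp w (h' + multiple m' t) (- multiple k' t) \<le> C"
    using h'(2) by blast
  show ?thesis
    by (rule tree_center_unique[of v "multiple M t" "h + multiple m t" C "- multiple k t"
          "h' + multiple m' t" "- multiple k' t"])
      (use mk mk' N[of M] N'[of M] in \<open>auto simp: M_def\<close>)
qed

text \<open>For a map of trees that sends \<open>v\<close>, the subgroup and the powers of
\<open>t\<close> to their counterparts, gates correspond if the Gromov products in the definition do.
Only large exponents matter, with a threshold \<open>B h\<close> that may depend on \<open>h\<close>.\<close>

lemma gate_transfer:
  assumes gate: "gate C H t v" and zero: "\<And>h. h \<in> H \<Longrightarrow> f h = 0 \<longleftrightarrow> h = 0"
    and c1: "\<And>m k. m \<ge> B 0 \<Longrightarrow> k \<ge> B 0 \<Longrightarrow> gp v (multiple m t) (- multiple k t) \<le> C \<Longrightarrow>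
      gp v' (multiple m t') (- multiple k t') \<le> C'"
    and c2: "\<And>h m k. h \<in> H \<Longrightarrow> m \<ge> B h \<Longrightarrow> k \<ge> B h \<Longrightarrow>
      gp v (multiple m t) (h + multiple k t) \<le> C \<Longrightarrow>
      gp v' (multiple m t') (f h + multiple k t') \<le> C'"
    and c3: "\<And>h m k. h \<in> H \<Longrightarrow> m \<ge> B h \<Longrightarrow> k \<ge> B h \<Longrightarrow>
      gp v (h + multiple m t) (- multiple k t) \<le> C \<Longrightarrow>
      gp v' (f h + multiple m t') (- multiple k t') \<le> C'"
  shows "gate C' (f ` H) t' v'"
  unfolding gate_def
proof (intro conjI ballI)
  obtain N where "\<forall>m\<ge>N. \<forall>k\<ge>N. gp v (multiple m t) (- multiple k t) \<le> C"
    using gateD(1)[OF gate] by (rule exE)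
  then show "\<exists>N. \<forall>m\<ge>N. \<forall>k\<ge>N. gp v' (multiple m t') (- multiple k t') \<le> C'"
    using c1 by (intro exI[of _ "max N (B 0)"]) simp
  fix h' assume "h' \<in> f ` H - {0}"
  then obtain h where h: "h \<in> H - {0}" "h' = f h" using zero by auto
  obtain N where "\<forall>m\<ge>N. \<forall>k\<ge>N. gp v (multiple m t) (h + multiple k t) \<le> C"
    using gateD(2)[OF gate h(1)] by (rule exE)
  then show "\<exists>N. \<forall>m\<ge>N. \<forall>k\<ge>N. gp v' (multiple m t') (h' + multiple k t') \<le> C'"
    using c2 h by (intro exI[of _ "max N (B h)"]) simp
next
  obtain h where h: "h \<in> H - {0}"
    "\<forall>N. \<exists>m\<ge>N. \<exists>k\<ge>N. gp v (h + multiple m t) (- multiple k t) \<le> C"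
    using gateD(3)[OF gate] by (rule bexE)
  have "\<exists>m\<ge>N. \<exists>k\<ge>N. gp v' (f h + multiple m t') (- multiple k t') \<le> C'" for N
    using spec[OF h(2), of "max N (B h)"] c3[of h] h(1) by (metis DiffD1 max.bounded_iff)
  moreover have "f h \<in> f ` H - {0}" using h(1) zero by auto
  ultimately show "\<exists>h\<in>f ` H - {0}. \<forall>N. \<exists>m\<ge>N. \<exists>k\<ge>N.
      gp v' (h + multiple m t') (- multiple k t') \<le> C'"
    by blast
qed

lemma gate_mono: "gate C H t v \<Longrightarrow> C \<le> D \<Longrightarrow> gate D H t v"
  using gate_transfer[of C H t v "\<lambda>h. h" "\<lambda>_. 0" v t D] by simp

text \<open>An automorphism maps powers of \<open>t\<close> and their translates to points of the same
form, so bounded cancellation controls every Gromov product in the definition of a gate.\<close>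

lemma gate_aut:
  assumes f: "aut_on n f"
  obtains D where "\<And>H t v. H \<subseteq> F n \<Longrightarrow> t \<in> F n \<Longrightarrow> v \<in> F n \<Longrightarrow> gate C H t v \<Longrightarrow>
    gate D (f ` H) (f t) (f v)"
proof -
  obtain D where D: "\<And>v x y. v \<in> F n \<Longrightarrow> x \<in> F n \<Longrightarrow> y \<in> F n \<Longrightarrow> gp v x y \<le> C \<Longrightarrow>
      gp (f v) (f x) (f y) \<le> D"
    using bounded_cancellation[OF f] by blast
  note hom = aut_on_hom[OF f]
  show thesis
  proof (rule that)
    fix H t v assume H: "H \<subseteq> F n" and t: "t \<in> F n" and v: "v \<in> F n" and gate: "gate C H t v"
    show "gate D (f ` H) (f t) (f v)"
    proof (rule gate_transfer[OF gate, where B = "\<lambda>_. 0"])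
      show "f h = 0 \<longleftrightarrow> h = 0" if "h \<in> H" for h
        using that H aut_on_eq_0[OF f] by auto
    next
      fix m k
      assume "gp v (multiple m t) (- multiple k t) \<le> C"
      then show "gp (f v) (multiple m (f t)) (- multiple k (f t)) \<le> D"
        using D[OF v, of "multiple m t" "- multiple k t"] t
        by (simp add: hom_on_multiple[OF hom] hom_on_uminus[OF hom])
    next
      fix h m k
      assume "h \<in> H" and *: "gp v (multiple m t) (h + multiple k t) \<le> C"
      then show "gp (f v) (multiple m (f t)) (f h + multiple k (f t)) \<le> D"
        using D[OF v _ _ *] t H by (simp add: hom_on_multiple[OF hom] hom_on_add[OF hom] subset_iff)
    next
      fix h m k
      assume "h \<in> H" and *: "gp v (h + multiple m t) (- multiple k t) \<le> C"
      then show "gp (f v) (f h + multiple m (f t)) (- multiple k (f t)) \<le> D"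
        using D[OF v _ _ *] t H
        by (simp add: hom_on_multiple[OF hom] hom_on_add[OF hom] hom_on_uminus[OF hom] subset_iff)
    qed
  qed
qed

text \<open>Gates are equivariant under conjugation. The conjugates of the powers of \<open>t\<close>
differ from their translates by a multiplication with \<open>- g\<close> on the right, which does not
change the end they converge to.\<close>

lemma gate_conj:
  assumes t: "t \<noteq> 0" and gate: "gate C H t v"
  shows "gate C ((\<lambda>h. g + h - g) ` H) (g + t - g) (g + v)"
proof -
  have absorb: "gp (g + v) (g + x - g) (g + y - g) \<le> C"
    if "gp v x y \<le> C" "C + len g < dist_len v x" "C + len g < dist_len v y" for x y
  proof -
    have move: "dist_len z (z - g) = len g" for z
      by (simp add: dist_len_def flip: add_uminus_conv_diff add.assoc)
    then have "gp v (x - g) y \<le> C"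
      using gp_absorb[of v x y C "x - g"] that by simp
    then have "gp v (x - g) (y - g) \<le> C"
      using gp_absorb[of v y "x - g" C "y - g"] that move by (simp add: gp_commute)
    then show ?thesis
      using gp_translate[of g v "x - g" "y - g"] by (simp add: add_diff_eq)
  qed
  have far: "C + len g < dist_len v (h + multiple m t)"
    if "m > C + len g + len h + len v" for h m
    using le_len_multiple[OF t, of m] that dist_len_triangle[of 0 "h + multiple m t" v]
      dist_len_triangle[of 0 "multiple m t" "- h"] dist_len_translate[of "- h" v "h + multiple m t"]
      dist_len_triangle[of "- h" "multiple m t" "- h + v"] dist_len_translate[of "- h" 0 v]
    by (simp flip: add.assoc)
  have far': "C + len g < dist_len v (- multiple m t)"
    if "m > C + len g + len v" for m
    using le_len_multiple[OF t, of m] that dist_len_triangle[of 0 "- multiple m t" v] by simp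
  have far0: "C + len g < dist_len v (multiple m t)"
    if "m > C + len g + len v" for m
    using le_len_multiple[OF t, of m] that dist_len_triangle[of 0 "multiple m t" v] by simp
  let ?i = "\<lambda>h. g + h - g"
  \<comment> \<open>From the exponent \<open>B h\<close> on, the points are so far from \<open>v\<close> that a translation by \<open>g\<close> goes unnoticed.\<close>
  define B where "B h = Suc (C + len g + len h + len v)" for h
  have i_add: "?i h + (g + x - g) = g + (h + x) - g" for h x
    by (simp add: add.assoc diff_conv_add_uminus del: add_uminus_conv_diff)
  have i_minus: "- (g + x - g) = g + (- x) - g" for x
    by (simp add: add.assoc minus_add diff_conv_add_uminus del: add_uminus_conv_diff)
  have i0: "?i h = 0 \<longleftrightarrow> h = 0" for h
    using add_left_cancel[of g h 0] by simp
  show ?thesis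
  proof (rule gate_transfer[OF gate, where B = B and f = ?i])
    fix m k
    assume "gp v (multiple m t) (- multiple k t) \<le> C" and "m \<ge> B 0" "k \<ge> B 0"
    then show "gp (g + v) (multiple m (?i t)) (- multiple k (?i t)) \<le> C"
      unfolding multiple_conj i_minus by (intro absorb far0 far') (simp_all add: B_def)
  next
    fix h m k
    assume "gp v (multiple m t) (h + multiple k t) \<le> C" and "m \<ge> B h" "k \<ge> B h"
    then show "gp (g + v) (multiple m (?i t)) (?i h + multiple k (?i t)) \<le> C"
      unfolding multiple_conj i_add by (intro absorb far0 far) (simp_all add: B_def)
  next
    fix h m k
    assume "gp v (h + multiple m t) (- multiple k t) \<le> C" and "m \<ge> B h" "k \<ge> B h"
    then show "gp (g + v) (?i h + multiple m (?i t)) (- multiple k (?i t)) \<le> C"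
      unfolding multiple_conj i_add i_minus by (intro absorb far far') (simp_all add: B_def)
  qed (rule i0)
qed

lemma letters_multiple_letter: "letters (multiple m (letter l)) = replicate m l"
proof (induction m)
  case (Suc m)
  have "reduced (l # replicate m l)"
    by (cases m) (auto simp: reduced_def successively_conv_nth nth_Cons' inv_letter_def prod_eq_iff)
  then show ?case
    using letters_add_reduced[of "letter l" "multiple m (letter l)"] Suc by simp
qed simp

text \<open>The words \<open>t\<^sup>m\<close>, \<open>h t\<^sup>m\<close> and \<open>t\<close> with a
negative exponent start with three different letters if \<open>h\<close> is a nontrivial word without
the letter \<open>t\<close>. The hypothesis on \<open>a\<close> provides such an \<open>h\<close>.\<close>

lemma gate_standard:
  assumes "a \<ge> 1"
  shows "gate 0 (F a) (gen a) 0"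
proof -
  have pos: "letters (multiple m (gen a)) = replicate m (a, True)" for m
    by (rule letters_multiple_letter)
  have neg: "letters (- multiple m (gen a)) = replicate m (a, False)" for m
    by (simp add: letters_uminus pos inv_letter_def)
  have hF: "fst l < a" if "h \<in> F a" "l \<in> set (letters h)" for h l
    using that by (auto simp: F_def)
  have coset: "letters (h + multiple m (gen a)) = letters h @ replicate m (a, True)"
    if "h \<in> F a" for h m
  proof -
    have "reduced (letters h @ replicate m (a, True))"
    proof (cases "m = 0 \<or> h = 0")
      case True
      then show ?thesis using reduced_letters[of "multiple m (gen a)"] by (auto simp: pos)
    next
      case False
      then have "fst (last (letters h)) < a" using hF[OF that, of "last (letters h)"] by simp
      moreover have "hd (replicate m (a, True)) = (a, True)" using False by (cases m) simp_all
      ultimately show ?thesis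
        using reduced_letters[of "multiple m (gen a)"]
        by (auto simp: reduced_append pos prod_eq_iff)
    qed
    then show ?thesis
      using letters_add_reduced[of h "multiple m (gen a)"] by (simp add: pos)
  qed
  have hd_coset: "letters h \<noteq> []" "hd (letters h) \<noteq> (a, b)" if "h \<in> F a - {0}" for h b
  proof -
    show "letters h \<noteq> []" using that by simp
    then have "fst (hd (letters h)) < a" using hF[of h "hd (letters h)"] that by simp
    then show "hd (letters h) \<noteq> (a, b)" by auto
  qed
  have c1: "gp 0 (multiple m (gen a)) (- multiple k (gen a)) = 0" for m k
    unfolding gp_def by (rule lcp_zero) (cases m; cases k; simp add: pos neg del: multiple.simps)
  have c2: "gp 0 (multiple m (gen a)) (h + multiple k (gen a)) = 0" if "h \<in> F a - {0}" for m k h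
    unfolding gp_def using hd_coset(1)[OF that] hd_coset(2)[OF that, of True] that
    by (intro lcp_zero) (cases m; simp add: pos coset hd_append del: multiple.simps)
  have c3: "gp 0 (h + multiple m (gen a)) (- multiple k (gen a)) = 0" if "h \<in> F a - {0}" for m k h
    unfolding gp_def using hd_coset(1)[OF that] hd_coset(2)[OF that, of False] that
    by (intro lcp_zero) (cases k; simp add: neg coset hd_append del: multiple.simps)
  have "gen 0 \<in> F a - {0}"
    using assms by (simp add: letters_eq_Nil[symmetric] del: letters_eq_Nil)
  then show ?thesis
    unfolding gate_def using c1 c2 c3 by (intro conjI ballI bexI[of _ "gen 0"] exI[of _ 0]) auto
qed

text \<open>A gate with an unspecified constant \<open>C\<close> is improved to one with constant
\<open>1\<close>. Since \<open>t\<close> is cyclically reduced, its powers lie on a geodesic line. The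
condition \<open>P\<close> that a vertex of this line lies on the lines from \<open>\<xi>\<close> to all
\<open>h \<xi>\<close> holds far out towards \<open>\<xi>\<close> and fails far out in the other
direction. At the first vertex \<open>v\<close> of a finite segment where it holds, the preceding vertex
\<open>u\<close> has an \<open>h\<close> for which \<open>h \<xi>\<close> is seen from \<open>u\<close>
in the direction of \<open>\<xi>\<close>; so the line from \<open>\<xi>'\<close> to \<open>h
\<xi>\<close> passes through \<open>u\<close>, next to \<open>v\<close>.\<close>

lemma gate_exists:
  assumes gate: "gate C H t 0" and cyc: "cancel t t = 0" and t: "t \<noteq> 0" "t \<in> F n"
  obtains v where "v \<in> F n" "gate 1 H t v"
proof -
  define L where "L = len t"
  have L: "L \<ge> 1" using t(1) by (simp add: L_def Suc_le_eq)
  have len: "len (multiple m t) = m * L" for m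
    by (simp add: L_def len_multiple_cyclically_reduced[OF cyc])
  \<comment> \<open>\<open>p 0, ..., p J\<close> is the geodesic segment from the power of \<open>t\<close> with exponent \<open>- M\<close> to the one with
    exponent \<open>M\<close>; both ends are farther than \<open>C\<close> from the base vertex.\<close>
  define M where "M = Suc C"
  define J where "J = 2 * M * L"
  have large: "M * L > C"
    using L mult_le_mono2[of 1 L M] by (simp add: M_def)
  define p where "p j = - multiple M t + prefix_elem j (multiple (2 * M) t)" for j
  have p0: "p 0 = - multiple M t"
    by (simp add: p_def)
  have pJ: "p J = multiple M t"
  proof -
    have "prefix_elem J (multiple (2 * M) t) = multiple M t + multiple M t"
      using prefix_elem_eq(1)[of "multiple (2 * M) t"] multiple_add[of M M t]
      unfolding len J_def mult_2 by simp
    then show ?thesis by (simp add: p_def flip: add.assoc)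
  qed
  have dist_pm: "dist_len (- multiple k t) (multiple m t) = (k + m) * L" for k m
    by (simp add: dist_len_def len flip: multiple_add)
  have dist_p: "dist_len (- multiple k t) (p j) + M * L = k * L + j"
    "dist_len (p j) (multiple m t) + M * L + j = J + m * L"
    if bounds: "k \<ge> M" "m \<ge> M" "j \<le> J" for k m j
  proof -
    obtain k' m' where km: "k = M + k'" "m = M + m'"
      using bounds by (auto simp: le_iff_add)
    define q where "q = prefix_elem j (multiple (2 * M) t)"
    have q: "len q = j" "dist_len q (multiple (2 * M) t) = J - j"
    proof -
      have whole: "len (multiple (2 * M) t) = J" by (simp only: len J_def)
      show "len q = j" using bounds(3) by (simp add: q_def whole)
      then show "dist_len q (multiple (2 * M) t) = J - j"
        using gp_dist[of q "multiple (2 * M) t" 0] bounds(3)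
        by (simp add: q_def gp_prefix_elem whole)
    qed
    have "dist_len (- multiple k t) (p j) = dist_len (- multiple k' t) q"
    proof -
      have "multiple k t = multiple k' t + multiple M t"
        by (simp add: km add.commute flip: multiple_add)
      then have "- multiple k t = - multiple M t + - multiple k' t"
        by (simp add: minus_add)
      then show ?thesis unfolding p_def q_def by (simp only: dist_len_translate)
    qed
    then have 1: "dist_len (- multiple k t) (p j) \<le> k' * L + j"
      using dist_len_triangle[of "- multiple k' t" q 0] by (simp add: q len)
    have "multiple m t = - multiple M t + multiple (2 * M + m') t"
      using multiple_add[of M "M + m'" t] by (simp add: km mult_2 add.assoc)
    then have "dist_len (p j) (multiple m t) = dist_len q (multiple (2 * M + m') t)"
      unfolding p_def q_def by (simp only: dist_len_translate)
    also have "\<dots> \<le> (J - j) + dist_len (multiple (2 * M) t) (multiple (2 * M + m') t)"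
      using dist_len_triangle[of q _ "multiple (2 * M) t"] q(2) by metis
    also have "dist_len (multiple (2 * M) t) (multiple (2 * M + m') t) = m' * L"
      by (simp add: dist_len_def multiple_add len add.assoc[symmetric])
    finally have 2: "dist_len (p j) (multiple m t) \<le> (J - j) + m' * L" .
    have "(k + m) * L = k' * L + J + m' * L" "k * L = M * L + k' * L" "m * L = M * L + m' * L"
      by (simp_all add: km J_def algebra_simps)
    then show "dist_len (- multiple k t) (p j) + M * L = k * L + j"
      "dist_len (p j) (multiple m t) + M * L + j = J + m * L"
      using 1 2 dist_len_triangle[of "- multiple k t" "multiple m t" "p j"] dist_pm[of k m] bounds(3)
      by linarith+
  qed
  define P where "P j \<longleftrightarrow> (\<forall>h\<in>H - {0}. \<exists>N. \<forall>m\<ge>N. \<forall>k\<ge>N.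
    gp (p j) (multiple m t) (h + multiple k t) = 0)" for j
  have "P J"
    unfolding P_def
  proof
    fix h assume h: "h \<in> H - {0}"
    obtain N where N: "\<forall>m\<ge>N. \<forall>k\<ge>N. gp 0 (multiple m t) (h + multiple k t) \<le> C"
      using gateD(2)[OF gate h] by (rule exE)
    have "gp (p J) (multiple m t) (h + multiple k t) = 0" if "m \<ge> max N M" "k \<ge> max N M" for m k
    proof -
      define x and y and v where "x = multiple m t" and "y = h + multiple k t" and "v = multiple M t"
      have xy: "gp 0 x y \<le> C" using N that by (simp add: x_def y_def)
      have xv: "dist_len v x + M * L = m * L"
        using dist_p(2)[of M m J] that by (simp add: pJ v_def x_def)
      then have gxv: "gp 0 x v = M * L"
        using gp_dist[of v x 0] by (simp add: len v_def x_def gp_commute)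
      then have "gp 0 x y \<le> gp 0 v y"
        using gp_ultra[of 0 v x y] xy large by (simp add: gp_commute)
      then have "gp v x y = 0"
        using gp_dist[of x y v] gp_dist[of x y 0] gp_dist[of v y 0] xv
        by (simp add: len v_def x_def)
      then show ?thesis by (simp add: pJ v_def x_def y_def)
    qed
    then show "\<exists>N. \<forall>m\<ge>N. \<forall>k\<ge>N. gp (p J) (multiple m t) (h + multiple k t) = 0"
      by blast
  qed
  moreover have "\<not> P 0"
  proof
    assume P0: "P 0"
    obtain h where h: "h \<in> H - {0}"
      "\<forall>N. \<exists>m\<ge>N. \<exists>k\<ge>N. gp 0 (h + multiple m t) (- multiple k t) \<le> C"
      using gateD(3)[OF gate] by (rule bexE)
    obtain N where N: "\<forall>m\<ge>N. \<forall>k\<ge>N. gp (p 0) (multiple m t) (h + multiple k t) = 0"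
      using P0 h(1) unfolding P_def by metis
    obtain m k where mk: "m \<ge> max N M" "k \<ge> max N M" "gp 0 (h + multiple m t) (- multiple k t) \<le> C"
      using spec[OF h(2), of "max N M"] by blast
    define x and y and y' and v where "x = multiple m t" and "y = h + multiple m t" and "y' = - multiple k t"
      and "v = - multiple M t"
    have "dist_len y' v + M * L = k * L"
      using dist_p(1)[of k M 0] mk by (simp add: p0 y'_def v_def)
    then have "gp 0 v y' = M * L"
      using gp_dist[of y' v 0] by (simp add: len v_def y'_def gp_commute)
    then have "gp 0 y v \<le> C"
      using gp_ultra[of 0 y v y'] mk(3) large by (simp add: y_def y'_def)
    moreover have "dist_len v x = M * L + m * L"
      by (simp add: v_def x_def dist_pm algebra_simps)
    ultimately have "gp v x y > 0"
      using gp_dist[of x y v] gp_dist[of x y 0] gp_dist[of y v 0] dist_len_commute[of y v] large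
      by (simp add: len v_def x_def)
    then show False using N mk by (simp add: p0 v_def x_def y_def)
  qed
  ultimately obtain j where j: "j < J" "\<not> P j" "P (Suc j)"
    using ex_least_nat_less[of P J] by blast
  define u and v where "u = p j" and "v = p (Suc j)"
  have uv: "dist_len u v \<le> 1"
    unfolding u_def v_def p_def dist_len_translate by (rule dist_len_prefix_elem)
  have "v \<in> F n" using t(2) by (simp add: v_def p_def)
  moreover have "gate 1 H t v"
    unfolding gate_def
  proof (intro conjI ballI)
    have "gp v (multiple m t) (- multiple k t) \<le> 1" if "m \<ge> M" "k \<ge> M" for m k
      using gp_dist[of "multiple m t" "- multiple k t" v] dist_p[of k m "Suc j"] that j(1)
        dist_pm[of k m] dist_len_commute[of "- multiple k t" "multiple m t"]
        dist_len_commute[of "- multiple k t" v]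
      by (simp add: v_def J_def algebra_simps)
    then show "\<exists>N. \<forall>m\<ge>N. \<forall>k\<ge>N. gp v (multiple m t) (- multiple k t) \<le> 1" by blast
    fix h assume "h \<in> H - {0}"
    then obtain N where "\<forall>m\<ge>N. \<forall>k\<ge>N. gp v (multiple m t) (h + multiple k t) = 0"
      using j(3) unfolding P_def v_def by metis
    then show "\<exists>N. \<forall>m\<ge>N. \<forall>k\<ge>N. gp v (multiple m t) (h + multiple k t) \<le> 1"
      by (intro exI[of _ N]) simp
  next
    obtain h where h: "h \<in> H - {0}"
      "\<nexists>N. \<forall>m\<ge>N. \<forall>k\<ge>N. gp u (multiple m t) (h + multiple k t) = 0"
      using j(2) unfolding P_def u_def by metis
    have "\<exists>m\<ge>N. \<exists>k\<ge>N. gp v (h + multiple m t) (- multiple k t) \<le> 1" for N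
    proof -
      obtain m k where mk: "m \<ge> max N M" "k \<ge> max N M"
        "gp u (multiple m t) (h + multiple k t) \<noteq> 0"
        using h(2) by metis
      define x and y and y' where "x = multiple m t" and "y = h + multiple k t" and
        "y' = - multiple (max N M) t"
      have "dist_len u x = dist_len v x + 1" "dist_len y' v = dist_len y' u + 1"
        using dist_p[of "max N M" m j] dist_p[of "max N M" m "Suc j"] mk j(1)
        by (simp_all add: u_def v_def x_def y'_def)
      then have "gp u v x = 1" "gp u v y' = 0"
        using gp_dist[of v x u] gp_dist[of v y' u] uv dist_len_commute[of y' v]
          dist_len_commute[of y' u] by simp_all
      moreover have "gp u x y > 0" using mk(3) by (simp add: x_def y_def)
      ultimately have "gp u y y' = 0"
        using gp_ultra[of u v x y] gp_ultra[of u v y y'] by (simp add: min_def split: if_splits)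
      then have "gp v y y' \<le> 1"
        using gp_dist[of y y' u] gp_dist[of y y' v] uv dist_len_triangle[of v y u]
          dist_len_triangle[of v y' u] dist_len_commute[of u v] by simp
      then show ?thesis
        unfolding y_def y'_def using mk(2) by (meson max.cobounded1 max.boundedE)
    qed
    with h(1) show "\<exists>h\<in>H - {0}. \<forall>N. \<exists>m\<ge>N. \<exists>k\<ge>N.
        gp v (h + multiple m t) (- multiple k t) \<le> 1"
      by blast
  qed
  ultimately show thesis by (rule that)
qed

text \<open>A conjugate of minimal length is cyclically reduced: a letter that cancels between its end
and its beginning could be removed by a conjugation.\<close>

lemma cyclically_reduced_conjugate:
  assumes t: "t \<in> F n" "t \<noteq> 0"
  obtains g where "g \<in> F n" "cancel (g + t - g) (g + t - g) = 0"
proof -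
  define g where "g = arg_min (\<lambda>g. len (g + t - g)) (\<lambda>g. g \<in> F n)"
  define s where "s = g + t - g"
  have g: "g \<in> F n" "\<And>g'. g' \<in> F n \<Longrightarrow> len s \<le> len (g' + t - g')"
    using arg_min_natI[of "\<lambda>g. g \<in> F n" 0 "\<lambda>g. len (g + t - g)"]
      arg_min_nat_le[of "\<lambda>g. g \<in> F n" _ "\<lambda>g. len (g + t - g)"]
    by (simp_all add: g_def s_def)
  have s: "s \<in> F n" using g t by (simp add: s_def)
  have "s \<noteq> 0"
    using t(2) add_left_cancel[of g t 0] by (simp add: s_def)
  have "cancel s s = 0"
  proof (rule ccontr)
    assume neg: "cancel s s \<noteq> 0"
    then obtain l u v where l: "letters (- s) = l # u" "letters s = l # v"
      by (cases "letters (- s)"; cases "letters s") (auto simp: cancel_def gp_def split: if_splits)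
    define x where "x = letter l"
    have x: "x \<in> F n" using s l by (simp add: x_def F_def)
    have gps: "gp 0 (- s) x = 1" "gp 0 x s = 1" "len x = 1"
      using l by (simp_all add: gp_def x_def)
    have "len s \<ge> 3" using two_cancel_self_less[OF \<open>s \<noteq> 0\<close>] neg by simp
    moreover have "dist_len (- s) (- s + x) = 1"
      using gps(3) by (simp add: dist_len_def flip: add.assoc)
    ultimately have "gp 0 (- s) (- s + x) \<ge> 2"
      using gp_dist[of "- s" "- s + x" 0] dist_len_triangle[of 0 "- s" "- s + x"]
        dist_len_commute[of "- s" "- s + x"] by simp
    then have "gp 0 (- s + x) x \<ge> 1"
      using gp_ultra[of 0 "- s + x" "- s" x] gps(1) by (simp add: gp_commute)
    then have "len (- x + s + x) + 2 \<le> len (- x + s) + 1"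
      using gp_dist[of "- s + x" x 0] gps(3) dist_len_commute[of s x]
      by (simp add: dist_len_def minus_add)
    moreover have "len (- x + s) + 2 = 1 + len s"
      using gp_dist[of x s 0] gps by (simp add: dist_len_def)
    ultimately have "len (- x + s + x) < len s" by simp
    moreover have "- x + s + x = (- x + g) + t - (- x + g)"
      by (simp add: s_def add.assoc minus_add diff_conv_add_uminus del: add_uminus_conv_diff)
    ultimately show False
      using g(2)[of "- x + g"] g(1) x by simp
  qed
  with g(1) that show thesis by (simp add: s_def)
qed

text \<open>The standard gate is carried over by \<open>f\<close> with a constant that depends on
\<open>f\<close>; \<open>gate_exists\<close> replaces the constant by \<open>1\<close>, and a
translation moves the new gate to \<open>0\<close>.\<close>

lemma normalizing_conjugate:
  assumes f: "aut_on (Suc a) f" and a: "a \<ge> 1"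
  obtains g where "g \<in> F (Suc a)"
    "gate 1 ((\<lambda>x. g + f x - g) ` F a) (g + f (gen a) - g) 0"
proof -
  let ?n = "Suc a"
  have sub: "F a \<subseteq> F ?n" by (rule F_mono) simp
  have t: "f (gen a) \<in> F ?n" "f (gen a) \<noteq> 0"
    using aut_on_closed[OF f, of "gen a"] aut_on_eq_0[OF f, of "gen a"]
    by (simp_all add: letters_eq_Nil[symmetric] del: letters_eq_Nil)
  obtain g where g: "g \<in> F ?n" "cancel (g + f (gen a) - g) (g + f (gen a) - g) = 0"
    by (rule cyclically_reduced_conjugate[OF t])
  have f': "aut_on ?n (\<lambda>x. g + f x - g)"
    using aut_on_comp[OF aut_on_conj[OF g(1)] f] .
  obtain D where "gate D ((\<lambda>x. g + f x - g) ` F a) (g + f (gen a) - g) (g + f 0 - g)"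
    using gate_aut[OF f', of 0] gate_standard[OF a] sub by (metis F_letter F_zero fst_conv lessI)
  then have gD: "gate D ((\<lambda>x. g + f x - g) ` F a) (g + f (gen a) - g) 0"
    by (simp add: hom_on_zero[OF aut_on_hom[OF f]])
  have t': "g + f (gen a) - g \<noteq> 0" "g + f (gen a) - g \<in> F ?n"
    using t g aut_on_eq_0[OF f', of "gen a"] aut_on_eq_0[OF f, of "gen a"] by simp_all
  obtain v where v: "v \<in> F ?n" "gate 1 ((\<lambda>x. g + f x - g) ` F a) (g + f (gen a) - g) v"
    by (rule gate_exists[OF gD g(2) t'])
  have "gate 1 ((\<lambda>h. - v + h - - v) ` (\<lambda>x. g + f x - g) ` F a)
      (- v + (g + f (gen a) - g) - - v) (- v + v)"
    by (rule gate_conj[OF t'(1) v(2)])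
  moreover have "- v + (g + x - g) - - v = (- v + g) + x - (- v + g)" for x
    by (simp add: add.assoc minus_add diff_conv_add_uminus del: add_uminus_conv_diff)
  ultimately have "gate 1 ((\<lambda>x. (- v + g) + f x - (- v + g)) ` F a)
      ((- v + g) + f (gen a) - (- v + g)) 0"
    by (simp add: image_image del: diff_minus_eq_add)
  then show thesis using that[of "- v + g"] g(1) v(1) by simp
qed

text \<open>Both \<open>g\<close> and \<open>0\<close> are gates of the same pair. The bound depends
only on \<open>f\<close>, not on the subgroup.\<close>

lemma normalized_conjugator_bounded:
  assumes f: "aut_on n f"
  obtains D where "\<And>H t g. H \<subseteq> F n \<Longrightarrow> t \<in> F n \<Longrightarrow> t \<noteq> 0 \<Longrightarrow> g \<in> F n \<Longrightarrow> gate 1 H t 0 \<Longrightarrow>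
    gate 1 ((\<lambda>x. g + f x - g) ` H) (g + f t - g) 0 \<Longrightarrow> len g \<le> D"
proof -
  obtain D where D: "\<And>H t v. H \<subseteq> F n \<Longrightarrow> t \<in> F n \<Longrightarrow> v \<in> F n \<Longrightarrow> gate 1 H t v \<Longrightarrow>
      gate D (f ` H) (f t) (f v)"
    using gate_aut[OF f] by blast
  show thesis
  proof (rule that)
    fix H t g assume H: "H \<subseteq> F n" and t: "t \<in> F n" "t \<noteq> 0" and g: "g \<in> F n"
      and g1: "gate 1 H t 0" and g2: "gate 1 ((\<lambda>x. g + f x - g) ` H) (g + f t - g) 0"
    have ft: "f t \<noteq> 0" using t aut_on_eq_0[OF f] by simp
    have f0: "f 0 = 0" by (rule hom_on_zero[OF aut_on_hom[OF f]])
    have "gate D (f ` H) (f t) 0" using D[OF H t(1) _ g1] f0 by simp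
    then have "gate D ((\<lambda>h. g + h - g) ` f ` H) (g + f t - g) (g + 0)"
      by (rule gate_conj[OF ft])
    then have "gate (max D 1) ((\<lambda>x. g + f x - g) ` H) (g + f t - g) g"
      by (auto intro: gate_mono[of D] simp: image_image)
    moreover have "gate (max D 1) ((\<lambda>x. g + f x - g) ` H) (g + f t - g) 0"
      by (rule gate_mono[OF g2]) simp
    ultimately show "len g \<le> 2 * max D 1"
      using gate_unique[of "max D 1" _ _ g 0] by (metis dist_len_zero(2))
  qed
qed

section \<open>Schreier bases\<close>

definition letter_code :: "letter \<Rightarrow> nat" where
  "letter_code l = 2 * fst l + of_bool (snd l)"

lemma letter_code_inj: "letter_code l = letter_code l' \<longleftrightarrow> l = l'"
  by (cases l; cases l'; cases "snd l"; cases "snd l'") (auto simp: letter_code_def, presburger+)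

text \<open>Coset representatives that are minimal in the length-lexicographic order form a Schreier
transversal: a prefix of a minimal word is minimal in its own coset.\<close>

definition shortlex :: "(freegrp \<times> freegrp) set" where
  "shortlex = inv_image (lenlex less_than) (\<lambda>x. map letter_code (letters x))"

lemma wf_shortlex: "wf shortlex"
  by (simp add: shortlex_def wf_inv_image wf_lenlex)

lemma shortlex_total: "x \<noteq> y \<Longrightarrow> (x, y) \<in> shortlex \<or> (y, x) \<in> shortlex"
proof -
  assume "x \<noteq> y"
  moreover have "inj letter_code" by (simp add: inj_def letter_code_inj)
  ultimately have "map letter_code (letters x) \<noteq> map letter_code (letters y)"
    by (simp add: inj_map_eq_map letters_inject)
  moreover have "total (lenlex less_than)"
    by (intro total_lenlex) (auto simp: total_on_def)
  ultimately show ?thesis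
    by (auto simp: shortlex_def total_on_def)
qed

lemma shortlex_shorter: "len x < len y \<Longrightarrow> (x, y) \<in> shortlex"
  by (simp add: shortlex_def lenlex_conv)

lemma letters_add_of_len:
  assumes "len (x + y) = len x + len y"
  shows "letters (x + y) = letters x @ letters y"
proof -
  have "lcp (letters (- x)) (letters y) = 0"
    using assms len_add[of x y] by (simp add: cancel_def gp_def)
  then have "letters x = [] \<or> letters y = [] \<or> hd (letters y) \<noteq> inv_letter (last (letters x))"
    by (cases "letters x" rule: rev_cases; cases "letters y")
      (auto simp: letters_uminus split: if_splits)
  then have "reduced (letters x @ letters y)" by (simp add: reduced_append)
  then show ?thesis by (rule letters_add_reduced)
qed

definition coset_rep :: "freegrp set \<Rightarrow> freegrp \<Rightarrow> freegrp" where
  "coset_rep H g = (SOME u. u \<in> (\<lambda>h. h + g) ` H \<and>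
    (\<forall>y. (y, u) \<in> shortlex \<longrightarrow> y \<notin> (\<lambda>h. h + g) ` H))"

definition schreier_gen :: "freegrp set \<Rightarrow> freegrp \<times> nat \<Rightarrow> freegrp" where
  "schreier_gen H e = fst e + gen (snd e) - coset_rep H (fst e + gen (snd e))"

text \<open>An edge of the coset graph of \<open>H\<close> in \<open>F n\<close> is a pair of a
representative and a generator. The transversal is a spanning tree, and an edge lies outside it iff its
Schreier generator is nontrivial.\<close>

definition schreier_edges :: "nat \<Rightarrow> freegrp set \<Rightarrow> (freegrp \<times> nat) set" where
  "schreier_edges n H =
    {e. coset_rep H (fst e) = fst e \<and> fst e \<in> F n \<and> snd e < n \<and> schreier_gen H e \<noteq> 0}"

text \<open>A function on the positively oriented edges is summed along the path in the coset graph that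
starts at \<open>u\<close> and is labelled by a word; an edge that is crossed against its orientation
counts negatively. The sum depends only on the element that the word represents
(\<open>path_push\<close>), and at \<open>u = 0\<close> it is a homomorphism on \<open>H\<close>
(\<open>cocycle_hom\<close>).\<close>

definition step :: "freegrp set \<Rightarrow> (freegrp \<times> nat \<Rightarrow> 'k :: group_add) \<Rightarrow> freegrp \<Rightarrow> letter \<Rightarrow> 'k" where
  "step H f u l =
    (if snd l then f (u, fst l) else - f (coset_rep H (u + letter l), fst l))"

fun path :: "freegrp set \<Rightarrow> (freegrp \<times> nat \<Rightarrow> 'k :: group_add) \<Rightarrow> freegrp \<Rightarrow> letter list \<Rightarrow> 'k" where
  "path H f u [] = 0"
| "path H f u (l # w) = step H f u l + path H f (coset_rep H (u + letter l)) w"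

definition cocycle ::
    "freegrp set \<Rightarrow> (freegrp \<times> nat \<Rightarrow> 'k :: group_add) \<Rightarrow> freegrp \<Rightarrow> freegrp \<Rightarrow> 'k" where
  "cocycle H f u x = path H f u (letters x)"

locale free_subgroup =
  fixes n :: nat and H :: "freegrp set"
  assumes H_F: "H \<subseteq> F n" and H_zero: "0 \<in> H"
    and H_add: "x \<in> H \<Longrightarrow> y \<in> H \<Longrightarrow> x + y \<in> H"
    and H_uminus: "x \<in> H \<Longrightarrow> - x \<in> H"
begin

abbreviation "rep \<equiv> coset_rep H"

lemma rep: "\<exists>h\<in>H. rep g = h + g" "h \<in> H \<Longrightarrow> (h + g, rep g) \<notin> shortlex"
proof -
  have "g \<in> (\<lambda>h. h + g) ` H" using H_zero by (auto intro!: image_eqI[of _ _ 0])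
  then obtain u where "u \<in> (\<lambda>h. h + g) ` H \<and>
      (\<forall>y. (y, u) \<in> shortlex \<longrightarrow> y \<notin> (\<lambda>h. h + g) ` H)"
    using wf_shortlex[unfolded wf_eq_minimal] by metis
  then have *: "rep g \<in> (\<lambda>h. h + g) ` H \<and>
      (\<forall>y. (y, rep g) \<in> shortlex \<longrightarrow> y \<notin> (\<lambda>h. h + g) ` H)"
    unfolding coset_rep_def by (rule someI)
  then show "\<exists>h\<in>H. rep g = h + g" "h \<in> H \<Longrightarrow> (h + g, rep g) \<notin> shortlex"
    by auto
qed

lemma rep_add: "h \<in> H \<Longrightarrow> rep (h + g) = rep g"
proof -
  assume h: "h \<in> H"
  have "(\<lambda>x. x + (h + g)) ` H = (\<lambda>x. x + g) ` H"
  proof (intro equalityI subsetI)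
    fix y assume "y \<in> (\<lambda>x. x + (h + g)) ` H"
    then obtain x where x: "x \<in> H" "y = x + (h + g)" by auto
    then show "y \<in> (\<lambda>x. x + g) ` H"
      using H_add h by (intro image_eqI[of _ _ "x + h"]) (simp_all add: add.assoc)
  next
    fix y assume "y \<in> (\<lambda>x. x + g) ` H"
    then obtain x where x: "x \<in> H" "y = x + g" by auto
    then show "y \<in> (\<lambda>x. x + (h + g)) ` H"
      using H_add[of x "- h"] H_uminus[OF h] h
      by (intro image_eqI[of _ _ "x - h"]) (simp_all add: add.assoc)
  qed
  then show ?thesis by (simp add: coset_rep_def)
qed

lemma rep_eq_iff: "rep g = rep g' \<longleftrightarrow> (\<exists>h\<in>H. g' = h + g)"
proof
  assume eq: "rep g = rep g'"
  obtain h h' where h: "h \<in> H" "rep g = h + g" "h' \<in> H" "rep g' = h' + g'"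
    using rep(1) by metis
  then have "g' = (- h' + h) + g"
    using eq by (metis add.assoc minus_add_cancel)
  then show "\<exists>h\<in>H. g' = h + g" using h H_add H_uminus by blast
qed (auto simp: rep_add)

lemma rep_rep [simp]: "rep (rep g) = rep g"
  using rep(1)[of g] rep_add by metis

lemma rep_rep_add [simp]: "rep (rep g + x) = rep (g + x)"
proof -
  obtain h where "h \<in> H" "rep g = h + g" using rep(1) by blast
  then show ?thesis using rep_add[of h "g + x"] by (simp add: add.assoc)
qed

lemma rep_subgroup: "h \<in> H \<Longrightarrow> rep h = 0"
proof -
  assume h: "h \<in> H"
  have "rep 0 = 0"
  proof (rule ccontr)
    assume "rep 0 \<noteq> 0"
    then have "(0, rep 0) \<in> shortlex" by (intro shortlex_shorter) simp
    then show False using rep(2)[OF H_zero, of 0] by simp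
  qed
  then show ?thesis using rep_add[OF h, of 0] by simp
qed

lemma rep_F [simp]: "rep g \<in> F n \<longleftrightarrow> g \<in> F n"
proof -
  obtain h where h: "h \<in> H" "rep g = h + g" using rep(1) by blast
  then have "h \<in> F n" using H_F by auto
  show ?thesis
    unfolding h(2)
  proof
    assume "h + g \<in> F n"
    moreover have "- h \<in> F n" using \<open>h \<in> F n\<close> by simp
    ultimately have "- h + (h + g) \<in> F n" by (rule F_add[rotated])
    then show "g \<in> F n" by (simp only: minus_add_cancel)
  qed (use \<open>h \<in> F n\<close> in simp)
qed

text \<open>Replacing a prefix \<open>p\<close> of \<open>u\<close> by a smaller word of its coset would
give a smaller word in the coset of \<open>u\<close>, even if the new prefix cancels against the
remainder.\<close>

lemma rep_prefix:
  assumes u: "rep u = u" and split: "letters u = p @ s"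
  shows "rep (word p) = word p"
proof (rule ccontr)
  assume ne: "rep (word p) \<noteq> word p"
  define q where "q = rep (word p)"
  obtain h where h: "h \<in> H" "q = h + word p" using rep(1) q_def by blast
  have "(word p, q) \<notin> shortlex" using rep(2)[OF H_zero, of "word p"] by (simp add: q_def)
  then have less: "(q, word p) \<in> shortlex" using shortlex_total ne by (auto simp: q_def)
  note sp = letters_split[OF split]
  have lq: "len q \<le> length p"
    using less lenlex_length by (fastforce simp: shortlex_def sp(2))
  have "(q + word s, u) \<in> shortlex"
  proof (cases "len (q + word s) < len u")
    case True
    then show ?thesis by (rule shortlex_shorter)
  next
    case False
    then have "len (q + word s) = len q + len (word s)"
      using len_add_le[of q "word s"] lq split by (simp add: sp(3))
    then have "letters (q + word s) = letters q @ s"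
      using letters_add_of_len sp(3) by metis
    then show ?thesis
      using less lenlex_append1[of "map letter_code (letters q)" "map letter_code p" less_than
          "map letter_code s" "map letter_code s"]
      by (simp add: shortlex_def split sp(2))
  qed
  moreover have "q + word s = h + u"
    using h(2) sp(1) by (simp add: add.assoc)
  ultimately show False using rep(2)[OF h(1), of u] u by simp
qed

lemma rep_prefix_elem: "rep u = u \<Longrightarrow> rep (prefix_elem i u) = prefix_elem i u"
  unfolding prefix_elem_def by (rule rep_prefix[of u _ "drop i (letters u)"]) simp_all

section \<open>Cocycles on the Schreier graph\<close>

lemma step_inv:
  assumes "rep u = u"
  shows "step H f (rep (u + letter l)) (inv_letter l) = - step H f u l"
proof -
  have "rep (u + letter l + letter (inv_letter l)) = u"
    using assms by (simp add: letter_inv_letter add.assoc)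
  then show ?thesis
    by (cases l; cases "snd l") (simp_all add: step_def inv_letter_def)
qed

lemma path_push:
  assumes "rep u = u"
  shows "path H f u (push_letter l w) = path H f u (l # w)"
proof (cases w)
  case (Cons y w')
  show ?thesis
  proof (cases "y = inv_letter l")
    case True
    have "rep (u + letter l + letter y) = u"
      using assms True by (simp add: letter_inv_letter add.assoc)
    then show ?thesis
      using Cons True step_inv[OF assms, of f l] by (simp flip: add.assoc)
  qed (simp add: Cons)
qed simp

lemma path_append:
  "rep u = u \<Longrightarrow> path H f u (v @ w) = path H f u v + path H f (rep (u + word v)) w"
  by (induction v arbitrary: u) (simp_all add: add.assoc)

lemma path_foldr_push:
  "rep u = u \<Longrightarrow> path H f u (foldr push_letter v w) = path H f u (v @ w)"
proof (induction v arbitrary: u)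
  case (Cons l v)
  then show ?case using path_push[OF Cons.prems, of f l "foldr push_letter v w"] by simp
qed simp

lemma cocycle_add:
  "rep u = u \<Longrightarrow> cocycle H f u (x + y) = cocycle H f u x + cocycle H f (rep (u + x)) y"
  by (simp add: cocycle_def letters_add path_foldr_push path_append)

lemma cocycle_letter: "cocycle H f u (letter l) = step H f u l"
  by (simp add: cocycle_def)

lemma rep_0 [simp]: "rep 0 = 0"
  using rep_subgroup H_zero by blast

lemma cocycle_hom: "h \<in> H \<Longrightarrow> cocycle H f 0 (h + x) = cocycle H f 0 h + cocycle H f 0 x"
  using cocycle_add[of 0 f h x] by (simp add: rep_subgroup)

text \<open>The path to a vertex along the spanning tree crosses only tree edges.\<close>

lemma cocycle_transversal:
  assumes f: "\<And>e. e \<notin> schreier_edges n H \<Longrightarrow> f e = 0"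
    and u: "rep u = u" "u \<in> F n"
  shows "cocycle H f 0 u = 0"
proof -
  have "cocycle H f 0 (word w) = 0" if "reduced w" "rep (word w) = word w" "word w \<in> F n" for w
    using that
  proof (induction w rule: rev_induct)
    case Nil
    then show ?case by (simp add: cocycle_def)
  next
    case (snoc l w)
    have red: "letters (word (w @ [l])) = w @ [l]" using letters_word[OF snoc.prems(1)] .
    have w: "rep (word w) = word w" by (rule rep_prefix[OF snoc.prems(2) red])
    have "reduced w" using snoc.prems(1) by (simp add: reduced_append)
    then have "word w \<in> F n" using snoc.prems(3) red by (auto simp: F_def letters_word)
    have "step H f (word w) l = 0"
    proof (cases "snd l")
      case True
      then have "schreier_gen H (word w, fst l) = 0"
        using snoc.prems(2) by (cases l) (simp add: schreier_gen_def)
      then show ?thesis using True f by (simp add: step_def schreier_edges_def)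
    next
      case False
      then have "word (w @ [l]) + gen (fst l) = word w"
        by (cases l) (simp add: letter_False)
      then have "schreier_gen H (word (w @ [l]), fst l) = 0"
        using w by (simp add: schreier_gen_def)
      then show ?thesis using False f snoc.prems(2) by (simp add: step_def schreier_edges_def)
    qed
    moreover have "cocycle H f 0 (word w) = 0"
      using snoc.IH w \<open>reduced w\<close> \<open>word w \<in> F n\<close> by blast
    ultimately show ?case
      using cocycle_add[of 0 f "word w" "letter l"] w by (simp add: cocycle_letter)
  qed
  from this[of "letters u"] show ?thesis using u by simp
qed

lemma schreier_gen_in: "schreier_gen H e \<in> H"
proof -
  obtain h where "h \<in> H" "rep (fst e + gen (snd e)) = h + (fst e + gen (snd e))"
    using rep(1) by blast
  then have "schreier_gen H e = - h"
    by (simp add: schreier_gen_def diff_conv_add_uminus minus_add del: add_uminus_conv_diff)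
      (metis add.assoc add.right_inverse add.right_neutral minus_add)
  then show ?thesis using H_uminus \<open>h \<in> H\<close> by simp
qed

text \<open>The closed path of a Schreier generator crosses exactly one edge outside the spanning tree.
Hence values on these edges can be prescribed freely, which is the freeness part of the
Nielsen--Schreier theorem.\<close>

lemma cocycle_schreier_gen:
  assumes f: "\<And>e. e \<notin> schreier_edges n H \<Longrightarrow> f e = 0" and e: "e \<in> schreier_edges n H"
  shows "cocycle H f 0 (schreier_gen H e) = f e"
proof -
  define u where "u = fst e"
  define v where "v = rep (u + gen (snd e))"
  have u: "rep u = u" "u \<in> F n" "snd e < n"
    using e by (simp_all add: schreier_edges_def u_def)
  have v: "rep v = v" "v \<in> F n" using u by (simp_all add: v_def)
  have "schreier_gen H e + v = u + gen (snd e)"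
    by (simp add: schreier_gen_def u_def v_def)
  then have "cocycle H f 0 (schreier_gen H e) + cocycle H f 0 v
      = cocycle H f 0 u + cocycle H f u (gen (snd e))"
    using cocycle_hom[OF schreier_gen_in, of f e v] cocycle_add[of 0 f u "gen (snd e)"] u(1)
    by simp
  then show ?thesis
    using cocycle_transversal[OF f u(1,2)] cocycle_transversal[OF f v]
    by (simp add: cocycle_letter step_def u_def)
qed

text \<open>If \<open>\<psi>\<close> turns the value of each edge into its Schreier generator, the sum
along a path telescopes. This is Schreier's rewriting of elements of \<open>H\<close>.\<close>

lemma cocycle_schreier_rewrite:
  assumes \<psi>: "\<And>x y. \<psi> (x + y) = \<psi> x + \<psi> y" "\<psi> 0 = 0"
    and f: "\<And>u a. rep u = u \<Longrightarrow> u \<in> F n \<Longrightarrow> a < n \<Longrightarrow> \<psi> (f (u, a)) = schreier_gen H (u, a)"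
    and u: "rep u = u" "u \<in> F n" and x: "x \<in> F n"
  shows "\<psi> (cocycle H f u x) = u + x - rep (u + x)"
proof -
  have \<psi>_minus: "\<psi> (- x) = - \<psi> x" for x
    using \<psi>(1)[of "- x" x, symmetric] \<psi>(2) by (simp add: eq_neg_iff_add_eq_0)
  have "\<psi> (path H f u w) = u + word w - rep (u + word w)"
    if "fst ` set w \<subseteq> {..<n}" "rep u = u" "u \<in> F n" for w u
    using that
  proof (induction w arbitrary: u)
    case (Cons l w)
    let ?u = "rep (u + letter l)"
    have "\<psi> (step H f u l) = u + letter l - ?u"
    proof (cases "snd l")
      case True
      then show ?thesis using f[of u "fst l"] Cons.prems
        by (cases l) (simp add: step_def schreier_gen_def)
    next
      case False
      then have "u + letter l + gen (fst l) = u"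
        by (cases l) (simp add: letter_False)
      then have "\<psi> (f (?u, fst l)) = ?u + gen (fst l) - u"
        using f[of ?u "fst l"] Cons.prems by (simp add: schreier_gen_def)
      then show ?thesis
        using False by (cases l) (simp add: step_def \<psi>_minus letter_False
            diff_conv_add_uminus minus_add add.assoc del: add_uminus_conv_diff)
    qed
    moreover have "\<psi> (path H f ?u w) = ?u + word w - rep (?u + word w)"
      using Cons.IH[of ?u] Cons.prems by simp
    moreover have "(a - b) + (b + c - d) = a + c - d" for a b c d :: freegrp
      by (metis add_diff_eq diff_add_cancel_left)
    ultimately have "\<psi> (path H f u (l # w)) = u + letter l + word w - rep (?u + word w)"
      by (simp only: path.simps \<psi>(1))
    then show ?case by (simp add: add.assoc)
  qed (simp add: \<psi>)
  from this[of "letters x" u] show ?thesis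
    using u x by (simp add: F_def cocycle_def)
qed

end

text \<open>A group that is generated by \<open>k\<close> elements has at most \<open>2\<^sup>k\<close>
homomorphisms to the group of order two. If their values on \<open>E\<close> can be prescribed freely,
then \<open>E\<close> has at most \<open>k\<close> elements.\<close>

lemma card_le_rank:
  fixes \<tau> :: "'e \<Rightarrow> freegrp" and \<chi> :: "('e \<Rightarrow> bit) \<Rightarrow> freegrp \<Rightarrow> bit"
  assumes E: "finite E"
    and hom: "\<And>\<phi>. hom_on k (\<lambda>x. \<chi> \<phi> (\<theta> x))"
    and \<chi>: "\<And>\<phi> e. e \<in> E \<Longrightarrow> \<chi> \<phi> (\<tau> e) = \<phi> e"
    and \<tau>: "\<And>e. e \<in> E \<Longrightarrow> \<tau> e \<in> \<theta> ` F k"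
  shows "card E \<le> k"
proof -
  have UNIV_bit: "finite (UNIV :: bit set)" "card (UNIV :: bit set) = 2"
  proof -
    have "x \<in> {0, 1}" for x :: bit using bit_not_zero_iff[of x] by blast
    then have U: "(UNIV :: bit set) = {0, 1}" by blast
    show "finite (UNIV :: bit set)" "card (UNIV :: bit set) = 2"
      unfolding U by simp_all
  qed
  define R where "R \<phi> = restrict (\<lambda>i. \<chi> \<phi> (\<theta> (gen i))) {..<k}" for \<phi>
  have "inj_on R (E \<rightarrow>\<^sub>E (UNIV :: bit set))"
  proof (rule inj_onI)
    fix \<phi> \<phi>' :: "'e \<Rightarrow> bit"
    assume ext: "\<phi> \<in> E \<rightarrow>\<^sub>E UNIV" "\<phi>' \<in> E \<rightarrow>\<^sub>E UNIV" and R: "R \<phi> = R \<phi>'"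
    have "\<chi> \<phi> (\<theta> (gen i)) = \<chi> \<phi>' (\<theta> (gen i))" if "i < k" for i
      using fun_cong[OF R, of i] that by (simp add: R_def)
    then have eq: "\<chi> \<phi> (\<theta> x) = \<chi> \<phi>' (\<theta> x)" if "x \<in> F k" for x
      by (rule hom_on_eqI[OF hom hom _ that])
    have "\<phi> e = \<phi>' e" if "e \<in> E" for e
    proof -
      have "\<tau> e \<in> \<theta> ` F k" by (rule \<tau>[OF that])
      then obtain x where "x \<in> F k" "\<tau> e = \<theta> x" by auto
      then show ?thesis using eq[of x] \<chi>[OF that, of \<phi>] \<chi>[OF that, of \<phi>'] by simp
    qed
    then show "\<phi> = \<phi>'" by (rule PiE_ext[OF ext])
  qed
  moreover have "R ` (E \<rightarrow>\<^sub>E UNIV) \<subseteq> {..<k} \<rightarrow>\<^sub>E UNIV"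
    by (auto simp: R_def split: if_splits)
  ultimately have "card (E \<rightarrow>\<^sub>E (UNIV :: bit set)) \<le> card ({..<k} \<rightarrow>\<^sub>E (UNIV :: bit set))"
    using UNIV_bit by (intro card_inj_on_le[of R]) (simp_all add: finite_PiE)
  then have "(2::nat) ^ card E \<le> 2 ^ k"
    using E UNIV_bit by (simp add: card_PiE)
  then show ?thesis by simp
qed

text \<open>For an enumeration \<open>e\<close> of the non-tree edges, \<open>basis_map\<close> sends
the generators of a free group to the Schreier generators; \<open>basis_coord\<close> is its inverse,
computed by counting crossings in order.\<close>

definition basis_map :: "freegrp set \<Rightarrow> (nat \<Rightarrow> freegrp \<times> nat) \<Rightarrow> freegrp \<Rightarrow> freegrp" where
  "basis_map H e = extend (\<lambda>i. schreier_gen H (e i))"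

definition edge_value :: "nat \<Rightarrow> (nat \<Rightarrow> freegrp \<times> nat) \<Rightarrow> freegrp \<times> nat \<Rightarrow> freegrp" where
  "edge_value k e x = (if x \<in> e ` {..<k} then gen (inv_into {..<k} e x) else 0)"

definition basis_coord :: "freegrp set \<Rightarrow> nat \<Rightarrow> (nat \<Rightarrow> freegrp \<times> nat) \<Rightarrow> freegrp \<Rightarrow> freegrp" where
  "basis_coord H k e = cocycle H (edge_value k e) 0"

context free_subgroup
begin

context
  fixes k and e :: "nat \<Rightarrow> freegrp \<times> nat"
  assumes e: "bij_betw e {..<k} (schreier_edges n H)"
begin

lemma edge_value_e: "i < k \<Longrightarrow> edge_value k e (e i) = gen i"
  using e by (auto simp: edge_value_def bij_betw_def inv_into_f_f)

lemma edge_value_other: "x \<notin> schreier_edges n H \<Longrightarrow> edge_value k e x = 0"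
  using e by (auto simp: edge_value_def bij_betw_def)

lemma basis_map_in: "x \<in> F k \<Longrightarrow> basis_map H e x \<in> H"
  unfolding basis_map_def
  by (rule extend_closed) (auto intro: schreier_gen_in H_zero H_add H_uminus)

lemma basis_map_coord: "h \<in> H \<Longrightarrow> basis_map H e (basis_coord H k e h) = h"
proof -
  assume h: "h \<in> H"
  have "basis_map H e (edge_value k e (u, a)) = schreier_gen H (u, a)"
    if "rep u = u" "u \<in> F n" "a < n" for u a
  proof (cases "(u, a) \<in> schreier_edges n H")
    case True
    then obtain i where "i < k" "(u, a) = e i" using e by (auto simp: bij_betw_def)
    then show ?thesis using edge_value_e by (simp add: basis_map_def)
  next
    case False
    then have "schreier_gen H (u, a) = 0" using that by (simp add: schreier_edges_def)
    then show ?thesis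
      using edge_value_other[OF False] hom_on_zero[OF hom_on_extend] by (simp add: basis_map_def)
  qed
  then have "basis_map H e (cocycle H (edge_value k e) 0 h) = 0 + h - rep (0 + h)"
    using h H_F by (intro cocycle_schreier_rewrite)
      (auto simp: basis_map_def extend_add hom_on_zero[OF hom_on_extend])
  then show ?thesis using h by (simp add: basis_coord_def rep_subgroup)
qed

lemma basis_coord_map:
  assumes "x \<in> F k"
  shows "basis_coord H k e (basis_map H e x) = x"
proof (rule hom_on_eqI[where f = "\<lambda>x. basis_coord H k e (basis_map H e x)" and g = "\<lambda>x. x"])
  show "hom_on k (\<lambda>x. basis_coord H k e (basis_map H e x))"
    unfolding hom_on_def
  proof (intro ballI)
    fix x y assume "x \<in> F k" "y \<in> F k"
    have "basis_map H e (x + y) = basis_map H e x + basis_map H e y"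
      unfolding basis_map_def by (rule extend_add)
    then show "basis_coord H k e (basis_map H e (x + y)) =
        basis_coord H k e (basis_map H e x) + basis_coord H k e (basis_map H e y)"
      unfolding basis_coord_def using cocycle_hom[OF basis_map_in[OF \<open>x \<in> F k\<close>]] by metis
  qed
  show "basis_coord H k e (basis_map H e (gen i)) = gen i" if "i < k" for i
  proof -
    have "e i \<in> schreier_edges n H" using that e by (auto simp: bij_betw_def)
    then have "cocycle H (edge_value k e) 0 (schreier_gen H (e i)) = edge_value k e (e i)"
      using edge_value_other by (intro cocycle_schreier_gen)
    then show ?thesis
      using edge_value_e[OF that] by (simp only: basis_coord_def basis_map_def extend_gen)
  qed
qed (use assms in \<open>simp_all add: hom_on_def\<close>)

lemma basis_coord_in: "h \<in> H \<Longrightarrow> basis_coord H k e h \<in> F k"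
proof -
  assume h: "h \<in> H"
  have val: "edge_value k e x \<in> F k" for x
    using inv_into_into[of x e "{..<k}"] by (simp add: edge_value_def)
  have "path H (edge_value k e) u w \<in> F k" for u w
    by (induction w arbitrary: u) (simp_all add: step_def val)
  then show ?thesis by (simp add: basis_coord_def cocycle_def)
qed

end

text \<open>\<open>card_le_rank\<close> is applied in both directions: \<open>H\<close> is generated by
the \<open>k\<close> images of generators under \<open>\<theta>\<close>, and also by the Schreier
generators.\<close>

lemma card_schreier_edges:
  assumes \<theta>: "hom_on k \<theta>" "inj_on \<theta> (F k)" "\<theta> ` F k = H"
  shows "finite (schreier_edges n H)" "card (schreier_edges n H) = k"
proof -
  have le: "card E \<le> k" if E: "E \<subseteq> schreier_edges n H" "finite E" for E
  proof (rule card_le_rank[where \<tau> = "schreier_gen H" and \<theta> = \<theta>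
        and \<chi> = "\<lambda>\<phi>. cocycle H (\<lambda>x. if x \<in> E then \<phi> x else 0) 0"])
    fix \<phi> :: "freegrp \<times> nat \<Rightarrow> bit"
    show "hom_on k (\<lambda>x. cocycle H (\<lambda>x. if x \<in> E then \<phi> x else 0) 0 (\<theta> x))"
      unfolding hom_on_def
    proof (intro ballI)
      fix x y assume xy: "x \<in> F k" "y \<in> F k"
      then have "\<theta> x \<in> H" using \<theta>(3) by blast
      then show "cocycle H (\<lambda>x. if x \<in> E then \<phi> x else 0) 0 (\<theta> (x + y)) =
          cocycle H (\<lambda>x. if x \<in> E then \<phi> x else 0) 0 (\<theta> x) +
          cocycle H (\<lambda>x. if x \<in> E then \<phi> x else 0) 0 (\<theta> y)"
        unfolding hom_on_add[OF \<theta>(1) xy] by (rule cocycle_hom)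
    qed
    show "cocycle H (\<lambda>x. if x \<in> E then \<phi> x else 0) 0 (schreier_gen H e) = \<phi> e" if "e \<in> E" for e
    proof -
      have "cocycle H (\<lambda>x. if x \<in> E then \<phi> x else 0) 0 (schreier_gen H e) =
          (if e \<in> E then \<phi> e else 0)"
        using that E(1) by (intro cocycle_schreier_gen) auto
      then show ?thesis using that by simp
    qed
  qed (use E schreier_gen_in \<theta>(3) in auto)
  show fin: "finite (schreier_edges n H)"
  proof (rule ccontr)
    assume "infinite (schreier_edges n H)"
    then obtain E where "E \<subseteq> schreier_edges n H" "finite E" "card E = Suc k"
      using infinite_arbitrarily_large by metis
    then show False using le[of E] by simp
  qed
  define m where "m = card (schreier_edges n H)"
  obtain e where e: "bij_betw e {..<m} (schreier_edges n H)"
    using ex_bij_betw_nat_finite[OF fin] by (auto simp: m_def atLeast0LessThan)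
  define \<theta>' where "\<theta>' = inv_into (F k) \<theta>"
  have \<theta>': "\<theta>' (\<theta> x) = x" if "x \<in> F k" for x
    using \<theta>(2) that by (simp add: \<theta>'_def inv_into_f_f)
  have "card {..<k} \<le> m"
  proof (rule card_le_rank[where \<tau> = "\<lambda>i. \<theta> (gen i)" and \<theta> = "basis_map H e"
        and \<chi> = "\<lambda>\<phi> y. extend \<phi> (\<theta>' y)"])
    fix \<phi> :: "nat \<Rightarrow> bit"
    have "\<theta>' (x + y) = \<theta>' x + \<theta>' y" if xy: "x \<in> H" "y \<in> H" for x y
    proof -
      obtain x' y' where "x' \<in> F k" "y' \<in> F k" "x = \<theta> x'" "y = \<theta> y'"
        using xy \<theta>(3) by blast
      then show ?thesis using \<theta>' by (simp flip: hom_on_add[OF \<theta>(1)])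
    qed
    then show "hom_on m (\<lambda>x. extend \<phi> (\<theta>' (basis_map H e x)))"
      unfolding hom_on_def using basis_map_in[OF e]
      by (simp add: basis_map_def extend_add)
    show "extend \<phi> (\<theta>' (\<theta> (gen i))) = \<phi> i" if "i \<in> {..<k}" for i
      using \<theta>'[of "gen i"] that by simp
    show "\<theta> (gen i) \<in> basis_map H e ` F m" if "i \<in> {..<k}" for i
    proof -
      have "\<theta> (gen i) \<in> H" using that \<theta>(3) by auto
      then show ?thesis
        using basis_map_coord[OF e] basis_coord_in[OF e] by (metis imageI)
    qed
  qed simp
  then show "card (schreier_edges n H) = k" using le[OF subset_refl fin] by (simp add: m_def)
qed

end

section \<open>Schreier bases under automorphisms\<close>

lemma (in free_subgroup) cocycle_len_le:
  assumes "\<And>e. len (f e) \<le> 1"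
  shows "len (cocycle H f u x) \<le> len x"
proof -
  have "len (path H f u w) \<le> length w" for w
  proof (induction w arbitrary: u)
    case (Cons l w)
    have "len (step H f u l) \<le> 1"
      using assms[of "(u, fst l)"] assms[of "(rep (u + letter l), fst l)"] by (simp add: step_def)
    then show ?case
      using Cons[of "rep (u + letter l)"]
        len_add_le[of "step H f u l" "path H f (rep (u + letter l)) w"] by simp
  qed simp
  then show ?thesis by (simp add: cocycle_def)
qed

text \<open>A path with nontrivial sum passes through the origin of a non-tree edge \<open>e\<close>. As
this happens after a prefix of \<open>x\<close>, only few starting points \<open>u\<close> are possible
for given \<open>x\<close>, which is what the conclusion records.\<close>

lemma (in free_subgroup) cocycle_nonzero_crosses:
  assumes f: "\<And>e. e \<notin> schreier_edges n H \<Longrightarrow> f e = 0" and u: "rep u = u"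
    and nz: "cocycle H f u x \<noteq> 0"
  obtains e i where "e \<in> schreier_edges n H" "i \<le> len x" "rep (fst e - prefix_elem i x) = u"
proof -
  have "\<exists>e\<in>schreier_edges n H. \<exists>i\<le>length w. fst e = rep (u + word (take i w))"
    if "path H f u w \<noteq> 0" "rep u = u" for w u
    using that
  proof (induction w arbitrary: u)
    case (Cons l w)
    show ?case
    proof (cases "step H f u l = 0")
      case False
      show ?thesis
      proof (cases "snd l")
        case True
        then have "(u, fst l) \<in> schreier_edges n H" using False f by (auto simp: step_def)
        then show ?thesis using Cons.prems(2) by (intro bexI[of _ "(u, fst l)"] exI[of _ 0]) auto
      next
        case False': False
        then have "(rep (u + letter l), fst l) \<in> schreier_edges n H"
          using False f by (auto simp: step_def)
        then show ?thesis
          by (intro bexI[of _ "(rep (u + letter l), fst l)"] exI[of _ 1]) auto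
      qed
    next
      case True
      then have "path H f (rep (u + letter l)) w \<noteq> 0" using Cons.prems(1) by simp
      from Cons.IH[OF this] obtain e i where "e \<in> schreier_edges n H" "i \<le> length w"
        "fst e = rep (rep (u + letter l) + word (take i w))" by auto
      then show ?thesis by (intro bexI[of _ e] exI[of _ "Suc i"]) (simp_all add: add.assoc)
    qed
  qed simp
  from this[of u "letters x"] obtain e i where
    e: "e \<in> schreier_edges n H" "i \<le> len x" "fst e = rep (u + prefix_elem i x)"
    using nz u by (auto simp: cocycle_def prefix_elem_def)
  have "rep (fst e - prefix_elem i x) = rep (u + prefix_elem i x + - prefix_elem i x)"
    using rep_rep_add[of "u + prefix_elem i x" "- prefix_elem i x"] e(3) by simp
  then show thesis using that[of e i] e u by simp
qed

lemma free_subgroup_image: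
  assumes "free_subgroup n H" "aut_on n \<sigma>"
  shows "free_subgroup n (\<sigma> ` H)"
proof -
  interpret H: free_subgroup n H by fact
  note hom = aut_on_hom[OF assms(2)]
  show ?thesis
  proof
    show "\<sigma> ` H \<subseteq> F n" using H.H_F aut_on_closed[OF assms(2)] by auto
    show "0 \<in> \<sigma> ` H" using hom_on_zero[OF hom] H.H_zero by (metis imageI)
  next
    fix x y assume "x \<in> \<sigma> ` H" "y \<in> \<sigma> ` H"
    then obtain a b where ab: "a \<in> H" "b \<in> H" "x = \<sigma> a" "y = \<sigma> b" by auto
    then have "x + y = \<sigma> (a + b)" using H.H_F by (simp add: hom_on_add[OF hom] subset_iff)
    then show "x + y \<in> \<sigma> ` H" using H.H_add ab by blast
  next
    fix x assume "x \<in> \<sigma> ` H"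
    then obtain a where a: "a \<in> H" "x = \<sigma> a" by auto
    then have "- x = \<sigma> (- a)" using H.H_F by (simp add: hom_on_uminus[OF hom] subset_iff)
    then show "- x \<in> \<sigma> ` H" using H.H_uminus a by blast
  qed
qed

context
  fixes n k L :: nat and H :: "freegrp set" and \<sigma> :: "freegrp \<Rightarrow> freegrp"
    and f :: "freegrp \<times> nat \<Rightarrow> freegrp"
  assumes H: "free_subgroup n H" and \<sigma>: "aut_on n \<sigma>"
    and L: "\<And>x. x \<in> F n \<Longrightarrow> len (\<sigma> x) \<le> L * len x"
    and fin: "finite (schreier_edges n (\<sigma> ` H))" and k: "card (schreier_edges n (\<sigma> ` H)) \<le> k"
    and f: "\<And>e. e \<notin> schreier_edges n (\<sigma> ` H) \<Longrightarrow> f e = 0" and f1: "\<And>e. len (f e) \<le> 1"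
begin

interpretation H: free_subgroup n H by (rule H)

interpretation K: free_subgroup n "\<sigma> ` H" by (rule free_subgroup_image[OF H \<sigma>])

text \<open>The image of the tree path to \<open>u\<close> is cut into blocks, one for each letter of
\<open>u\<close>. A block contributes at most \<open>L\<close>, and it contributes something only if it
crosses one of the at most \<open>k\<close> non-tree edges. The block is determined by its letter and
its starting vertex, since \<open>u\<close> visits each vertex of the coset graph of \<open>H\<close> at
most once; the number of contributing blocks is therefore bounded independently of \<open>u\<close> and
\<open>H\<close>.\<close>

lemma cocycle_image_transversal:
  assumes u: "coset_rep H u = u" "u \<in> F n"
  shows "len (cocycle (\<sigma> ` H) f 0 (\<sigma> u)) \<le> L * (k * (L + 1) * (2 * n))"
proof -
  note hom = aut_on_hom[OF \<sigma>]
  define \<gamma> where "\<gamma> = cocycle (\<sigma> ` H) f"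
  define l where "l i = letters u ! i" for i
  define s where "s i = coset_rep (\<sigma> ` H) (\<sigma> (prefix_elem i u))" for i
  have l: "fst (l i) < n" if "i < len u" for i
    using u(2) nth_mem[OF that] by (force simp: F_def l_def)
  have prefix_Suc: "prefix_elem (Suc i) u = prefix_elem i u + letter (l i)" if "i < len u" for i
    using that by (simp add: prefix_elem_def l_def take_Suc_conv_app_nth)
  \<comment> \<open>\<open>s i\<close> is the vertex at which the block of the letter \<open>l i\<close> starts.\<close>
  define B where "B = {i. i < len u \<and> \<gamma> (s i) (\<sigma> (letter (l i))) \<noteq> 0}"
  have len_letter: "len (\<sigma> (letter (l i))) \<le> L" if "i < len u" for i
    using L[of "letter (l i)"] l[OF that] by simp
  have bound: "len (\<gamma> 0 (\<sigma> (prefix_elem j u))) \<le> L * card (B \<inter> {..<j})" if "j \<le> len u" for j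
    using that
  proof (induction j)
    case 0
    then show ?case by (simp add: hom_on_zero[OF hom] \<gamma>_def cocycle_def)
  next
    case (Suc j)
    then have j: "j < len u" by simp
    have "\<sigma> (prefix_elem (Suc j) u) = \<sigma> (prefix_elem j u) + \<sigma> (letter (l j))"
      using u(2) l[OF j] by (simp add: prefix_Suc[OF j] hom_on_add[OF hom])
    then have eq: "\<gamma> 0 (\<sigma> (prefix_elem (Suc j) u)) =
        \<gamma> 0 (\<sigma> (prefix_elem j u)) + \<gamma> (s j) (\<sigma> (letter (l j)))"
      using K.cocycle_add[of 0 f "\<sigma> (prefix_elem j u)" "\<sigma> (letter (l j))"]
      by (simp add: \<gamma>_def s_def)
    show ?case
    proof (cases "j \<in> B")
      case False
      then have "B \<inter> {..<Suc j} = B \<inter> {..<j}" by (auto simp: less_Suc_eq)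
      then show ?thesis using False j Suc.IH eq by (simp add: B_def)
    next
      case True
      then have "B \<inter> {..<Suc j} = insert j (B \<inter> {..<j})" by auto
      then have "card (B \<inter> {..<Suc j}) = Suc (card (B \<inter> {..<j}))" by simp
      moreover have "len (\<gamma> (s j) (\<sigma> (letter (l j)))) \<le> L"
        using K.cocycle_len_le[of f "s j" "\<sigma> (letter (l j))"] f1 len_letter[OF j]
        by (simp add: \<gamma>_def)
      ultimately show ?thesis
        using Suc.IH j eq len_add_le[of "\<gamma> 0 (\<sigma> (prefix_elem j u))" "\<gamma> (s j) (\<sigma> (letter (l j)))"]
        by simp
    qed
  qed
  \<comment> \<open>By \<open>cocycle_nonzero_crosses\<close>, a contributing block is determined by an edge, a position in the block and a letter.\<close>
  define Q where "Q = schreier_edges n (\<sigma> ` H) \<times> {..L} \<times> ({..<n} \<times> (UNIV :: bool set))"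
  define q where "q = (\<lambda>(e :: freegrp \<times> nat, i, x).
    (coset_rep (\<sigma> ` H) (fst e - prefix_elem i (\<sigma> (letter x))), x))"
  have "inj_on (\<lambda>i. (s i, l i)) B"
  proof (rule inj_onI)
    fix i j assume ij: "i \<in> B" "j \<in> B" "(s i, l i) = (s j, l j)"
    then obtain h where h: "h \<in> H" "\<sigma> (prefix_elem j u) = \<sigma> h + \<sigma> (prefix_elem i u)"
      using K.rep_eq_iff by (auto simp: s_def)
    then have "\<sigma> (prefix_elem j u) = \<sigma> (h + prefix_elem i u)"
      using u(2) H.H_F by (simp add: hom_on_add[OF hom] subset_iff)
    then have "prefix_elem j u = h + prefix_elem i u"
      using aut_on_inj[OF \<sigma>, of "prefix_elem j u" "h + prefix_elem i u"] h(1) u(2) H.H_F by auto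
    then have "prefix_elem i u = prefix_elem j u"
      using H.rep_add[OF h(1)] H.rep_prefix_elem[OF u(1)] by metis
    then have "min (len u) i = min (len u) j"
      by (metis length_take letters_prefix_elem)
    then show "i = j" using ij by (simp add: B_def)
  qed
  moreover have "(\<lambda>i. (s i, l i)) ` B \<subseteq> q ` Q"
  proof
    fix y assume "y \<in> (\<lambda>i. (s i, l i)) ` B"
    then obtain i where i: "i \<in> B" "y = (s i, l i)" by auto
    then have "cocycle (\<sigma> ` H) f (s i) (\<sigma> (letter (l i))) \<noteq> 0" "i < len u"
      by (simp_all add: B_def \<gamma>_def)
    then obtain e j where e: "e \<in> schreier_edges n (\<sigma> ` H)" "j \<le> len (\<sigma> (letter (l i)))"
      "coset_rep (\<sigma> ` H) (fst e - prefix_elem j (\<sigma> (letter (l i)))) = s i"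
      using K.cocycle_nonzero_crosses[where f = f and u = "s i" and x = "\<sigma> (letter (l i))", OF f]
      by (auto simp: s_def)
    then have "y = q (e, j, l i)" using i by (simp add: q_def)
    moreover have "(e, j, l i) \<in> Q"
      using e len_letter[OF \<open>i < len u\<close>] l[OF \<open>i < len u\<close>] by (cases "l i") (auto simp: Q_def)
    ultimately show "y \<in> q ` Q" by blast
  qed
  moreover have "finite Q" using fin by (simp add: Q_def)
  ultimately have "card B \<le> card Q"
    using surj_card_le[of Q "(\<lambda>i. (s i, l i)) ` B" q] card_image by metis
  also have "\<dots> = card (schreier_edges n (\<sigma> ` H)) * ((L + 1) * (n * 2))"
    by (simp add: Q_def card_cartesian_product)
  also have "\<dots> \<le> k * ((L + 1) * (n * 2))"
    using k by (rule mult_le_mono1)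
  finally have "card B \<le> k * (L + 1) * (2 * n)"
    by (simp add: algebra_simps)
  then have B: "L * card B \<le> L * (k * (L + 1) * (2 * n))"
    by (rule mult_le_mono2)
  have "B \<inter> {..<len u} = B" by (auto simp: B_def)
  then have "len (\<gamma> 0 (\<sigma> u)) \<le> L * card B" using bound[of "len u"] by simp
  then show ?thesis using B unfolding \<gamma>_def by (rule le_trans)
qed

text \<open>A Schreier generator runs along the tree, crosses one edge, and returns along the tree.\<close>

lemma cocycle_image_schreier_gen:
  assumes e: "e \<in> schreier_edges n H"
  shows "len (cocycle (\<sigma> ` H) f 0 (\<sigma> (schreier_gen H e))) \<le>
    2 * (L * (k * (L + 1) * (2 * n))) + L"
proof -
  note hom = aut_on_hom[OF \<sigma>]
  define u where "u = fst e"
  define g where "g = gen (snd e)"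
  define v where "v = coset_rep H (u + g)"
  have u: "coset_rep H u = u" "u \<in> F n" and g: "g \<in> F n"
    using e by (simp_all add: u_def g_def schreier_edges_def)
  have v: "coset_rep H v = v" "v \<in> F n" using u g by (simp_all add: v_def)
  define y where "y = schreier_gen H e"
  have y: "y \<in> H" by (simp only: y_def H.schreier_gen_in)
  then have "y \<in> F n" using H.H_F by blast
  have "y + v = u + g" by (simp add: y_def schreier_gen_def u_def g_def v_def)
  then have "\<sigma> y + \<sigma> v = \<sigma> u + \<sigma> g"
    using \<open>y \<in> F n\<close> u v g by (simp flip: hom_on_add[OF hom])
  define c where "c = cocycle (\<sigma> ` H) f"
  have "c 0 (\<sigma> y) + c 0 (\<sigma> v) = c 0 (\<sigma> u) + c (coset_rep (\<sigma> ` H) (\<sigma> u)) (\<sigma> g)"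
    using K.cocycle_hom[of "\<sigma> y" f "\<sigma> v"] K.cocycle_add[of 0 f "\<sigma> u" "\<sigma> g"] y
      \<open>\<sigma> y + \<sigma> v = \<sigma> u + \<sigma> g\<close> by (simp add: c_def)
  then have eq: "c 0 (\<sigma> y) = c 0 (\<sigma> u) + c (coset_rep (\<sigma> ` H) (\<sigma> u)) (\<sigma> g) + - c 0 (\<sigma> v)"
    by (metis add.assoc add.right_inverse add.right_neutral)
  have "len (c 0 (\<sigma> y)) \<le>
      len (c 0 (\<sigma> u)) + len (c (coset_rep (\<sigma> ` H) (\<sigma> u)) (\<sigma> g)) + len (c 0 (\<sigma> v))"
    unfolding eq using len_add_le[of "c 0 (\<sigma> u) + c (coset_rep (\<sigma> ` H) (\<sigma> u)) (\<sigma> g)" "- c 0 (\<sigma> v)"]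
      len_add_le[of "c 0 (\<sigma> u)" "c (coset_rep (\<sigma> ` H) (\<sigma> u)) (\<sigma> g)"] len_uminus[of "c 0 (\<sigma> v)"]
    by linarith
  moreover have "len (c (coset_rep (\<sigma> ` H) (\<sigma> u)) (\<sigma> g)) \<le> L"
    using K.cocycle_len_le[of f "coset_rep (\<sigma> ` H) (\<sigma> u)" "\<sigma> g"] f1 L[OF g]
    by (simp add: c_def g_def)
  ultimately show ?thesis
    using cocycle_image_transversal[OF u] cocycle_image_transversal[OF v]
    by (simp add: c_def y_def)
qed

end

definition schreier_marking :: "nat \<Rightarrow> nat \<Rightarrow> freegrp set \<Rightarrow> nat \<Rightarrow> freegrp \<times> nat" where
  "schreier_marking n k H = (SOME e. bij_betw e {..<k} (schreier_edges n H))"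

text \<open>A chosen Schreier basis of \<open>H\<close>, as an isomorphism from \<open>F k\<close>;
\<open>comarking\<close> is its inverse.\<close>

definition marking :: "nat \<Rightarrow> nat \<Rightarrow> freegrp set \<Rightarrow> freegrp \<Rightarrow> freegrp" where
  "marking n k H = basis_map H (schreier_marking n k H)"

definition comarking :: "nat \<Rightarrow> nat \<Rightarrow> freegrp set \<Rightarrow> freegrp \<Rightarrow> freegrp" where
  "comarking n k H = basis_coord H k (schreier_marking n k H)"

locale marked_subgroup = free_subgroup n H for n and H :: "freegrp set" +
  fixes k :: nat
  assumes rank: "\<exists>\<theta>. hom_on k \<theta> \<and> inj_on \<theta> (F k) \<and> \<theta> ` F k = H"
begin

lemma finite_edges: "finite (schreier_edges n H)" and card_edges: "card (schreier_edges n H) = k"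
  using rank card_schreier_edges by blast+

lemma schreier_marking: "bij_betw (schreier_marking n k H) {..<k} (schreier_edges n H)"
proof -
  have "\<exists>e. bij_betw e {..<k} (schreier_edges n H)"
    using ex_bij_betw_nat_finite[OF finite_edges] card_edges by (simp add: atLeast0LessThan)
  then show ?thesis unfolding schreier_marking_def by (rule someI_ex)
qed

lemmas marking_in = basis_map_in[OF schreier_marking, folded marking_def]
lemmas comarking_in = basis_coord_in[OF schreier_marking, folded comarking_def]
lemmas marking_comarking =
  basis_map_coord[OF schreier_marking, folded marking_def comarking_def]
lemmas comarking_marking =
  basis_coord_map[OF schreier_marking, folded marking_def comarking_def]

lemma marking_add: "marking n k H (x + y) = marking n k H x + marking n k H y"
  by (simp add: marking_def basis_map_def extend_add)

end

text \<open>The bound is uniform in \<open>H\<close>. So the Schreier bases of \<open>H\<close> and of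
\<open>\<sigma> H\<close> correspond under \<open>\<sigma>\<close> up to an automorphism of \<open>F
k\<close> from a finite set, although there are infinitely many \<open>H\<close>.\<close>

lemma marking_change_bounded:
  assumes \<sigma>: "aut_on n \<sigma>"
  obtains D where "\<And>H i. marked_subgroup n H k \<Longrightarrow> i < k \<Longrightarrow>
    len (comarking n k (\<sigma> ` H) (\<sigma> (marking n k H (gen i)))) \<le> D"
proof -
  obtain L where L: "\<And>x. x \<in> F n \<Longrightarrow> len (\<sigma> x) \<le> L * len x"
    using aut_on_bilipschitz[OF \<sigma>] by blast
  show thesis
  proof (rule that)
    fix H i assume H: "marked_subgroup n H k" and i: "i < k"
    interpret H: marked_subgroup n H k by fact
    interpret K: free_subgroup n "\<sigma> ` H" using free_subgroup_image[OF H.free_subgroup_axioms \<sigma>] .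
    interpret K: marked_subgroup n "\<sigma> ` H" k
    proof
      obtain \<theta> where \<theta>: "hom_on k \<theta>" "inj_on \<theta> (F k)" "\<theta> ` F k = H" using H.rank by blast
      have sub: "\<theta> x \<in> F n" if "x \<in> F k" for x using \<theta>(3) H.H_F that by blast
      have "hom_on k (\<lambda>x. \<sigma> (\<theta> x))"
        using hom_on_add[OF aut_on_hom[OF \<sigma>]] hom_on_add[OF \<theta>(1)] sub by (simp add: hom_on_def)
      moreover have "inj_on (\<lambda>x. \<sigma> (\<theta> x)) (F k)"
        using \<theta>(2) aut_on_inj[OF \<sigma>] sub by (auto simp: inj_on_def)
      moreover have "(\<lambda>x. \<sigma> (\<theta> x)) ` F k = \<sigma> ` H" using \<theta>(3) by (auto simp: image_image)
      ultimately show "\<exists>\<theta>. hom_on k \<theta> \<and> inj_on \<theta> (F k) \<and> \<theta> ` F k = \<sigma> ` H" by blast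
    qed
    let ?e = "schreier_marking n k H" and ?f = "edge_value k (schreier_marking n k (\<sigma> ` H))"
    have "?e i \<in> schreier_edges n H" using H.schreier_marking i by (auto simp: bij_betw_def)
    then have "len (cocycle (\<sigma> ` H) ?f 0 (\<sigma> (schreier_gen H (?e i)))) \<le>
        2 * (L * (k * (L + 1) * (2 * n))) + L"
      using H.free_subgroup_axioms \<sigma> L K.finite_edges K.card_edges
        K.edge_value_other[OF K.schreier_marking]
      by (intro cocycle_image_schreier_gen) (auto simp: edge_value_def)
    then show "len (comarking n k (\<sigma> ` H) (\<sigma> (marking n k H (gen i)))) \<le>
        2 * (L * (k * (L + 1) * (2 * n))) + L"
      by (simp add: comarking_def marking_def basis_coord_def basis_map_def)
  qed
qed

section \<open>Nielsen reduction\<close>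

text \<open>The letters are the digits of a number in base \<open>2 * n\<close>, so words of the same
length are compared lexicographically.\<close>

fun word_code :: "nat \<Rightarrow> letter list \<Rightarrow> nat" where
  "word_code n [] = 0"
| "word_code n (l # w) = letter_code l * (2 * n) ^ length w + word_code n w"

lemma word_code_append:
  "word_code n (p @ s) = word_code n p * (2 * n) ^ length s + word_code n s"
  by (induction p) (simp_all add: algebra_simps power_add)

lemma word_code_less: "fst ` set w \<subseteq> {..<n} \<Longrightarrow> word_code n w < (2 * n) ^ length w"
proof (induction w)
  case (Cons l w)
  then have "letter_code l + 1 \<le> 2 * n" by (auto simp: letter_code_def)
  then have "(letter_code l + 1) * (2 * n) ^ length w \<le> 2 * n * (2 * n) ^ length w"
    by (rule mult_le_mono1)
  then show ?case using Cons by (simp add: algebra_simps)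
qed simp

lemma word_code_inj:
  assumes "word_code n p = word_code n q" "length p = length q"
    "fst ` set p \<subseteq> {..<n}" "fst ` set q \<subseteq> {..<n}"
  shows "p = q"
  using assms(2,1,3,4)
proof (induction p q rule: list_induct2)
  case (Cons l p m q)
  define B where "B = (2 * n) ^ length p"
  have less: "word_code n p < B" "word_code n q < B"
    using Cons word_code_less[of p n] word_code_less[of q n] by (simp_all add: B_def)
  have eq: "letter_code l * B + word_code n p = letter_code m * B + word_code n q"
    using Cons by (simp add: B_def)
  from arg_cong[OF eq, of "\<lambda>x. x div B"] have "letter_code l = letter_code m"
    using less by simp
  then have "l = m" by (simp add: letter_code_inj)
  with eq Cons show ?case by simp
qed simp

lemma lcp_self: "lcp w w = length w"
  by (induction w) auto

definition half_code :: "nat \<Rightarrow> freegrp \<Rightarrow> nat" where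
  "half_code n x = word_code n (take ((len x + 1) div 2) (letters x))"

text \<open>The codes of the initial and of the inverted terminal half of a word break ties between
words of the same length in the reduction.\<close>

definition half_weight :: "nat \<Rightarrow> freegrp \<Rightarrow> nat" where
  "half_weight n x = half_code n x + half_code n (- x)"

definition simpler :: "nat \<Rightarrow> freegrp \<Rightarrow> freegrp \<Rightarrow> bool" where
  "simpler n x y \<longleftrightarrow> len x < len y \<or> len x = len y \<and> half_weight n x < half_weight n y"

lemma simpler_uminus [simp]: "simpler n (- x) y = simpler n x y" "simpler n x (- y) = simpler n x y"
  by (simp_all add: simpler_def half_weight_def add.commute)

lemma letters_lcp_prefix:
  assumes "k \<le> lcp (letters x) (letters y)"
  shows "take k (letters x) = take k (letters y)"
proof -
  obtain p u v where "letters x = p @ u" "letters y = p @ v"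
      "length p = lcp (letters x) (letters y)" "u = [] \<or> v = [] \<or> hd u \<noteq> hd v"
    by (rule lcp_split)
  then show ?thesis using assms by simp
qed

text \<open>If exactly half of \<open>y\<close> cancels in \<open>y + z\<close>, then \<open>y +
z\<close> arises from \<open>z\<close> by exchanging a prefix \<open>q\<close> for the first half
\<open>p\<close> of \<open>y\<close>. Length and terminal half stay the same, so the exchange is no
simplification only if the code of \<open>q\<close> is at most that of \<open>p\<close>.\<close>

lemma half_exchange:
  assumes y: "len y = 2 * k" and c: "cancel y z = k" and z: "2 * k \<le> len z"
    and not: "\<not> simpler n (y + z) z" and F: "0 < n"
  shows "word_code n (take k (letters (- y))) \<le> word_code n (take k (letters y))"
proof -
  define p q where "p = take k (letters y)" and "q = take k (letters (- y))"
  define z' where "z' = drop k (letters z)"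
  have q: "q = take k (letters z)"
    unfolding q_def using c by (intro letters_lcp_prefix) (simp add: cancel_def gp_def)
  have lz: "letters z = q @ z'" by (simp add: q z'_def)
  have lq: "length q = k" "length p = k" using y by (simp_all add: q_def p_def)
  have ly: "letters y = p @ rev (map inv_letter q)"
  proof -
    have "letters y = rev (map inv_letter (letters (- y)))"
      using letters_uminus[of "- y"] by simp
    then have "drop k (letters y) = rev (map inv_letter (take (len (- y) - k) (letters (- y))))"
      by (metis drop_rev length_map take_map)
    also have "len (- y) - k = k" using y by simp
    finally have "drop k (letters y) = rev (map inv_letter q)" by (simp only: q_def)
    then show ?thesis by (metis append_take_drop_id p_def)
  qed
  have "word (rev (map inv_letter q)) = - word q"
    by (induction q) (simp_all add: letter_inv_letter minus_add)
  then have "y + z = word p + word z'"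
    using letters_split(1)[OF ly] letters_split(1)[OF lz] by (simp add: add.assoc)
  moreover have "len (y + z) = len z" using len_add[of y z] y c by simp
  ultimately have lyz: "letters (y + z) = p @ z'"
    using letters_add_of_len[of "word p" "word z'"] lz lq
    by (simp add: letters_split[OF ly] letters_split[OF lz])
  define h where "h = (len z + 1) div 2"
  have h: "k \<le> h" "h \<le> length z'" using z lz lq by (auto simp: h_def)
  have "half_code n (- (y + z)) = half_code n (- z)"
    using h by (simp add: half_code_def letters_uminus lyz lz lq flip: h_def)
  moreover have "half_code n (y + z) = word_code n (p @ take (h - k) z')"
    "half_code n z = word_code n (q @ take (h - k) z')"
    using h by (simp_all add: half_code_def lyz lz lq h_def)
  ultimately have "word_code n q \<le> word_code n p"
    using not \<open>len (y + z) = len z\<close> F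
    by (auto simp: simpler_def half_weight_def word_code_append not_less)
  then show ?thesis by (simp add: p_def q_def)
qed

text \<open>If no product of two basis elements is simpler than a factor, then at most half of each
factor is lost on either side. If a factor were lost completely, half on each side, then
\<open>half_exchange\<close> on both sides would force its two halves to be inverse to each other. So
products are thin.\<close>

lemma length_le_of_no_simplification:
  assumes \<phi>: "aut_on n \<phi>"
    and left: "\<And>l m. fst l < n \<Longrightarrow> fst m < n \<Longrightarrow> fst l \<noteq> fst m \<Longrightarrow>
      \<not> simpler n (\<phi> (letter l) + \<phi> (letter m)) (\<phi> (letter l))"
    and x: "x \<in> F n"
  shows "len x \<le> len (\<phi> x)"
proof -
  note hom = aut_on_hom[OF \<phi>]
  define b where "b l = \<phi> (letter l)" for l
  have b_inv: "b (inv_letter l) = - b l" if "fst l < n" for l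
    using that by (simp add: b_def letter_inv_letter hom_on_uminus[OF hom])
  have b: "b l \<in> F n" "b l \<noteq> 0" if "fst l < n" for l
    using that aut_on_closed[OF \<phi>, of "letter l"] aut_on_eq_0[OF \<phi>, of "letter l"]
    by (simp_all add: b_def letters_eq_Nil[symmetric] del: letters_eq_Nil)
  have right: "\<not> simpler n (b l + b m) (b m)" if "fst l < n" "fst m < n" "fst l \<noteq> fst m" for l m
    using left[of "inv_letter m" "inv_letter l"] that
      simpler_uminus(1)[of n "b l + b m"] by (simp add: minus_add b_inv flip: b_def)
  have half: "2 * cancel (b l) (b m) \<le> len (b l)" "2 * cancel (b l) (b m) \<le> len (b m)"
    if "fst l < n" "fst m < n" "m \<noteq> inv_letter l" for l m
  proof -
    have "2 * cancel (b l) (b m) \<le> len (b l) \<and> 2 * cancel (b l) (b m) \<le> len (b m)"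
    proof (cases "fst l = fst m")
      case True
      then have "m = l" using that(3) by (auto simp: inv_letter_def prod_eq_iff)
      then show ?thesis using two_cancel_self_less[OF b(2)[OF that(1)]] by simp
    next
      case False
      then show ?thesis
        using left[OF that(1,2) False] right[OF that(1,2) False] len_add[of "b l" "b m"]
        by (simp add: simpler_def flip: b_def)
    qed
    then show "2 * cancel (b l) (b m) \<le> len (b l)" "2 * cancel (b l) (b m) \<le> len (b m)"
      by simp_all
  qed
  have mid: "cancel (b l) (b m) + cancel (b m) (b r) < len (b m)"
    if lmr: "fst l < n" "fst m < n" "fst r < n" "m \<noteq> inv_letter l" "r \<noteq> inv_letter m" for l m r
  proof (rule ccontr)
    assume neg: "\<not> ?thesis"
    define k where "k = cancel (b l) (b m)"
    have k: "len (b m) = 2 * k" "cancel (b l) (b m) = k" "cancel (b m) (b r) = k"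
      using neg half(2)[OF lmr(1,2,4)] half(1)[OF lmr(2,3,5)] by (simp_all add: k_def)
    have ne: "fst l \<noteq> fst m" "fst m \<noteq> fst r"
    proof -
      have self: "2 * cancel (b m) (b m) < len (b m)"
        by (rule two_cancel_self_less[OF b(2)[OF lmr(2)]])
      show "fst l \<noteq> fst m"
      proof
        assume "fst l = fst m"
        then have "l = m" using lmr(4) by (auto simp: inv_letter_def prod_eq_iff)
        then show False using self k by simp
      qed
      show "fst m \<noteq> fst r"
      proof
        assume "fst m = fst r"
        then have "r = m" using lmr(5) by (auto simp: inv_letter_def prod_eq_iff)
        then show False using self k by simp
      qed
    qed
    have n: "0 < n" using lmr(1) by simp
    have "word_code n (take k (letters (- b m))) \<le> word_code n (take k (letters (b m)))"
      using k half(2)[OF lmr(2,3,5)] right[OF lmr(2,3) ne(2)] n by (intro half_exchange) auto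
    moreover have "word_code n (take k (letters (- (- b m)))) \<le> word_code n (take k (letters (- b m)))"
    proof (rule half_exchange)
      show "cancel (- b m) (- b l) = k" using k(2) by (simp add: cancel_inverse)
      show "\<not> simpler n (- b m + - b l) (- b l)"
        using left[OF lmr(1,2) ne(1)] simpler_uminus(1)[of n "b l + b m"]
        by (simp add: minus_add flip: b_def)
    qed (use k half(1)[OF lmr(1,2,4)] n in auto)
    ultimately have "word_code n (take k (letters (- b m))) = word_code n (take k (letters (b m)))"
      by simp
    moreover have "fst ` set (take k (letters y)) \<subseteq> {..<n}" if "y \<in> F n" for y
      using F_prefix_elem[OF that, of k] by (simp add: F_def)
    ultimately have eq: "take k (letters (- b m)) = take k (letters (b m))"
      using b(1)[OF lmr(2)] by (intro word_code_inj[of n]) (simp_all add: k(1))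
    then have "take k (letters (b m)) @ [] = take k (letters (- b m)) @ []" by simp
    then have "gp 0 (prefix_elem k (- b m)) (prefix_elem k (b m)) = k"
      using k(1) by (simp add: gp_def lcp_self)
    then have "k \<le> cancel (b m) (b m)"
      by (simp add: gp_prefix_elem gp_prefix_elem' cancel_def)
    then show False using two_cancel_self_less[OF b(2)[OF lmr(2)]] k(1) by simp
  qed
  have thin: "thin (map b w)" if "reduced w" "fst ` set w \<subseteq> {..<n}" for w
    using that
  proof (induction w)
    case (Cons l w)
    note IH = Cons.IH
    show ?case
    proof (cases w)
      case Nil
      then show ?thesis using Cons.prems b(2)[of l] by simp
    next
      case (Cons m w')
      have lm: "fst l < n" "fst m < n" "m \<noteq> inv_letter l" "thin (map b w)"
        using Cons.prems Cons IH by (auto simp: reduced_Cons)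
      have "cancel (b l) (b m) < len (b l)"
        using half(1)[OF lm(1-3)] b(2)[OF lm(1)] by (cases "len (b l)") auto
      moreover have "cancel (b l) (b m) + cancel_next (b m) (map b w') < len (b m)"
      proof (cases w')
        case Nil
        then show ?thesis
          using half(2)[OF lm(1-3)] b(2)[OF lm(2)] by (cases "len (b m)") auto
      next
        case (Cons r w'')
        then have "fst r < n" "r \<noteq> inv_letter m"
          using Cons.prems \<open>w = m # w'\<close> by (auto simp: reduced_Cons)
        then show ?thesis using mid[of l m r] lm Cons by simp
      qed
      ultimately show ?thesis using lm(4) Cons by simp
    qed
  qed simp
  have "\<phi> (word w) = sum_list (map b w)" if "fst ` set w \<subseteq> {..<n}" for w
    using that
    by (induction w) (simp_all add: hom_on_zero[OF hom] hom_on_add[OF hom] F_word b_def)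
  from this[of "letters x"] show ?thesis
    using length_le_thin_sum_list[OF thin[of "letters x"]] x by (simp add: F_def)
qed

definition nielsen_move :: "nat \<Rightarrow> freegrp \<Rightarrow> freegrp \<Rightarrow> freegrp \<Rightarrow> freegrp" where
  "nielsen_move i p q = extend (\<lambda>m. if m = i then p + gen i + q else gen m)"

lemma nielsen_move_gen [simp]:
  "nielsen_move i p q (gen m) = (if m = i then p + gen i + q else gen m)"
  by (simp add: nielsen_move_def)

lemma hom_on_nielsen_move: "hom_on n (nielsen_move i p q)"
  unfolding nielsen_move_def by (rule hom_on_extend)

text \<open>A factor by which the generator \<open>i\<close> may be multiplied in a Nielsen move: a
letter with another index, or nothing.\<close>

definition other_letter :: "nat \<Rightarrow> nat \<Rightarrow> freegrp \<Rightarrow> bool" where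
  "other_letter n i p \<longleftrightarrow> p = 0 \<or> (\<exists>l. p = letter l \<and> fst l < n \<and> fst l \<noteq> i)"

lemma other_letterD:
  assumes "other_letter n i p"
  shows "p \<in> F n" "len p \<le> 1" "nielsen_move i a b p = p" "other_letter n i (- p)"
proof -
  show "p \<in> F n" "len p \<le> 1" using assms by (auto simp: other_letter_def)
  show "nielsen_move i a b p = p"
  proof (cases "p = 0")
    case True
    then show ?thesis using hom_on_zero[OF hom_on_nielsen_move] by simp
  next
    case False
    then obtain l where l: "p = letter l" "fst l < n" "fst l \<noteq> i"
      using assms by (auto simp: other_letter_def)
    then show ?thesis
      using hom_on_letter[OF hom_on_nielsen_move, of l n i a b]
      by (cases l; cases "snd l") (auto simp: letter_value_def letter_False)
  qed
  show "other_letter n i (- p)"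
    using assms unfolding other_letter_def
    by (metis fst_conv inv_letter_simps(1) letter_inv_letter neg_equal_0_iff_equal)
qed

lemma aut_on_nielsen_move:
  assumes i: "i < n" and p: "other_letter n i p" and q: "other_letter n i q"
  shows "aut_on n (nielsen_move i p q)"
proof (rule aut_on_byWitness[where g = "nielsen_move i (- p) (- q)"])
  have closed: "nielsen_move i p q x \<in> F n"
    if "x \<in> F n" "other_letter n i p" "other_letter n i q" for x p q
    unfolding nielsen_move_def
    using that i other_letterD(1) by (intro extend_closed) auto
  have inv: "nielsen_move i p q (nielsen_move i (- p) (- q) x) = x"
    if x: "x \<in> F n" and p: "other_letter n i p" and q: "other_letter n i q" for x p q
  proof (rule hom_on_eqI[OF _ _ _ x, where g = "\<lambda>x. x"])
    show "hom_on n (\<lambda>x. nielsen_move i p q (nielsen_move i (- p) (- q) x))"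
    proof (rule hom_on_comp[where n = n and f = "nielsen_move i p q" and
          g = "nielsen_move i (- p) (- q)"])
      show "nielsen_move i (- p) (- q) ` F n \<subseteq> F n"
        using closed[OF _ other_letterD(4)[OF p] other_letterD(4)[OF q]] by blast
    qed (rule hom_on_nielsen_move)+
    show "hom_on n (\<lambda>x. x)" by (simp add: hom_on_def)
    fix m assume "m < n"
    show "nielsen_move i p q (nielsen_move i (- p) (- q) (gen m)) = gen m"
    proof (cases "m = i")
      case True
      have "nielsen_move i p q (- p + gen i + - q) =
          nielsen_move i p q (- p) + nielsen_move i p q (gen i) + nielsen_move i p q (- q)"
        unfolding nielsen_move_def by (simp only: extend_add)
      also have "nielsen_move i p q (- p) = - p"
        by (rule other_letterD(3)[OF other_letterD(4)[OF p]])
      also have "nielsen_move i p q (- q) = - q"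
        by (rule other_letterD(3)[OF other_letterD(4)[OF q]])
      also have "nielsen_move i p q (gen i) = p + gen i + q" by simp
      also have "- p + (p + gen i + q) + - q = gen i"
        by (metis add.assoc add.right_inverse add.right_neutral minus_add_cancel)
      finally show ?thesis using True by simp
    qed simp
  qed
  fix x assume x: "x \<in> F n"
  show "nielsen_move i p q x \<in> F n" using closed x p q by blast
  show "nielsen_move i (- p) (- q) x \<in> F n" using closed x p q other_letterD(4) by blast
  show "nielsen_move i p q (nielsen_move i (- p) (- q) x) = x" using inv x p q by blast
  show "nielsen_move i (- p) (- q) (nielsen_move i p q x) = x"
    using inv[OF x other_letterD(4)[OF p] other_letterD(4)[OF q]] by simp
qed (rule hom_on_nielsen_move)

definition nielsen_rank :: "nat \<Rightarrow> (freegrp \<Rightarrow> freegrp) \<Rightarrow> nat \<times> nat" where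
  "nielsen_rank n \<phi> = (\<Sum>i<n. len (\<phi> (gen i)), \<Sum>i<n. half_weight n (\<phi> (gen i)))"

text \<open>Either the basis is fully reduced and \<open>\<phi>\<close> does not shorten words, or some
Nielsen move lowers \<open>nielsen_rank\<close>, which takes values in a well-founded order.\<close>

lemma nielsen_reduction:
  assumes \<phi>: "aut_on n \<phi>"
  obtains "\<And>x. x \<in> F n \<Longrightarrow> len x \<le> len (\<phi> x)"
  | \<nu> where "aut_on n \<nu>" "\<And>i. i < n \<Longrightarrow> len (\<nu> (gen i)) \<le> 3"
    "(nielsen_rank n (\<lambda>x. \<phi> (\<nu> x)), nielsen_rank n \<phi>) \<in> less_than <*lex*> less_than"
proof (cases "\<forall>l m. fst l < n \<longrightarrow> fst m < n \<longrightarrow> fst l \<noteq> fst m \<longrightarrow>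
    \<not> simpler n (\<phi> (letter l) + \<phi> (letter m)) (\<phi> (letter l))")
  case True
  then show thesis using length_le_of_no_simplification[OF \<phi>] that(1) by blast
next
  case False
  note hom = aut_on_hom[OF \<phi>]
  obtain l m where lm: "fst l < n" "fst m < n" "fst l \<noteq> fst m"
    "simpler n (\<phi> (letter l) + \<phi> (letter m)) (\<phi> (letter l))"
    using False by blast
  define i where "i = fst l"
  have m: "other_letter n i (letter m)" "other_letter n i 0"
    unfolding other_letter_def i_def using lm by metis+
  have m': "other_letter n i (- letter m)" using other_letterD(4)[OF m(1)] .
  obtain p q where pq: "other_letter n i p" "other_letter n i q"
    "simpler n (\<phi> (p + gen i + q)) (\<phi> (gen i))"
  proof (cases "snd l")
    case True
    then have "letter l = gen i" by (cases l) (simp add: i_def)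
    then show ?thesis
      using that[of 0 "letter m"] m lm by (simp add: hom_on_add[OF hom] i_def)
  next
    case False
    then have l: "letter l = - gen i" by (cases l) (simp add: i_def letter_False)
    have "\<phi> (- letter m + gen i + 0) = - (\<phi> (letter l) + \<phi> (letter m))"
      using lm by (simp add: l i_def hom_on_add[OF hom] hom_on_uminus[OF hom] minus_add)
    then show ?thesis
      using that[of "- letter m" 0] m m' lm by (simp add: l i_def hom_on_uminus[OF hom])
  qed
  let ?\<nu> = "nielsen_move i p q"
  have i: "i < n" using lm by (simp add: i_def)
  have sum: "(\<Sum>j<n. g (\<phi> (?\<nu> (gen j)))) + g (\<phi> (gen i)) =
      (\<Sum>j<n. g (\<phi> (gen j))) + g (\<phi> (p + gen i + q))" for g :: "freegrp \<Rightarrow> nat"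
  proof -
    have "(\<Sum>j\<in>{..<n} - {i}. g (\<phi> (?\<nu> (gen j)))) = (\<Sum>j\<in>{..<n} - {i}. g (\<phi> (gen j)))"
      by (rule sum.cong) auto
    then show ?thesis
      using i sum.remove[of "{..<n}" i "\<lambda>j. g (\<phi> (?\<nu> (gen j)))"]
        sum.remove[of "{..<n}" i "\<lambda>j. g (\<phi> (gen j))"] by simp
  qed
  have "len (?\<nu> (gen j)) \<le> 3" for j
    using other_letterD(2)[OF pq(1)] other_letterD(2)[OF pq(2)] len_add_le[of "p + gen i" q]
      len_add_le[of p "gen i"] by simp
  moreover have "(nielsen_rank n (\<lambda>x. \<phi> (?\<nu> x)), nielsen_rank n \<phi>) \<in> less_than <*lex*> less_than"
    using pq(3) sum[of len] sum[of "half_weight n"]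
    by (auto simp: nielsen_rank_def simpler_def)
  ultimately show thesis
    using that(2)[of ?\<nu>] aut_on_nielsen_move[OF i pq(1,2)] by blast
qed

section \<open>Retracting automorphisms onto a free factor\<close>

lemma inverse_on_eqI: "aut_on n f \<Longrightarrow> y \<in> F n \<Longrightarrow> f y = x \<Longrightarrow> inverse_on n f x = y"
  using inverse_on(2) by blast

lemma aut_on_cong:
  assumes "\<And>x. x \<in> F n \<Longrightarrow> f x = g x" "aut_on n f"
  shows "aut_on n g"
  using assms bij_betw_cong[of "F n" f g "F n"] by (simp add: aut_on_def hom_on_def)

definition factor_preimage :: "nat \<Rightarrow> (freegrp \<Rightarrow> freegrp) \<Rightarrow> freegrp set" where
  "factor_preimage a \<Phi> = inverse_on (Suc a) \<Phi> ` F a"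

text \<open>The gate of the preimages of the factor and of the complementary generator is the base
vertex. For \<open>a = 0\<close> the factor is trivial and has no gate.\<close>

definition normalized :: "nat \<Rightarrow> (freegrp \<Rightarrow> freegrp) \<Rightarrow> bool" where
  "normalized a \<Phi> \<longleftrightarrow>
    (a \<ge> 1 \<longrightarrow> gate 1 (factor_preimage a \<Phi>) (inverse_on (Suc a) \<Phi> (gen a)) 0)"

definition extension :: "nat \<Rightarrow> (freegrp \<Rightarrow> freegrp) \<Rightarrow> freegrp \<Rightarrow> freegrp" where
  "extension a \<phi> = extend (\<lambda>i. if i < a then \<phi> (gen i) else gen i)"

definition retract :: "nat \<Rightarrow> (freegrp \<Rightarrow> freegrp) \<Rightarrow> freegrp \<Rightarrow> freegrp" where
  "retract a \<Phi> x = \<Phi> (marking (Suc a) a (factor_preimage a \<Phi>) x)"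

lemma F_Suc: "F a \<subseteq> F (Suc a)"
  by (rule F_mono) simp

lemma F_SucI [intro]: "x \<in> F a \<Longrightarrow> x \<in> F (Suc a)"
  using F_Suc by blast

lemma free_subgroup_factor: "free_subgroup (Suc a) (F a)"
  using F_Suc by unfold_locales auto

lemma marked_subgroup_factor_preimage:
  assumes \<Phi>: "aut_on (Suc a) \<Phi>"
  shows "marked_subgroup (Suc a) (factor_preimage a \<Phi>) a"
proof -
  let ?\<theta> = "inverse_on (Suc a) \<Phi>"
  note \<theta> = aut_on_inverse[OF \<Phi>]
  interpret free_subgroup "Suc a" "factor_preimage a \<Phi>"
    unfolding factor_preimage_def by (rule free_subgroup_image[OF free_subgroup_factor \<theta>])
  show ?thesis
  proof
    have "hom_on a ?\<theta>" using hom_on_mono[OF aut_on_hom[OF \<theta>]] by simp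
    moreover have "inj_on ?\<theta> (F a)"
      using aut_on_bij[OF \<theta>] F_Suc by (meson bij_betw_imp_inj_on inj_on_subset)
    ultimately show "\<exists>\<theta>. hom_on a \<theta> \<and> inj_on \<theta> (F a) \<and> \<theta> ` F a = factor_preimage a \<Phi>"
      by (auto simp: factor_preimage_def)
  qed
qed

lemma retract_aut:
  assumes \<Phi>: "aut_on (Suc a) \<Phi>"
  shows "aut_on a (retract a \<Phi>)"
    and "y \<in> F a \<Longrightarrow> inverse_on a (retract a \<Phi>) y =
      comarking (Suc a) a (factor_preimage a \<Phi>) (inverse_on (Suc a) \<Phi> y)"
proof -
  let ?H = "factor_preimage a \<Phi>"
  interpret H: marked_subgroup "Suc a" ?H a
    by (rule marked_subgroup_factor_preimage[OF \<Phi>])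
  let ?g = "\<lambda>y. comarking (Suc a) a ?H (inverse_on (Suc a) \<Phi> y)"
  have mark: "marking (Suc a) a ?H x \<in> ?H" "marking (Suc a) a ?H x \<in> F (Suc a)" if "x \<in> F a" for x
    using H.marking_in[OF that] H.H_F by auto
  have \<Phi>_H: "\<Phi> h \<in> F a" "inverse_on (Suc a) \<Phi> (\<Phi> h) = h" if h: "h \<in> ?H" for h
  proof -
    obtain x where "x \<in> F a" "h = inverse_on (Suc a) \<Phi> x"
      using h by (auto simp: factor_preimage_def)
    then show "\<Phi> h \<in> F a" using inverse_on(1)[OF \<Phi> F_SucI] by simp
    show "inverse_on (Suc a) \<Phi> (\<Phi> h) = h" using inverse_on(2)[OF \<Phi>] that H.H_F by blast
  qed
  have inv: "inverse_on (Suc a) \<Phi> y \<in> ?H" "\<Phi> (inverse_on (Suc a) \<Phi> y) = y" if "y \<in> F a" for y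
    using that inverse_on(1)[OF \<Phi> F_SucI[OF that]] by (simp_all add: factor_preimage_def)
  have hom: "hom_on a (retract a \<Phi>)"
    unfolding hom_on_def retract_def
    using mark by (simp add: H.marking_add hom_on_add[OF aut_on_hom[OF \<Phi>]])
  have rg: "retract a \<Phi> (?g y) = y" if "y \<in> F a" for y
    using inv[OF that] by (simp add: retract_def H.marking_comarking)
  have gr: "?g (retract a \<Phi> x) = x" if "x \<in> F a" for x
    using mark[OF that] that by (simp add: retract_def \<Phi>_H H.comarking_marking)
  have g_in: "?g y \<in> F a" if "y \<in> F a" for y
    using H.comarking_in inv(1)[OF that] by blast
  have r_in: "retract a \<Phi> x \<in> F a" if "x \<in> F a" for x
    using \<Phi>_H(1) mark(1)[OF that] by (simp add: retract_def)
  show aut: "aut_on a (retract a \<Phi>)"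
    by (rule aut_on_byWitness[where g = ?g]) (use hom rg gr g_in r_in in auto)
  show "inverse_on a (retract a \<Phi>) y = ?g y" if "y \<in> F a"
    by (rule inverse_on_eqI[OF aut g_in[OF that] rg[OF that]])
qed

text \<open>The hypothesis on \<open>\<Psi>\<close> says that \<open>\<Psi>\<close> represents the outer
class of \<open>\<Phi>\<close> times that of \<open>S\<close>. Normalization leaves only finitely many
\<open>g\<close>, and \<open>marking_change_bounded\<close> applies to \<open>S\<close> composed with
the conjugation by each of them.\<close>

lemma retract_change_bounded:
  assumes S: "aut_on (Suc a) S" and a: "a \<ge> 1"
  obtains D where "\<And>\<Phi> \<Psi> g i. aut_on (Suc a) \<Phi> \<Longrightarrow> aut_on (Suc a) \<Psi> \<Longrightarrow>
    normalized a \<Phi> \<Longrightarrow> normalized a \<Psi> \<Longrightarrow> g \<in> F (Suc a) \<Longrightarrow>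
    (\<And>x. x \<in> F (Suc a) \<Longrightarrow> \<Psi> x = \<Phi> (S (g + x - g))) \<Longrightarrow> i < a \<Longrightarrow>
    len (inverse_on a (retract a \<Phi>) (retract a \<Psi> (gen i))) \<le> D"
proof -
  let ?n = "Suc a"
  note S' = aut_on_inverse[OF S]
  obtain B where B: "\<And>H t g. H \<subseteq> F ?n \<Longrightarrow> t \<in> F ?n \<Longrightarrow> t \<noteq> 0 \<Longrightarrow> g \<in> F ?n \<Longrightarrow> gate 1 H t 0 \<Longrightarrow>
      gate 1 ((\<lambda>x. g + inverse_on ?n S x - g) ` H) (g + inverse_on ?n S t - g) 0 \<Longrightarrow> len g \<le> B"
    using normalized_conjugator_bounded[OF S'] by blast
  define T where "T g x = S (g + x - g)" for g x
  have T: "aut_on ?n (T g)" if "g \<in> F ?n" for g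
    unfolding T_def using aut_on_comp[OF S aut_on_conj[OF that]] .
  have "\<exists>D. \<forall>H i. marked_subgroup ?n H a \<longrightarrow> i < a \<longrightarrow>
      len (comarking ?n a (T g ` H) (T g (marking ?n a H (gen i)))) \<le> D" if "g \<in> F ?n" for g
    using marking_change_bounded[OF T[OF that], of a] by metis
  then obtain D where D: "\<And>g H i. g \<in> F ?n \<Longrightarrow> marked_subgroup ?n H a \<Longrightarrow> i < a \<Longrightarrow>
      len (comarking ?n a (T g ` H) (T g (marking ?n a H (gen i)))) \<le> D g"
    by metis
  define W where "W = {g \<in> F ?n. len g \<le> B}"
  have W: "finite W" unfolding W_def by (rule finite_ball)
  show thesis
  proof (rule that)
    fix \<Phi> \<Psi> g i
    assume \<Phi>: "aut_on ?n \<Phi>" and \<Psi>: "aut_on ?n \<Psi>" and n\<Phi>: "normalized a \<Phi>" and n\<Psi>: "normalized a \<Psi>"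
      and g: "g \<in> F ?n" and eq: "\<And>x. x \<in> F ?n \<Longrightarrow> \<Psi> x = \<Phi> (S (g + x - g))" and i: "i < a"
    let ?H = "factor_preimage a \<Phi>" and ?K = "factor_preimage a \<Psi>"
    interpret H: marked_subgroup ?n ?H a by (rule marked_subgroup_factor_preimage[OF \<Phi>])
    interpret K: marked_subgroup ?n ?K a by (rule marked_subgroup_factor_preimage[OF \<Psi>])
    have eqT: "\<Psi> x = \<Phi> (T g x)" if "x \<in> F ?n" for x using eq[OF that] by (simp add: T_def)
    have inv_T: "inverse_on ?n \<Phi> (\<Psi> x) = T g x" if "x \<in> F ?n" for x
      using eqT[OF that] aut_on_closed[OF T[OF g] that] by (simp add: inverse_on(2)[OF \<Phi>])
    have inv_\<Psi>: "inverse_on ?n \<Psi> y = - g + inverse_on ?n S (inverse_on ?n \<Phi> y) - - g"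
      if "y \<in> F ?n" for y
    proof (rule inverse_on_eqI[OF \<Psi>])
      let ?z = "inverse_on ?n S (inverse_on ?n \<Phi> y)"
      have z: "?z \<in> F ?n" using that by (simp add: inverse_on(3)[OF S] inverse_on(3)[OF \<Phi>])
      show "- g + ?z - - g \<in> F ?n" using z g by simp
      have "g + (- g + ?z - - g) - g = ?z"
        by (simp add: add.assoc diff_conv_add_uminus del: add_uminus_conv_diff)
      then have "T g (- g + ?z - - g) = inverse_on ?n \<Phi> y"
        using that by (simp only: T_def inverse_on(1)[OF S] inverse_on(3)[OF \<Phi>])
      then show "\<Psi> (- g + ?z - - g) = y"
        using z g that eqT[of "- g + ?z - - g"] inverse_on(1)[OF \<Phi>] by simp
    qed
    have K: "?K = (\<lambda>x. - g + inverse_on ?n S x - - g) ` ?H"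
      using inv_\<Psi> F_Suc unfolding factor_preimage_def image_image by (intro image_cong) auto
    let ?t = "inverse_on ?n \<Phi> (gen a)"
    have t: "?t \<in> F ?n" "?t \<noteq> 0"
      using inverse_on(3)[OF \<Phi>, of "gen a"] aut_on_eq_0[OF aut_on_inverse[OF \<Phi>], of "gen a"]
      by (simp_all add: letters_eq_Nil[symmetric] del: letters_eq_Nil)
    have "len (- g) \<le> B"
    proof (rule B[of ?H ?t])
      show "gate 1 ?H ?t 0" using n\<Phi> a by (simp add: normalized_def)
      show "gate 1 ((\<lambda>x. - g + inverse_on ?n S x - - g) ` ?H) (- g + inverse_on ?n S ?t - - g) 0"
        using n\<Psi> a inv_\<Psi>[of "gen a"] unfolding normalized_def K by simp
    qed (use H.H_F t g in auto)
    then have "g \<in> W" using g by (simp add: W_def)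
    have TK: "T g ` ?K = ?H"
    proof -
      have "\<Phi> (T g (inverse_on ?n \<Psi> y)) = y" if "y \<in> F ?n" for y
        using eqT[of "inverse_on ?n \<Psi> y"] inverse_on[OF \<Psi> that] by simp
      then have "T g (inverse_on ?n \<Psi> y) = inverse_on ?n \<Phi> y" if "y \<in> F ?n" for y
        using inverse_on_eqI[OF \<Phi>, of "T g (inverse_on ?n \<Psi> y)" y]
          aut_on_closed[OF T[OF g] inverse_on(3)[OF \<Psi> that]] that by simp
      then show ?thesis
        using F_Suc unfolding factor_preimage_def image_image by (intro image_cong) auto
    qed
    have gen: "gen i \<in> F a" using i by simp
    have mark: "marking ?n a ?K (gen i) \<in> F ?n" using K.marking_in[OF gen] K.H_F by auto
    have "inverse_on a (retract a \<Phi>) (retract a \<Psi> (gen i)) =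
        comarking ?n a ?H (inverse_on ?n \<Phi> (retract a \<Psi> (gen i)))"
      by (rule retract_aut(2)[OF \<Phi> aut_on_closed[OF retract_aut(1)[OF \<Psi>] gen]])
    also have "\<dots> = comarking ?n a ?H (T g (marking ?n a ?K (gen i)))"
      using inv_T[OF mark] by (simp add: retract_def)
    finally have "len (inverse_on a (retract a \<Phi>) (retract a \<Psi> (gen i))) \<le> D g"
      using D[OF g K.marked_subgroup_axioms i] by (simp add: TK)
    also have "\<dots> \<le> (\<Sum>g\<in>W. D g)"
      using \<open>g \<in> W\<close> W by (intro member_le_sum) auto
    finally show "len (inverse_on a (retract a \<Phi>) (retract a \<Psi> (gen i))) \<le> (\<Sum>g\<in>W. D g)" .
  qed
qed

lemma extension_eq:
  assumes "hom_on a \<phi>" "x \<in> F a"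
  shows "extension a \<phi> x = \<phi> x"
proof (rule hom_on_eqI[OF _ assms(1) _ assms(2)])
  show "hom_on a (extension a \<phi>)" unfolding extension_def by (rule hom_on_extend)
  show "extension a \<phi> (gen i) = \<phi> (gen i)" if "i < a" for i
    using that by (simp add: extension_def)
qed

lemma extension_gen [simp]: "extension a \<phi> (gen a) = gen a"
  by (simp add: extension_def)

lemma hom_on_extension: "hom_on n (extension a \<phi>)"
  unfolding extension_def by (rule hom_on_extend)

lemma extension_closed:
  assumes "aut_on a \<phi>" "x \<in> F (Suc a)"
  shows "extension a \<phi> x \<in> F (Suc a)"
  unfolding extension_def
proof (rule extend_closed[OF assms(2)])
  show "(if i < a then \<phi> (gen i) else gen i) \<in> F (Suc a)" if "i < Suc a" for i
    using that aut_on_closed[OF assms(1), of "gen i"] F_Suc by auto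
qed auto

lemma extension_comp:
  assumes \<phi>: "aut_on a \<phi>" and \<psi>: "aut_on a \<psi>" and x: "x \<in> F (Suc a)"
  shows "extension a \<phi> (extension a \<psi> x) = extension a (\<lambda>x. \<phi> (\<psi> x)) x"
proof (rule hom_on_eqI[OF _ hom_on_extension _ x])
  show "hom_on (Suc a) (\<lambda>x. extension a \<phi> (extension a \<psi> x))"
  proof (rule hom_on_comp[where n = "Suc a" and f = "extension a \<phi>" and g = "extension a \<psi>"])
    show "extension a \<psi> ` F (Suc a) \<subseteq> F (Suc a)"
      using extension_closed[OF \<psi>] by blast
  qed (rule hom_on_extension)+
  fix i assume i: "i < Suc a"
  show "extension a \<phi> (extension a \<psi> (gen i)) = extension a (\<lambda>x. \<phi> (\<psi> x)) (gen i)"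
  proof (cases "i < a")
    case True
    then have "gen i \<in> F a" by simp
    then show ?thesis
      using extension_eq[OF aut_on_hom[OF \<psi>]] extension_eq[OF aut_on_hom[OF \<phi>]]
        extension_eq[OF aut_on_hom[OF aut_on_comp[OF \<phi> \<psi>]]] aut_on_closed[OF \<psi>] by simp
  next
    case False
    then have "i = a" using i by simp
    then show ?thesis by simp
  qed
qed

lemma extension_id:
  assumes "\<And>x. x \<in> F a \<Longrightarrow> \<phi> x = x" "x \<in> F (Suc a)"
  shows "extension a \<phi> x = x"
  by (rule hom_on_eqI[OF hom_on_extension _ _ assms(2), of "\<lambda>x. x"])
    (auto simp: hom_on_def extension_def assms(1))

lemma extension_inverse:
  assumes \<phi>: "aut_on a \<phi>" and x: "x \<in> F (Suc a)"
  shows "extension a \<phi> (extension a (inverse_on a \<phi>) x) = x"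
    and "extension a (inverse_on a \<phi>) (extension a \<phi> x) = x"
  using extension_comp[OF \<phi> aut_on_inverse[OF \<phi>] x] extension_comp[OF aut_on_inverse[OF \<phi>] \<phi> x]
    extension_id[of a "\<lambda>x. \<phi> (inverse_on a \<phi> x)" x] extension_id[of a "\<lambda>x. inverse_on a \<phi> (\<phi> x)" x]
    inverse_on[OF \<phi>] x by simp_all

lemma aut_on_extension:
  assumes \<phi>: "aut_on a \<phi>"
  shows "aut_on (Suc a) (extension a \<phi>)"
  using extension_inverse[OF \<phi>] extension_closed[OF \<phi>] extension_closed[OF aut_on_inverse[OF \<phi>]]
  by (intro aut_on_byWitness[where g = "extension a (inverse_on a \<phi>)"] hom_on_extension) auto

lemma inverse_on_extension:
  assumes \<phi>: "aut_on a \<phi>" and x: "x \<in> F (Suc a)"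
  shows "inverse_on (Suc a) (extension a \<phi>) x = extension a (inverse_on a \<phi>) x"
  using extension_inverse(1)[OF assms] extension_closed[OF aut_on_inverse[OF \<phi>] x]
  by (intro inverse_on_eqI[OF aut_on_extension[OF \<phi>]])

lemma factor_preimage_extension:
  assumes \<phi>: "aut_on a \<phi>"
  shows "factor_preimage a (extension a \<phi>) = F a"
proof -
  have "inverse_on (Suc a) (extension a \<phi>) x = inverse_on a \<phi> x" if "x \<in> F a" for x
    using inverse_on_extension[OF \<phi>, of x] extension_eq[OF aut_on_hom[OF aut_on_inverse[OF \<phi>]] that]
      that F_Suc by auto
  then have "factor_preimage a (extension a \<phi>) = inverse_on a \<phi> ` F a"
    unfolding factor_preimage_def by (intro image_cong) auto
  then show ?thesis using aut_on_image[OF aut_on_inverse[OF \<phi>]] by simp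
qed

lemma normalized_extension:
  assumes \<phi>: "aut_on a \<phi>"
  shows "normalized a (extension a \<phi>)"
proof -
  have "inverse_on (Suc a) (extension a \<phi>) (gen a) = gen a"
    using inverse_on_extension[OF \<phi>, of "gen a"] by simp
  then show ?thesis
    using gate_mono[OF gate_standard, of a 1]
    by (simp add: normalized_def factor_preimage_extension[OF \<phi>])
qed

lemma normalized_exists:
  assumes \<Phi>: "aut_on (Suc a) \<Phi>"
  obtains g where "g \<in> F (Suc a)" "normalized a (\<lambda>x. \<Phi> (g + x - g))"
proof (cases "a \<ge> 1")
  case False
  then show thesis using that[of 0] by (simp add: normalized_def)
next
  case True
  let ?n = "Suc a"
  obtain g where g: "g \<in> F ?n" and gate: "gate 1 ((\<lambda>x. g + inverse_on ?n \<Phi> x - g) ` F a)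
      (g + inverse_on ?n \<Phi> (gen a) - g) 0"
    using normalizing_conjugate[OF aut_on_inverse[OF \<Phi>] True] by metis
  have g': "- g \<in> F ?n" using g by simp
  have aut: "aut_on ?n (\<lambda>x. \<Phi> (- g + x - - g))"
    using aut_on_comp[OF \<Phi> aut_on_conj[OF g']] .
  have inv: "inverse_on ?n (\<lambda>x. \<Phi> (- g + x - - g)) y = g + inverse_on ?n \<Phi> y - g"
    if "y \<in> F ?n" for y
  proof (rule inverse_on_eqI[OF aut])
    have "- g + (g + inverse_on ?n \<Phi> y - g) - - g = inverse_on ?n \<Phi> y"
      by (simp add: add.assoc diff_conv_add_uminus del: add_uminus_conv_diff)
    then show "\<Phi> (- g + (g + inverse_on ?n \<Phi> y - g) - - g) = y"
      using inverse_on(1)[OF \<Phi> that] by simp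
    show "g + inverse_on ?n \<Phi> y - g \<in> F ?n" using g inverse_on(3)[OF \<Phi> that] by simp
  qed
  have "factor_preimage a (\<lambda>x. \<Phi> (- g + x - - g)) = (\<lambda>x. g + inverse_on ?n \<Phi> x - g) ` F a"
    unfolding factor_preimage_def using inv F_Suc by (intro image_cong) auto
  then have "normalized a (\<lambda>x. \<Phi> (- g + x - - g))"
    using gate inv[of "gen a"] by (simp add: normalized_def del: diff_minus_eq_add)
  then show thesis using that[OF g'] by blast
qed

text \<open>If the extension of \<open>\<phi>\<close> is conjugation by \<open>g\<close>, then both
\<open>0\<close> and \<open>g\<close> are gates of the standard pair with constant \<open>0\<close>, so
\<open>g = 0\<close> by uniqueness.\<close>

lemma inner_extension_trivial:
  assumes \<phi>: "aut_on a \<phi>" and g: "g \<in> F (Suc a)"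
    and eq: "\<And>x. x \<in> F (Suc a) \<Longrightarrow> extension a \<phi> x = g + x - g" and x: "x \<in> F a"
  shows "\<phi> x = x"
proof (cases "a \<ge> 1")
  case False
  then have "a = 0" by simp
  then have "x = 0" using x by (simp add: F_def)
  then show ?thesis using hom_on_zero[OF aut_on_hom[OF \<phi>]] by simp
next
  case True
  have std: "gate 0 (F a) (gen a) 0" by (rule gate_standard[OF True])
  have eq_F: "\<phi> y = g + y - g" if "y \<in> F a" for y
    using eq[of y] extension_eq[OF aut_on_hom[OF \<phi>] that] that F_Suc by auto
  have "(\<lambda>y. g + y - g) ` F a = \<phi> ` F a" using eq_F by (intro image_cong) auto
  then have "(\<lambda>y. g + y - g) ` F a = F a" using aut_on_image[OF \<phi>] by simp
  moreover have "g + gen a - g = gen a" using eq[of "gen a"] by simp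
  moreover have "gen a \<noteq> 0" by (simp add: letters_eq_Nil[symmetric] del: letters_eq_Nil)
  ultimately have "gate 0 (F a) (gen a) g"
    using gate_conj[OF _ std, of g] by simp
  then have "dist_len g 0 = 0" using gate_unique[OF _ std, of g] by simp
  then have "g = 0" by simp
  then show ?thesis using eq_F[OF x] by simp
qed

lemma retract_extension:
  assumes \<phi>: "aut_on a \<phi>" and x: "x \<in> F a"
  shows "retract a (extension a \<phi>) (comarking (Suc a) a (F a) x) = \<phi> x"
proof -
  interpret marked_subgroup "Suc a" "F a" a
    using marked_subgroup_factor_preimage[OF aut_on_extension[OF \<phi>]]
    by (simp add: factor_preimage_extension[OF \<phi>])
  show ?thesis
    using x marking_comarking[OF x] extension_eq[OF aut_on_hom[OF \<phi>] x]
    by (simp add: retract_def factor_preimage_extension[OF \<phi>])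
qed

lemma aut_on_comarking_factor: "aut_on a (comarking (Suc a) a (F a))"
proof -
  have id: "aut_on a (\<lambda>x. x)" by (simp add: aut_on_def hom_on_def bij_betw_def)
  have ext: "aut_on (Suc a) (extension a (\<lambda>x. x))" by (rule aut_on_extension[OF id])
  have "inverse_on a (retract a (extension a (\<lambda>x. x))) y = comarking (Suc a) a (F a) y"
    if y: "y \<in> F a" for y
  proof -
    have "inverse_on (Suc a) (extension a (\<lambda>x. x)) y = y"
      using extension_eq[OF aut_on_hom[OF id] y] by (rule inverse_on_eqI[OF ext F_SucI[OF y]])
    then show ?thesis
      using retract_aut(2)[OF ext y] by (simp add: factor_preimage_extension[OF id])
  qed
  then show ?thesis
    by (rule aut_on_cong[OF _ aut_on_inverse[OF retract_aut(1)[OF ext]]])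
qed

section \<open>Word metrics\<close>

lemma (in group) foldr_mult:
  "set w \<subseteq> carrier G \<Longrightarrow> x \<in> carrier G \<Longrightarrow> foldr (\<otimes>) w x = foldr (\<otimes>) w \<one> \<otimes> x"
  "set w \<subseteq> carrier G \<Longrightarrow> foldr (\<otimes>) w \<one> \<in> carrier G"
proof -
  have closed: "foldr (\<otimes>) w \<one> \<in> carrier G" if "set w \<subseteq> carrier G" for w
    using that by (induction w) auto
  then show "set w \<subseteq> carrier G \<Longrightarrow> foldr (\<otimes>) w \<one> \<in> carrier G" .
  show "set w \<subseteq> carrier G \<Longrightarrow> x \<in> carrier G \<Longrightarrow> foldr (\<otimes>) w x = foldr (\<otimes>) w \<one> \<otimes> x"
    by (induction w) (auto simp: m_assoc closed)
qed

context group
begin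

context
  fixes S assumes S: "finite_generating_set G S"
begin

lemma generators_carrier: "S \<union> m_inv G ` S \<subseteq> carrier G"
  using S by (auto simp: finite_generating_set_def)

lemma word_length_attained:
  assumes "g \<in> carrier G"
  obtains w where "length w = word_length G S g" "set w \<subseteq> S \<union> m_inv G ` S" "foldr (\<otimes>) w \<one> = g"
proof -
  have "\<exists>w. set w \<subseteq> S \<union> m_inv G ` S \<and> foldr (\<otimes>) w \<one> = g" if "g \<in> generate G S" for g
    using that
  proof induction
    case one
    then show ?case by (intro exI[of _ "[]"]) simp
  next
    case (incl h)
    then show ?case using generators_carrier by (intro exI[of _ "[h]"]) auto
  next
    case (inv h)
    then show ?case using generators_carrier by (intro exI[of _ "[m_inv G h]"]) auto
  next
    case (eng h1 h2)
    then obtain w1 w2 where w: "set w1 \<subseteq> S \<union> m_inv G ` S" "foldr (\<otimes>) w1 \<one> = h1"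
      "set w2 \<subseteq> S \<union> m_inv G ` S" "foldr (\<otimes>) w2 \<one> = h2" by auto
    have "foldr (\<otimes>) (w1 @ w2) \<one> = h1 \<otimes> h2"
      using w foldr_mult(1)[of w1 h2] foldr_mult(2)[of w2] generators_carrier by auto
    then show ?case using w by (intro exI[of _ "w1 @ w2"]) auto
  qed
  then have "\<exists>n w. length w = n \<and> set w \<subseteq> S \<union> m_inv G ` S \<and> foldr (\<otimes>) w \<one> = g"
    using assms S by (auto simp: finite_generating_set_def)
  from LeastI_ex[OF this] show thesis using that by (auto simp: word_length_def)
qed

lemma word_length_le:
  "set w \<subseteq> S \<union> m_inv G ` S \<Longrightarrow> foldr (\<otimes>) w \<one> = g \<Longrightarrow> word_length G S g \<le> length w"
  unfolding word_length_def by (rule Least_le) auto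

lemma word_length_one: "word_length G S \<one> = 0"
  using word_length_le[of "[]" \<one>] by simp

lemma word_length_mult:
  assumes "x \<in> carrier G" "y \<in> carrier G"
  shows "word_length G S (x \<otimes> y) \<le> word_length G S x + word_length G S y"
proof -
  obtain v where v: "length v = word_length G S x" "set v \<subseteq> S \<union> m_inv G ` S" "foldr (\<otimes>) v \<one> = x"
    using word_length_attained[OF assms(1)] by blast
  obtain w where w: "length w = word_length G S y" "set w \<subseteq> S \<union> m_inv G ` S" "foldr (\<otimes>) w \<one> = y"
    using word_length_attained[OF assms(2)] by blast
  have "foldr (\<otimes>) (v @ w) \<one> = x \<otimes> y"
    using v w foldr_mult(1)[of v y] generators_carrier assms by auto
  then show ?thesis using word_length_le[of "v @ w" "x \<otimes> y"] v w by simp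
qed

end

end

text \<open>The finitely many differences for the finitely many generators have bounded length, and the
difference for a word of generators is a product of such differences.\<close>

lemma lipschitz_of_finite_differences:
  assumes "group G" "group K"
    and S: "finite_generating_set G S" and T: "finite_generating_set K T"
    and f: "f \<in> carrier G \<rightarrow> carrier K"
    and fin: "\<And>s. s \<in> carrier G \<Longrightarrow>
      finite ((\<lambda>a. inv\<^bsub>K\<^esub> f a \<otimes>\<^bsub>K\<^esub> f (a \<otimes>\<^bsub>G\<^esub> s)) ` carrier G)"
  shows "\<exists>C\<ge>1. \<forall>a\<in>carrier G. \<forall>b\<in>carrier G.
    word_dist K T (f a) (f b) \<le> C * word_dist G S a b"
proof -
  interpret G: group G by fact
  interpret K: group K by fact
  define P where "P = S \<union> m_inv G ` S"
  have P: "finite P" "P \<subseteq> carrier G"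
    using S G.generators_carrier[OF S] by (auto simp: P_def finite_generating_set_def)
  define \<delta> where "\<delta> a s = inv\<^bsub>K\<^esub> f a \<otimes>\<^bsub>K\<^esub> f (a \<otimes>\<^bsub>G\<^esub> s)" for a s
  have fK: "f a \<in> carrier K" if "a \<in> carrier G" for a using f that by auto
  have \<delta>: "\<delta> a s \<in> carrier K" if "a \<in> carrier G" "s \<in> carrier G" for a s
    using fK that by (simp add: \<delta>_def)
  have "finite (\<Union>s\<in>P. (\<lambda>a. word_length K T (\<delta> a s)) ` carrier G)"
  proof (rule finite_UN_I[OF P(1)])
    fix s assume "s \<in> P"
    then have "finite ((\<lambda>a. \<delta> a s) ` carrier G)" using fin P(2) by (auto simp: \<delta>_def)
    then have "finite (word_length K T ` (\<lambda>a. \<delta> a s) ` carrier G)" by (rule finite_imageI)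
    then show "finite ((\<lambda>a. word_length K T (\<delta> a s)) ` carrier G)" by (simp add: image_image)
  qed
  then obtain M where M: "\<And>a s. a \<in> carrier G \<Longrightarrow> s \<in> P \<Longrightarrow> word_length K T (\<delta> a s) \<le> M"
    using finite_nat_set_iff_bounded_le[THEN iffD1] by fastforce
  have bound: "word_length K T (\<delta> a (foldr (\<otimes>\<^bsub>G\<^esub>) w \<one>\<^bsub>G\<^esub>)) \<le> M * length w"
    if "set w \<subseteq> P" "a \<in> carrier G" for w a
    using that
  proof (induction w arbitrary: a)
    case Nil
    then show ?case using fK by (simp add: \<delta>_def K.word_length_one[OF T])
  next
    case (Cons s w)
    let ?x = "foldr (\<otimes>\<^bsub>G\<^esub>) w \<one>\<^bsub>G\<^esub>"
    have s: "s \<in> P" "s \<in> carrier G" using Cons.prems P(2) by auto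
    have x: "?x \<in> carrier G" using Cons.prems P(2) by (intro G.foldr_mult(2)) auto
    have "\<delta> a (s \<otimes>\<^bsub>G\<^esub> ?x) = \<delta> a s \<otimes>\<^bsub>K\<^esub> \<delta> (a \<otimes>\<^bsub>G\<^esub> s) ?x"
      using fK s x Cons.prems(2)
      by (simp add: \<delta>_def K.m_assoc G.m_assoc) (simp add: K.m_assoc[symmetric])
    then have "word_length K T (\<delta> a (s \<otimes>\<^bsub>G\<^esub> ?x)) \<le>
        word_length K T (\<delta> a s) + word_length K T (\<delta> (a \<otimes>\<^bsub>G\<^esub> s) ?x)"
      using K.word_length_mult[OF T] \<delta> s x Cons.prems(2) by simp
    also have "\<dots> \<le> M + M * length w"
      using M[OF Cons.prems(2) s(1)] Cons.IH[of "a \<otimes>\<^bsub>G\<^esub> s"] Cons.prems s by (intro add_mono) auto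
    finally show ?case by simp
  qed
  have main: "word_dist K T (f a) (f b) \<le> real (max 1 M) * word_dist G S a b"
    if ab: "a \<in> carrier G" "b \<in> carrier G" for a b
  proof -
    let ?g = "inv\<^bsub>G\<^esub> a \<otimes>\<^bsub>G\<^esub> b"
    have g: "?g \<in> carrier G" using ab by simp
    obtain w where w: "length w = word_length G S ?g" "set w \<subseteq> S \<union> m_inv G ` S"
      "foldr (\<otimes>\<^bsub>G\<^esub>) w \<one>\<^bsub>G\<^esub> = ?g"
      by (rule G.word_length_attained[OF S g])
    have "a \<otimes>\<^bsub>G\<^esub> ?g = b" using ab by (simp add: G.m_assoc[symmetric])
    then have "inv\<^bsub>K\<^esub> f a \<otimes>\<^bsub>K\<^esub> f b = \<delta> a ?g" by (simp add: \<delta>_def)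
    then have "word_length K T (inv\<^bsub>K\<^esub> f a \<otimes>\<^bsub>K\<^esub> f b) \<le> M * word_length G S ?g"
      using bound[of w a] w ab by (simp add: P_def)
    also have "\<dots> \<le> max 1 M * word_length G S ?g" by (rule mult_le_mono1) simp
    finally show ?thesis unfolding word_dist_def by (metis of_nat_le_iff of_nat_mult)
  qed
  show ?thesis
    by (rule exI[of _ "real (max 1 M)"]) (use main in auto)
qed

lemma lipschitz_retractionI:
  assumes "group G" and H: "subgroup H G"
    and fg: "finitely_generated G" "finitely_generated (G\<lparr>carrier := H\<rparr>)"
    and r: "r \<in> carrier G \<rightarrow> H" "\<And>h. h \<in> H \<Longrightarrow> r h = h"
    and fin: "\<And>s. s \<in> carrier G \<Longrightarrow>
      finite ((\<lambda>a. inv\<^bsub>G\<^esub> r a \<otimes>\<^bsub>G\<^esub> r (a \<otimes>\<^bsub>G\<^esub> s)) ` carrier G)"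
  shows "lipschitz_retraction G H r"
proof -
  interpret G: group G by fact
  let ?H = "G\<lparr>carrier := H\<rparr>"
  have gH: "group ?H" using G.subgroup_imp_group[OF H] .
  have "\<exists>C\<ge>1. \<forall>a\<in>carrier G. \<forall>b\<in>carrier G. word_dist ?H T (r a) (r b) \<le> C * word_dist G S a b"
    if "finite_generating_set G S" "finite_generating_set ?H T" for S T
  proof (rule lipschitz_of_finite_differences[OF assms(1) gH that])
    show "r \<in> carrier G \<rightarrow> carrier ?H" using r by simp
    fix s assume s: "s \<in> carrier G"
    have "(\<lambda>a. inv\<^bsub>?H\<^esub> r a \<otimes>\<^bsub>?H\<^esub> r (a \<otimes>\<^bsub>G\<^esub> s)) ` carrier G =
        (\<lambda>a. inv\<^bsub>G\<^esub> r a \<otimes>\<^bsub>G\<^esub> r (a \<otimes>\<^bsub>G\<^esub> s)) ` carrier G"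
      using funcset_mem[OF r(1)] by (intro image_cong) (simp_all add: G.m_inv_consistent[OF H])
    then show "finite ((\<lambda>a. inv\<^bsub>?H\<^esub> r a \<otimes>\<^bsub>?H\<^esub> r (a \<otimes>\<^bsub>G\<^esub> s)) ` carrier G)"
      using fin[OF s] by simp
  qed
  then show ?thesis using H fg r by (simp add: lipschitz_retraction_def)
qed

text \<open>The inclusion is Lipschitz by \<open>lipschitz_of_finite_differences\<close>, and the
retraction gives the inequality in the other direction, without additive constant.\<close>

lemma undistorted_of_retraction:
  assumes "group G" and retr: "lipschitz_retraction G H r"
  shows "undistorted G H"
proof -
  interpret G: group G by fact
  let ?H = "G\<lparr>carrier := H\<rparr>"
  have H: "subgroup H G" and r: "\<And>h. h \<in> H \<Longrightarrow> r h = h"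
    using retr by (auto simp: lipschitz_retraction_def)
  interpret H: group ?H using G.subgroup_imp_group[OF H] .
  have HG: "H \<subseteq> carrier G" by (rule subgroup.subset[OF H])
  have "quasi_isometric_embedding H (word_dist ?H T) (word_dist G S) (\<lambda>h. h)"
    if S: "finite_generating_set G S" and T: "finite_generating_set ?H T" for S T
  proof -
    obtain K where K: "K \<ge> 1" "\<And>a b. a \<in> carrier G \<Longrightarrow> b \<in> carrier G \<Longrightarrow>
        word_dist ?H T (r a) (r b) \<le> K * word_dist G S a b"
      using retr S T unfolding lipschitz_retraction_def by meson
    have "\<exists>C\<ge>1. \<forall>a\<in>carrier ?H. \<forall>b\<in>carrier ?H. word_dist G S a b \<le> C * word_dist ?H T a b"
    proof (rule lipschitz_of_finite_differences[OF H.is_group assms(1) T S])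
      show "(\<lambda>h. h) \<in> carrier ?H \<rightarrow> carrier G" using HG by auto
      fix s assume "s \<in> carrier ?H"
      then have "inv\<^bsub>G\<^esub> a \<otimes>\<^bsub>G\<^esub> (a \<otimes>\<^bsub>?H\<^esub> s) = s" if "a \<in> carrier ?H" for a
        using HG that by (auto simp: G.m_assoc[symmetric] subset_iff)
      then have "(\<lambda>a. inv\<^bsub>G\<^esub> a \<otimes>\<^bsub>G\<^esub> (a \<otimes>\<^bsub>?H\<^esub> s)) ` carrier ?H \<subseteq> {s}" by auto
      then show "finite ((\<lambda>a. inv\<^bsub>G\<^esub> a \<otimes>\<^bsub>G\<^esub> (a \<otimes>\<^bsub>?H\<^esub> s)) ` carrier ?H)"
        by (rule finite_subset) simp
    qed
    then obtain C where C: "C \<ge> 1" "\<And>a b. a \<in> H \<Longrightarrow> b \<in> H \<Longrightarrow>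
        word_dist G S a b \<le> C * word_dist ?H T a b" by auto
    define L where "L = max K C"
    have L: "L \<ge> 1" "K \<le> L" "C \<le> L" using K(1) by (simp_all add: L_def)
    have nonneg: "word_dist G S a b \<ge> 0" "word_dist ?H T a b \<ge> 0" for a b
      by (simp_all add: word_dist_def)
    have "word_dist ?H T a b / L - 0 \<le> word_dist G S a b \<and>
        word_dist G S a b \<le> L * word_dist ?H T a b + 0" if ab: "a \<in> H" "b \<in> H" for a b
    proof
      have "word_dist ?H T a b \<le> K * word_dist G S a b" using K(2)[of a b] ab HG r by auto
      also have "\<dots> \<le> L * word_dist G S a b" using L nonneg by (intro mult_right_mono) auto
      finally show "word_dist ?H T a b / L - 0 \<le> word_dist G S a b"
        using L by (simp add: field_simps)
      have "word_dist G S a b \<le> C * word_dist ?H T a b" using C(2) ab by simp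
      also have "\<dots> \<le> L * word_dist ?H T a b" using L nonneg by (intro mult_right_mono) auto
      finally show "word_dist G S a b \<le> L * word_dist ?H T a b + 0" by simp
    qed
    then show ?thesis unfolding quasi_isometric_embedding_def using L(1) by blast
  qed
  then show ?thesis using retr by (simp add: undistorted_def lipschitz_retraction_def)
qed

lemma finitely_generated_image:
  assumes "group G" "group K" and h: "h \<in> hom G K" "h ` carrier G = carrier K"
    and fg: "finitely_generated G"
  shows "finitely_generated K"
proof -
  interpret group_hom G K h using assms by (simp add: group_hom_def group_hom_axioms_def)
  obtain S where S: "finite S" "S \<subseteq> carrier G" "generate G S = carrier G"
    using fg by (auto simp: finitely_generated_def finite_generating_set_def)
  then have "generate K (h ` S) = carrier K" using generate_img[OF S(2)] h(2) by simp
  then show ?thesis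
    using S h(2) unfolding finitely_generated_def finite_generating_set_def
    by (intro exI[of _ "h ` S"]) auto
qed

section \<open>Automorphisms of free groups as maps of words\<close>

text \<open>An automorphism of the list-based group acts on the type of reduced words by
\<open>act\<close>; conversely, \<open>realize\<close> turns a map of reduced words into an extensional
map of lists.\<close>

definition act :: "(letter list \<Rightarrow> letter list) \<Rightarrow> freegrp \<Rightarrow> freegrp" where
  "act \<alpha> x = of_letters (\<alpha> (letters x))"

definition realize :: "nat \<Rightarrow> (freegrp \<Rightarrow> freegrp) \<Rightarrow> letter list \<Rightarrow> letter list" where
  "realize n \<sigma> = restrict (\<lambda>w. letters (\<sigma> (of_letters w))) (carrier (free_group n))"

lemma letters_in_carrier [simp]: "letters x \<in> carrier (free_group n) \<longleftrightarrow> x \<in> F n"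
  by (simp add: free_group_def F_def)

lemma carrier_cases:
  assumes "w \<in> carrier (free_group n)"
  obtains x where "x \<in> F n" "w = letters x"
  using assms that[of "of_letters w"] by (auto simp: free_group_def F_def)

lemma mult_letters: "letters x \<otimes>\<^bsub>free_group n\<^esub> letters y = letters (x + y)"
  by (simp add: free_group_def letters_add)

lemma of_letters_letters [simp]: "of_letters (letters x) = x"
  by (rule letters_inverse)

lemma inv_letters: "x \<in> F n \<Longrightarrow> inv\<^bsub>free_group n\<^esub> letters x = letters (- x)"
  by (rule group.inv_equality[OF group_free_group])
    (simp_all add: mult_letters, simp add: free_group_def)

lemma act_realize: "x \<in> F n \<Longrightarrow> act (realize n \<sigma>) x = \<sigma> x"
  by (simp add: act_def realize_def)

lemma realize_cong: "(\<And>x. x \<in> F n \<Longrightarrow> \<sigma> x = \<tau> x) \<Longrightarrow> realize n \<sigma> = realize n \<tau>"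
  unfolding realize_def by (rule restrict_ext) (auto elim!: carrier_cases)

lemma realize_letters: "x \<in> F n \<Longrightarrow> realize n \<sigma> (letters x) = letters (\<sigma> x)"
  by (simp add: realize_def)

lemma auto_letters:
  assumes "\<alpha> \<in> auto (free_group n)" "x \<in> F n"
  shows "\<alpha> (letters x) = letters (act \<alpha> x)" "act \<alpha> x \<in> F n"
proof -
  have "\<alpha> (letters x) \<in> carrier (free_group n)"
    using assms by (auto simp: auto_def hom_def)
  then obtain y where "y \<in> F n" "\<alpha> (letters x) = letters y" by (rule carrier_cases)
  then show "\<alpha> (letters x) = letters (act \<alpha> x)" "act \<alpha> x \<in> F n" by (simp_all add: act_def)
qed

lemma realize_act:
  assumes "\<alpha> \<in> auto (free_group n)"
  shows "realize n (act \<alpha>) = \<alpha>"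
proof (rule extensionalityI)
  show "realize n (act \<alpha>) \<in> extensional (carrier (free_group n))" by (simp add: realize_def)
  show "\<alpha> \<in> extensional (carrier (free_group n))"
    using assms by (simp add: auto_def Bij_def)
  fix w assume "w \<in> carrier (free_group n)"
  then obtain x where "x \<in> F n" "w = letters x" by (rule carrier_cases)
  then show "realize n (act \<alpha>) w = \<alpha> w"
    using auto_letters[OF assms] by (simp add: realize_letters)
qed

lemma bij_letters: "bij_betw letters (F n) (carrier (free_group n))"
  by (rule bij_betwI[where g = of_letters]) (auto elim!: carrier_cases)

lemma aut_on_act:
  assumes \<alpha>: "\<alpha> \<in> auto (free_group n)"
  shows "aut_on n (act \<alpha>)"
proof -
  have "act \<alpha> (x + y) = act \<alpha> x + act \<alpha> y" if "x \<in> F n" "y \<in> F n" for x y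
  proof -
    have "\<alpha> (letters x \<otimes>\<^bsub>free_group n\<^esub> letters y) =
        \<alpha> (letters x) \<otimes>\<^bsub>free_group n\<^esub> \<alpha> (letters y)"
      using \<alpha> that by (auto simp: auto_def hom_def)
    then have "letters (act \<alpha> (x + y)) = letters (act \<alpha> x + act \<alpha> y)"
      using that by (simp add: mult_letters auto_letters[OF \<alpha>])
    then show ?thesis by (simp add: letters_inject)
  qed
  moreover have "bij_betw \<alpha> (carrier (free_group n)) (carrier (free_group n))"
    using \<alpha> by (simp add: auto_def Bij_def)
  then have "bij_betw (\<lambda>x. \<alpha> (letters x)) (F n) (carrier (free_group n))"
    using bij_betw_trans[OF bij_letters] by (simp add: comp_def)
  then have "bij_betw (\<lambda>x. letters (act \<alpha> x)) (F n) (carrier (free_group n))"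
    using auto_letters(1)[OF \<alpha>] by (simp cong: bij_betw_cong)
  then have "bij_betw (act \<alpha>) (F n) (F n)"
    using bij_betw_comp_iff2[OF bij_letters, of "act \<alpha>" "F n" n] auto_letters(2)[OF \<alpha>]
    by (auto simp: comp_def)
  ultimately show ?thesis by (simp add: aut_on_def hom_on_def)
qed

lemma realize_auto:
  assumes \<sigma>: "aut_on n \<sigma>"
  shows "realize n \<sigma> \<in> auto (free_group n)"
proof -
  note hom = aut_on_hom[OF \<sigma>]
  have "realize n \<sigma> \<in> hom (free_group n) (free_group n)"
  proof (rule homI)
    fix v w assume "v \<in> carrier (free_group n)" "w \<in> carrier (free_group n)"
    then obtain x y where xy: "x \<in> F n" "y \<in> F n" "v = letters x" "w = letters y"
      by (metis carrier_cases)
    then show "realize n \<sigma> (v \<otimes>\<^bsub>free_group n\<^esub> w) =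
        realize n \<sigma> v \<otimes>\<^bsub>free_group n\<^esub> realize n \<sigma> w"
      by (simp add: mult_letters realize_letters hom_on_add[OF hom])
  next
    fix v assume "v \<in> carrier (free_group n)"
    then obtain x where "x \<in> F n" "v = letters x" by (rule carrier_cases)
    then show "realize n \<sigma> v \<in> carrier (free_group n)"
      using aut_on_closed[OF \<sigma>] by (simp add: realize_letters)
  qed
  moreover have "bij_betw (realize n \<sigma>) (carrier (free_group n)) (carrier (free_group n))"
  proof (rule bij_betw_byWitness[where f' = "realize n (inverse_on n \<sigma>)"])
    show "\<forall>v\<in>carrier (free_group n). realize n (inverse_on n \<sigma>) (realize n \<sigma> v) = v"
      using aut_on_closed[OF \<sigma>]
      by (auto elim!: carrier_cases simp: realize_letters inverse_on[OF \<sigma>])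
    show "\<forall>v\<in>carrier (free_group n). realize n \<sigma> (realize n (inverse_on n \<sigma>) v) = v"
      by (auto elim!: carrier_cases simp: realize_letters inverse_on[OF \<sigma>])
  qed (auto elim!: carrier_cases simp: realize_letters inverse_on[OF \<sigma>] aut_on_closed[OF \<sigma>])
  ultimately show ?thesis
    by (simp add: auto_def Bij_def realize_def)
qed

abbreviation AutF :: "nat \<Rightarrow> (letter list \<Rightarrow> letter list) monoid" where
  "AutF n \<equiv> AutoGroup (free_group n)"

lemma carrier_AutF: "carrier (AutF n) = auto (free_group n)"
  by (simp add: AutoGroup_def)

lemma group_AutF: "group (AutF n)"
  by (rule group.AutoGroup[OF group_free_group])

lemma AutF_cases:
  assumes "\<alpha> \<in> carrier (AutF n)"
  obtains \<sigma> where "aut_on n \<sigma>" "\<alpha> = realize n \<sigma>"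
  using assms that[of "act \<alpha>"] aut_on_act realize_act by (metis carrier_AutF)

lemma realize_carrier: "aut_on n \<sigma> \<Longrightarrow> realize n \<sigma> \<in> carrier (AutF n)"
  by (simp add: carrier_AutF realize_auto)

lemma realize_mult:
  assumes "aut_on n \<sigma>" "aut_on n \<tau>"
  shows "realize n \<sigma> \<otimes>\<^bsub>AutF n\<^esub> realize n \<tau> = realize n (\<lambda>x. \<sigma> (\<tau> x))"
proof -
  have "realize n \<sigma> \<in> Bij (carrier (free_group n))" "realize n \<tau> \<in> Bij (carrier (free_group n))"
    using realize_auto[OF assms(1)] realize_auto[OF assms(2)] by (simp_all add: auto_def)
  then have "realize n \<sigma> \<otimes>\<^bsub>AutF n\<^esub> realize n \<tau> =
      compose (carrier (free_group n)) (realize n \<sigma>) (realize n \<tau>)"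
    by (simp add: AutoGroup_def BijGroup_def)
  also have "\<dots> = realize n (\<lambda>x. \<sigma> (\<tau> x))"
  proof (rule extensionalityI)
    fix w assume "w \<in> carrier (free_group n)"
    then obtain x where "x \<in> F n" "w = letters x" by (rule carrier_cases)
    then show "compose (carrier (free_group n)) (realize n \<sigma>) (realize n \<tau>) w =
        realize n (\<lambda>x. \<sigma> (\<tau> x)) w"
      using aut_on_closed[OF assms(2)] by (simp add: compose_def realize_letters)
  qed (simp_all add: realize_def)
  finally show ?thesis .
qed

lemma realize_one: "\<one>\<^bsub>AutF n\<^esub> = realize n (\<lambda>x. x)"
proof -
  have "aut_on n (\<lambda>x. x)" by (simp add: aut_on_def hom_on_def bij_betw_def)
  then show ?thesis
    using group.l_cancel_one[OF group_AutF, of "realize n (\<lambda>x. x)" n "realize n (\<lambda>x. x)"]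
    by (simp add: realize_carrier realize_mult)
qed

lemma realize_inv:
  assumes "aut_on n \<sigma>"
  shows "inv\<^bsub>AutF n\<^esub> realize n \<sigma> = realize n (inverse_on n \<sigma>)"
proof (rule group.inv_equality[OF group_AutF])
  have "realize n (\<lambda>x. inverse_on n \<sigma> (\<sigma> x)) = realize n (\<lambda>x. x)"
    by (rule realize_cong) (simp add: inverse_on[OF assms])
  then show "realize n (inverse_on n \<sigma>) \<otimes>\<^bsub>AutF n\<^esub> realize n \<sigma> = \<one>\<^bsub>AutF n\<^esub>"
    by (simp add: realize_mult[OF aut_on_inverse[OF assms] assms] realize_one)
qed (simp_all add: realize_carrier assms aut_on_inverse)

lemma inner_automorphism_letters:
  assumes "g \<in> F n"
  shows "inner_automorphism (free_group n) (letters g) = realize n (\<lambda>x. g + x - g)"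
proof (rule extensionalityI)
  fix w assume "w \<in> carrier (free_group n)"
  then obtain x where "x \<in> F n" "w = letters x" by (rule carrier_cases)
  then show "inner_automorphism (free_group n) (letters g) w = realize n (\<lambda>x. g + x - g) w"
    using assms by (simp add: inner_automorphism_def realize_letters inv_letters mult_letters)
qed (simp_all add: inner_automorphism_def realize_def)

lemma Inn_eq: "Inn (free_group n) = (\<lambda>g. realize n (\<lambda>x. g + x - g)) ` F n"
proof -
  have "carrier (free_group n) = letters ` F n"
    using bij_letters by (simp add: bij_betw_def)
  then show ?thesis
    unfolding Inn_def by (simp only: image_image) (rule image_cong[OF refl inner_automorphism_letters])
qed

lemma finite_bounded_automorphisms:
  "finite {\<alpha> \<in> carrier (AutF n). \<forall>i<n. len (act \<alpha> (gen i)) \<le> C}" (is "finite ?A")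
proof -
  define R where "R \<alpha> = restrict (\<lambda>i. act \<alpha> (gen i)) {..<n}" for \<alpha>
  have "inj_on R ?A"
  proof (rule inj_onI)
    fix \<alpha> \<beta> assume ab: "\<alpha> \<in> ?A" "\<beta> \<in> ?A" and R: "R \<alpha> = R \<beta>"
    have gens: "act \<alpha> (gen i) = act \<beta> (gen i)" if "i < n" for i
      using fun_cong[OF R, of i] that by (simp add: R_def)
    have "act \<alpha> x = act \<beta> x" if "x \<in> F n" for x
    proof (rule hom_on_eqI[OF _ _ _ that])
      show "hom_on n (act \<alpha>)" "hom_on n (act \<beta>)"
        using ab by (simp_all add: carrier_AutF aut_on_hom[OF aut_on_act])
    qed (rule gens)
    then have "realize n (act \<alpha>) = realize n (act \<beta>)" by (rule realize_cong)
    then show "\<alpha> = \<beta>" using ab realize_act by (simp add: carrier_AutF)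
  qed
  moreover have "R ` ?A \<subseteq> {..<n} \<rightarrow>\<^sub>E {x \<in> F n. len x \<le> C}"
    using auto_letters(2) by (auto simp: R_def carrier_AutF split: if_splits)
  moreover have "finite ({..<n} \<rightarrow>\<^sub>E {x \<in> F n. len x \<le> C})"
    by (intro finite_PiE finite_ball) simp
  ultimately show ?thesis by (meson finite_subset finite_imageD)
qed

text \<open>The automorphisms with generator images of length at most \<open>3\<close> form a finite set
that contains the Nielsen moves. It also contains the inverses of the automorphisms that do not shorten
words, at which the reduction stops.\<close>

theorem finitely_generated_AutF: "finitely_generated (AutF n)"
proof -
  interpret A: group "AutF n" by (rule group_AutF)
  define S where "S = {\<alpha> \<in> carrier (AutF n). \<forall>i<n. len (act \<alpha> (gen i)) \<le> 3}"
  have gen: "realize n \<phi> \<in> generate (AutF n) S" if "aut_on n \<phi>" for \<phi>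
    using that
  proof (induction "nielsen_rank n \<phi>" arbitrary: \<phi>
      rule: wf_induct_rule[OF wf_lex_prod[OF wf_less_than wf_less_than]])
    case (1 \<phi>)
    note \<phi> = 1(2)
    from \<phi> show ?case
    proof (cases rule: nielsen_reduction)
      case 1
      have "len (inverse_on n \<phi> (gen i)) \<le> 3" if "i < n" for i
        using 1[of "inverse_on n \<phi> (gen i)"] that by (simp add: inverse_on[OF \<phi>])
      then have "realize n (inverse_on n \<phi>) \<in> S"
        using realize_carrier[OF aut_on_inverse[OF \<phi>]] by (simp add: S_def act_realize)
      then have "inv\<^bsub>AutF n\<^esub> realize n (inverse_on n \<phi>) \<in> generate (AutF n) S"
        by (rule generate.inv)
      then show ?thesis
        by (simp add: realize_carrier[OF \<phi>] flip: realize_inv[OF \<phi>])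
    next
      case (2 \<nu>)
      have "realize n (\<lambda>x. \<phi> (\<nu> x)) \<in> generate (AutF n) S"
        using 1(1)[OF 2(3) aut_on_comp[OF \<phi> 2(1)]] .
      moreover have "realize n \<nu> \<in> S"
        using 2 realize_carrier[OF 2(1)] by (simp add: S_def act_realize)
      ultimately have "realize n (\<lambda>x. \<phi> (\<nu> x)) \<otimes>\<^bsub>AutF n\<^esub> inv\<^bsub>AutF n\<^esub> realize n \<nu> \<in> generate (AutF n) S"
        by (intro generate.eng generate.inv)
      then show ?thesis
        using realize_carrier[OF \<phi>] realize_carrier[OF 2(1)]
        by (simp add: A.m_assoc flip: realize_mult[OF \<phi> 2(1)])
    qed
  qed
  have S: "S \<subseteq> carrier (AutF n)" by (auto simp: S_def)
  have "carrier (AutF n) \<subseteq> generate (AutF n) S" using gen by (auto elim!: AutF_cases)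
  then have "generate (AutF n) S = carrier (AutF n)"
    using A.generate_incl[OF S] by blast
  moreover have "finite S" unfolding S_def by (rule finite_bounded_automorphisms)
  ultimately show ?thesis
    using S unfolding finitely_generated_def finite_generating_set_def by blast
qed

section \<open>The retraction onto the automorphism group of the factor\<close>

abbreviation OutF :: "nat \<Rightarrow> (letter list \<Rightarrow> letter list) set monoid" where
  "OutF n \<equiv> OutGroup (free_group n)"

definition outer_class :: "nat \<Rightarrow> (letter list \<Rightarrow> letter list) \<Rightarrow> (letter list \<Rightarrow> letter list) set" where
  "outer_class n \<alpha> = Inn (free_group n) #>\<^bsub>AutF n\<^esub> \<alpha>"

lemma normal_InnF: "Inn (free_group n) \<lhd> AutF n"
  by (rule group.normal_Inn[OF group_free_group])

lemma outer_class_hom: "outer_class n \<in> hom (AutF n) (OutF n)"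
  using normal.r_coset_hom_Mod[OF normal_InnF] by (simp add: OutGroup_def outer_class_def[abs_def])

lemma outer_class_surj: "outer_class n ` carrier (AutF n) = carrier (OutF n)"
  by (auto simp: OutGroup_def FactGroup_def RCOSETS_def outer_class_def)

lemma outer_class_eqD:
  assumes "aut_on n \<Phi>" "aut_on n \<Psi>"
    and eq: "outer_class n (realize n \<Phi>) = outer_class n (realize n \<Psi>)"
  obtains h where "h \<in> F n" "\<And>x. x \<in> F n \<Longrightarrow> \<Psi> x = h + \<Phi> x - h"
proof -
  interpret A: group "AutF n" by (rule group_AutF)
  have sub: "subgroup (Inn (free_group n)) (AutF n)"
    by (rule normal_imp_subgroup[OF normal_InnF])
  have "realize n \<Psi> \<in> outer_class n (realize n \<Psi>)"
    unfolding outer_class_def by (rule A.rcos_self[OF realize_carrier[OF assms(2)] sub])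
  then have "realize n \<Psi> \<in> Inn (free_group n) #>\<^bsub>AutF n\<^esub> realize n \<Phi>"
    unfolding eq[symmetric] by (simp only: outer_class_def)
  then obtain h where h: "h \<in> F n"
    "realize n \<Psi> = realize n (\<lambda>x. h + x - h) \<otimes>\<^bsub>AutF n\<^esub> realize n \<Phi>"
    by (auto simp: r_coset_def Inn_eq)
  then have eq': "realize n \<Psi> = realize n (\<lambda>x. h + \<Phi> x - h)"
    by (simp add: realize_mult[OF aut_on_conj assms(1)])
  show thesis
  proof (rule that[OF h(1)])
    fix x assume "x \<in> F n"
    then show "\<Psi> x = h + \<Phi> x - h"
      using act_realize[of x n \<Psi>] act_realize[of x n "\<lambda>x. h + \<Phi> x - h"] eq' by simp
  qed
qed

lemma outer_class_conj:
  assumes \<Phi>: "aut_on n \<Phi>" and g: "g \<in> F n"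
  shows "outer_class n (realize n (\<lambda>x. \<Phi> (g + x - g))) = outer_class n (realize n \<Phi>)"
proof -
  interpret A: group "AutF n" by (rule group_AutF)
  interpret O: group "OutF n" by (rule group_OutGroup[OF group_free_group])
  have inn: "realize n (\<lambda>x. g + x - g) \<in> Inn (free_group n)" using g by (auto simp: Inn_eq)
  have "outer_class n (realize n (\<lambda>x. g + x - g)) = Inn (free_group n)"
    unfolding outer_class_def
    by (rule subgroup.rcos_const[OF normal_imp_subgroup[OF normal_InnF] group_AutF inn])
  then have one: "outer_class n (realize n (\<lambda>x. g + x - g)) = \<one>\<^bsub>OutF n\<^esub>"
    by (simp add: OutGroup_def FactGroup_def)
  have "realize n (\<lambda>x. \<Phi> (g + x - g)) = realize n \<Phi> \<otimes>\<^bsub>AutF n\<^esub> realize n (\<lambda>x. g + x - g)"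
    by (rule realize_mult[OF \<Phi> aut_on_conj[OF g], symmetric])
  then have "outer_class n (realize n (\<lambda>x. \<Phi> (g + x - g))) =
      outer_class n (realize n \<Phi>) \<otimes>\<^bsub>OutF n\<^esub> \<one>\<^bsub>OutF n\<^esub>"
    using hom_mult[OF outer_class_hom realize_carrier[OF \<Phi>] realize_carrier[OF aut_on_conj[OF g]]] one
    by simp
  also have "outer_class n (realize n \<Phi>) \<in> carrier (OutF n)"
    using hom_in_carrier[OF outer_class_hom realize_carrier[OF \<Phi>]] .
  then have "outer_class n (realize n \<Phi>) \<otimes>\<^bsub>OutF n\<^esub> \<one>\<^bsub>OutF n\<^esub> = outer_class n (realize n \<Phi>)"
    by simp
  finally show ?thesis .
qed

definition extension_class :: "nat \<Rightarrow> (letter list \<Rightarrow> letter list) \<Rightarrow> (letter list \<Rightarrow> letter list) set" where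
  "extension_class a \<alpha> = outer_class (Suc a) (realize (Suc a) (extension a (act \<alpha>)))"

lemma extension_class_realize:
  "extension_class a (realize a \<phi>) = outer_class (Suc a) (realize (Suc a) (extension a \<phi>))"
proof -
  have "(\<lambda>i. if i < a then act (realize a \<phi>) (gen i) else gen i) =
      (\<lambda>i. if i < a then \<phi> (gen i) else gen i)"
    by (auto simp: act_realize)
  then show ?thesis by (simp add: extension_class_def extension_def)
qed

lemma extension_class_hom: "extension_class a \<in> hom (AutF a) (OutF (Suc a))"
proof (rule homI)
  fix \<alpha> assume "\<alpha> \<in> carrier (AutF a)"
  then obtain \<phi> where "aut_on a \<phi>" "\<alpha> = realize a \<phi>" by (rule AutF_cases)
  then show "extension_class a \<alpha> \<in> carrier (OutF (Suc a))"
    using hom_in_carrier[OF outer_class_hom realize_carrier[OF aut_on_extension]]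
    by (simp add: extension_class_realize)
next
  fix \<alpha> \<beta> assume "\<alpha> \<in> carrier (AutF a)" "\<beta> \<in> carrier (AutF a)"
  then obtain \<phi> \<psi> where \<phi>: "aut_on a \<phi>" "\<alpha> = realize a \<phi>" and \<psi>: "aut_on a \<psi>" "\<beta> = realize a \<psi>"
    by (metis AutF_cases)
  have "realize (Suc a) (extension a (\<lambda>x. \<phi> (\<psi> x))) =
      realize (Suc a) (\<lambda>x. extension a \<phi> (extension a \<psi> x))"
    by (rule realize_cong) (simp add: extension_comp[OF \<phi>(1) \<psi>(1)])
  also have "\<dots> = realize (Suc a) (extension a \<phi>) \<otimes>\<^bsub>AutF (Suc a)\<^esub> realize (Suc a) (extension a \<psi>)"
    by (rule realize_mult[OF aut_on_extension[OF \<phi>(1)] aut_on_extension[OF \<psi>(1)], symmetric])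
  finally show "extension_class a (\<alpha> \<otimes>\<^bsub>AutF a\<^esub> \<beta>) =
      extension_class a \<alpha> \<otimes>\<^bsub>OutF (Suc a)\<^esub> extension_class a \<beta>"
    using hom_mult[OF outer_class_hom realize_carrier[OF aut_on_extension[OF \<phi>(1)]]
        realize_carrier[OF aut_on_extension[OF \<psi>(1)]]]
    by (simp add: \<phi> \<psi> realize_mult extension_class_realize)
qed

lemma extension_class_inj: "inj_on (extension_class a) (carrier (AutF a))"
proof (rule inj_onI)
  interpret A: group "AutF a" by (rule group_AutF)
  interpret O: group "OutF (Suc a)" by (rule group_OutGroup[OF group_free_group])
  interpret h: group_hom "AutF a" "OutF (Suc a)" "extension_class a"
    by unfold_locales (rule extension_class_hom)
  have trivial: "\<alpha> = \<one>\<^bsub>AutF a\<^esub>"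
    if \<alpha>: "\<alpha> \<in> carrier (AutF a)" "extension_class a \<alpha> = \<one>\<^bsub>OutF (Suc a)\<^esub>" for \<alpha>
  proof -
    obtain \<phi> where \<phi>: "aut_on a \<phi>" "\<alpha> = realize a \<phi>" using \<alpha>(1) by (rule AutF_cases)
    have id: "aut_on m (\<lambda>x. x)" for m by (simp add: aut_on_def hom_on_def bij_betw_def)
    have "outer_class (Suc a) (realize (Suc a) (\<lambda>x. x)) = \<one>\<^bsub>OutF (Suc a)\<^esub>"
      using hom_one[OF outer_class_hom group_AutF group_OutGroup[OF group_free_group], of "Suc a"]
      by (simp add: realize_one)
    then have "outer_class (Suc a) (realize (Suc a) (\<lambda>x. x)) =
        outer_class (Suc a) (realize (Suc a) (extension a \<phi>))"
      using \<alpha>(2) \<phi>(2) by (simp add: extension_class_realize)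
    then obtain g where "g \<in> F (Suc a)" "\<And>x. x \<in> F (Suc a) \<Longrightarrow> extension a \<phi> x = g + x - g"
      using outer_class_eqD[OF id aut_on_extension[OF \<phi>(1)]] by blast
    then have "\<phi> x = x" if "x \<in> F a" for x
      using inner_extension_trivial[OF \<phi>(1)] that by blast
    then have "realize a \<phi> = realize a (\<lambda>x. x)" by (rule realize_cong)
    then show ?thesis by (simp add: \<phi>(2) realize_one)
  qed
  fix \<alpha> \<beta> assume ab: "\<alpha> \<in> carrier (AutF a)" "\<beta> \<in> carrier (AutF a)"
    and eq: "extension_class a \<alpha> = extension_class a \<beta>"
  have "extension_class a (\<alpha> \<otimes>\<^bsub>AutF a\<^esub> inv\<^bsub>AutF a\<^esub> \<beta>) = \<one>\<^bsub>OutF (Suc a)\<^esub>"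
    using ab eq by simp
  then have "\<alpha> \<otimes>\<^bsub>AutF a\<^esub> inv\<^bsub>AutF a\<^esub> \<beta> = \<one>\<^bsub>AutF a\<^esub>"
    using ab by (intro trivial) auto
  then have "\<alpha> \<otimes>\<^bsub>AutF a\<^esub> inv\<^bsub>AutF a\<^esub> \<beta> \<otimes>\<^bsub>AutF a\<^esub> \<beta> = \<beta>" using ab by simp
  then show "\<alpha> = \<beta>" using ab by (simp add: A.m_assoc)
qed

text \<open>A normalized representative exists in every outer class. On the subgroup the representative
is required to be the extension itself, so that the retraction is the identity there and not only up to
bounded distance.\<close>

definition good_representative ::
    "nat \<Rightarrow> (letter list \<Rightarrow> letter list) set \<Rightarrow> (freegrp \<Rightarrow> freegrp) \<Rightarrow> bool" where
  "good_representative a c \<Phi> \<longleftrightarrow>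
    aut_on (Suc a) \<Phi> \<and> outer_class (Suc a) (realize (Suc a) \<Phi>) = c \<and> normalized a \<Phi> \<and>
    (c \<in> extension_class a ` carrier (AutF a) \<longrightarrow> (\<exists>\<phi>. aut_on a \<phi> \<and> \<Phi> = extension a \<phi>))"

lemma good_representative_exists:
  assumes "c \<in> carrier (OutF (Suc a))"
  shows "\<exists>\<Phi>. good_representative a c \<Phi>"
proof (cases "c \<in> extension_class a ` carrier (AutF a)")
  case True
  then obtain \<alpha> where "\<alpha> \<in> carrier (AutF a)" "c = extension_class a \<alpha>" by auto
  then obtain \<phi> where "aut_on a \<phi>" "c = extension_class a (realize a \<phi>)" by (metis AutF_cases)
  then have "good_representative a c (extension a \<phi>)"
    using aut_on_extension[of a \<phi>] normalized_extension[of a \<phi>]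
    by (auto simp: good_representative_def extension_class_realize)
  then show ?thesis by blast
next
  case False
  obtain \<alpha> where "\<alpha> \<in> carrier (AutF (Suc a))" "c = outer_class (Suc a) \<alpha>"
    using assms outer_class_surj by blast
  then obtain \<Phi> where \<Phi>: "aut_on (Suc a) \<Phi>" "c = outer_class (Suc a) (realize (Suc a) \<Phi>)"
    by (metis AutF_cases)
  obtain g where g: "g \<in> F (Suc a)" "normalized a (\<lambda>x. \<Phi> (g + x - g))"
    by (rule normalized_exists[OF \<Phi>(1)])
  have "good_representative a c (\<lambda>x. \<Phi> (g + x - g))"
    using False g \<Phi> aut_on_comp[OF \<Phi>(1) aut_on_conj[OF g(1)]] outer_class_conj[OF \<Phi>(1) g(1)]
    by (simp add: good_representative_def)
  then show ?thesis by blast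
qed

definition representative :: "nat \<Rightarrow> (letter list \<Rightarrow> letter list) set \<Rightarrow> freegrp \<Rightarrow> freegrp" where
  "representative a c = (SOME \<Phi>. good_representative a c \<Phi>)"

lemma representative: "c \<in> carrier (OutF (Suc a)) \<Longrightarrow> good_representative a c (representative a c)"
  unfolding representative_def using good_representative_exists by (rule someI_ex)

text \<open>The Schreier basis of the factor \<open>A\<close> itself need not be the standard basis in
its standard order. The constant change of basis on the right corrects this.\<close>

definition factor_basis_change :: "nat \<Rightarrow> letter list \<Rightarrow> letter list" where
  "factor_basis_change a = realize a (comarking (Suc a) a (F a))"

definition retraction_aut :: "nat \<Rightarrow> (letter list \<Rightarrow> letter list) set \<Rightarrow> letter list \<Rightarrow> letter list" where
  "retraction_aut a c = realize a (retract a (representative a c)) \<otimes>\<^bsub>AutF a\<^esub> factor_basis_change a"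

lemma factor_basis_change_carrier: "factor_basis_change a \<in> carrier (AutF a)"
  unfolding factor_basis_change_def by (rule realize_carrier[OF aut_on_comarking_factor])

lemma retract_representative_aut:
  "c \<in> carrier (OutF (Suc a)) \<Longrightarrow> aut_on a (retract a (representative a c))"
  using representative retract_aut(1) by (auto simp: good_representative_def)

lemma retraction_aut_carrier:
  "c \<in> carrier (OutF (Suc a)) \<Longrightarrow> retraction_aut a c \<in> carrier (AutF a)"
  unfolding retraction_aut_def
  using group.is_monoid[OF group_AutF] realize_carrier[OF retract_representative_aut]
    factor_basis_change_carrier by (intro monoid.m_closed)

lemma extension_class_retraction_aut:
  assumes c: "c \<in> carrier (OutF (Suc a))" and ext: "c \<in> extension_class a ` carrier (AutF a)"
  shows "extension_class a (retraction_aut a c) = c"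
proof -
  obtain \<phi> where \<phi>: "aut_on a \<phi>" "representative a c = extension a \<phi>"
    "outer_class (Suc a) (realize (Suc a) (extension a \<phi>)) = c"
    using representative[OF c] ext by (auto simp: good_representative_def)
  have "retraction_aut a c = realize a (\<lambda>x. retract a (extension a \<phi>) (comarking (Suc a) a (F a) x))"
    unfolding retraction_aut_def factor_basis_change_def \<phi>(2)
    by (rule realize_mult[OF retract_aut(1)[OF aut_on_extension[OF \<phi>(1)]] aut_on_comarking_factor])
  also have "\<dots> = realize a \<phi>"
    by (rule realize_cong[OF retract_extension[OF \<phi>(1)]])
  finally show ?thesis using \<phi>(3) by (simp add: extension_class_realize)
qed

text \<open>A product \<open>c s\<close> is represented by \<open>\<Phi> S\<close> up to conjugation, so
\<open>retract_change_bounded\<close> bounds the difference, up to conjugation by the constant change of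
basis. For \<open>a = 0\<close> the target is finite.\<close>

lemma retraction_differences_finite:
  assumes s: "s \<in> carrier (OutF (Suc a))"
  shows "finite ((\<lambda>c. inv\<^bsub>AutF a\<^esub> retraction_aut a c \<otimes>\<^bsub>AutF a\<^esub>
    retraction_aut a (c \<otimes>\<^bsub>OutF (Suc a)\<^esub> s)) ` carrier (OutF (Suc a)))" (is "finite (?\<delta> ` _)")
proof -
  interpret A: group "AutF a" by (rule group_AutF)
  interpret O: group "OutF (Suc a)" by (rule group_OutGroup[OF group_free_group])
  show ?thesis
  proof (cases "a \<ge> 1")
    case False
    then have "{\<alpha> \<in> carrier (AutF a). \<forall>i<a. len (act \<alpha> (gen i)) \<le> 0} = carrier (AutF a)" by auto
    then have "finite (carrier (AutF a))"
      using finite_bounded_automorphisms[of a 0] by simp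
    moreover have "?\<delta> ` carrier (OutF (Suc a)) \<subseteq> carrier (AutF a)"
      using s by (auto intro!: retraction_aut_carrier)
    ultimately show ?thesis by (rule finite_subset[rotated])
  next
    case True
    define S where "S = representative a s"
    have S: "aut_on (Suc a) S" "outer_class (Suc a) (realize (Suc a) S) = s"
      using representative[OF s] by (simp_all add: S_def good_representative_def)
    obtain D where D: "\<And>\<Phi> \<Psi> g i. aut_on (Suc a) \<Phi> \<Longrightarrow> aut_on (Suc a) \<Psi> \<Longrightarrow>
        normalized a \<Phi> \<Longrightarrow> normalized a \<Psi> \<Longrightarrow> g \<in> F (Suc a) \<Longrightarrow>
        (\<And>x. x \<in> F (Suc a) \<Longrightarrow> \<Psi> x = \<Phi> (S (g + x - g))) \<Longrightarrow> i < a \<Longrightarrow>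
        len (inverse_on a (retract a \<Phi>) (retract a \<Psi> (gen i))) \<le> D"
      using retract_change_bounded[OF S(1) True] by metis
    let ?k = "factor_basis_change a"
    define Q where "Q = {\<alpha> \<in> carrier (AutF a). \<forall>i<a. len (act \<alpha> (gen i)) \<le> D}"
    have "?\<delta> c \<in> (\<lambda>\<beta>. inv\<^bsub>AutF a\<^esub> ?k \<otimes>\<^bsub>AutF a\<^esub> \<beta> \<otimes>\<^bsub>AutF a\<^esub> ?k) ` Q"
      if c: "c \<in> carrier (OutF (Suc a))" for c
    proof -
      define \<Phi> \<Psi> where "\<Phi> = representative a c" and
        "\<Psi> = representative a (c \<otimes>\<^bsub>OutF (Suc a)\<^esub> s)"
      have cs: "c \<otimes>\<^bsub>OutF (Suc a)\<^esub> s \<in> carrier (OutF (Suc a))" using c s by simp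
      have \<Phi>: "aut_on (Suc a) \<Phi>" "outer_class (Suc a) (realize (Suc a) \<Phi>) = c" "normalized a \<Phi>"
        using representative[OF c] by (simp_all add: \<Phi>_def good_representative_def)
      have \<Psi>: "aut_on (Suc a) \<Psi>" "normalized a \<Psi>"
        "outer_class (Suc a) (realize (Suc a) \<Psi>) = c \<otimes>\<^bsub>OutF (Suc a)\<^esub> s"
        using representative[OF cs] by (simp_all add: \<Psi>_def good_representative_def)
      note \<Phi>S = aut_on_comp[OF \<Phi>(1) S(1)]
      have "outer_class (Suc a) (realize (Suc a) (\<lambda>x. \<Phi> (S x))) = c \<otimes>\<^bsub>OutF (Suc a)\<^esub> s"
        using hom_mult[OF outer_class_hom realize_carrier[OF \<Phi>(1)] realize_carrier[OF S(1)]]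
        by (simp add: realize_mult[OF \<Phi>(1) S(1)] \<Phi>(2) S(2))
      then obtain h where h: "h \<in> F (Suc a)" "\<And>x. x \<in> F (Suc a) \<Longrightarrow> \<Psi> x = h + \<Phi> (S x) - h"
        using outer_class_eqD[OF \<Phi>S \<Psi>(1)] \<Psi>(3) by metis
      define g where "g = inverse_on (Suc a) (\<lambda>x. \<Phi> (S x)) h"
      have g: "g \<in> F (Suc a)" "\<Phi> (S g) = h"
        using inverse_on[OF \<Phi>S h(1)] by (simp_all add: g_def)
      have \<Psi>_eq: "\<Psi> x = \<Phi> (S (g + x - g))" if "x \<in> F (Suc a)" for x
        using h(2)[OF that] g that hom_on_add[OF aut_on_hom[OF \<Phi>S], of g x]
          hom_on_diff[OF aut_on_hom[OF \<Phi>S], of "g + x" g] by simp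
      let ?f = "retract a \<Phi>" and ?g = "retract a \<Psi>"
      have f: "aut_on a ?f" and g': "aut_on a ?g"
        using retract_aut(1) \<Phi>(1) \<Psi>(1) by blast+
      define \<beta> where "\<beta> = inv\<^bsub>AutF a\<^esub> realize a ?f \<otimes>\<^bsub>AutF a\<^esub> realize a ?g"
      have \<beta>: "\<beta> = realize a (\<lambda>x. inverse_on a ?f (?g x))"
        by (simp add: \<beta>_def realize_inv[OF f] realize_mult[OF aut_on_inverse[OF f] g'])
      have "\<beta> \<in> Q"
        using D[OF \<Phi>(1) \<Psi>(1) \<Phi>(3) \<Psi>(2) g(1) \<Psi>_eq]
          realize_carrier[OF aut_on_comp[OF aut_on_inverse[OF f] g']]
        by (simp add: Q_def \<beta> act_realize)
      moreover have "?\<delta> c = inv\<^bsub>AutF a\<^esub> ?k \<otimes>\<^bsub>AutF a\<^esub> \<beta> \<otimes>\<^bsub>AutF a\<^esub> ?k"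
        using factor_basis_change_carrier realize_carrier[OF f] realize_carrier[OF g']
        by (simp add: retraction_aut_def \<beta>_def A.inv_mult_group A.m_assoc flip: \<Phi>_def \<Psi>_def)
      ultimately show ?thesis by blast
    qed
    then have "?\<delta> ` carrier (OutF (Suc a)) \<subseteq>
        (\<lambda>\<beta>. inv\<^bsub>AutF a\<^esub> ?k \<otimes>\<^bsub>AutF a\<^esub> \<beta> \<otimes>\<^bsub>AutF a\<^esub> ?k) ` Q" by blast
    moreover have "finite Q" unfolding Q_def by (rule finite_bounded_automorphisms)
    ultimately show ?thesis by (meson finite_imageI finite_subset)
  qed
qed

theorem corollary2:
  fixes n :: nat
  assumes "n \<ge> 1"
  shows "\<exists>H. subgroup H (OutGroup (free_group n)) \<and>
    (OutGroup (free_group n))\<lparr>carrier := H\<rparr> \<cong> AutoGroup (free_group (n - 1)) \<and>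
    (\<exists>\<pi>. lipschitz_retraction (OutGroup (free_group n)) H \<pi>) \<and>
    undistorted (OutGroup (free_group n)) H"
proof -
  obtain a where n: "n = Suc a" using assms by (cases n) auto
  interpret A: group "AutF a" by (rule group_AutF)
  interpret O: group "OutF (Suc a)" by (rule group_OutGroup[OF group_free_group])
  interpret \<iota>: group_hom "AutF a" "OutF (Suc a)" "extension_class a"
    by unfold_locales (rule extension_class_hom)
  define H where "H = extension_class a ` carrier (AutF a)"
  let ?H = "(OutF (Suc a))\<lparr>carrier := H\<rparr>"
  have H: "subgroup H (OutF (Suc a))"
    unfolding H_def by (rule \<iota>.img_is_subgroup)
  have iso: "extension_class a \<in> iso (AutF a) ?H"
    using extension_class_inj \<iota>.homh by (auto simp: iso_def hom_def bij_betw_def H_def)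
  then have "AutF a \<cong> ?H" by (auto simp: is_iso_def)
  then have "?H \<cong> AutF a" by (rule A.iso_sym)
  moreover have retr: "lipschitz_retraction (OutF (Suc a)) H (\<lambda>c. extension_class a (retraction_aut a c))"
  proof (rule lipschitz_retractionI[OF O.is_group H])
    show "finitely_generated (OutF (Suc a))"
      by (rule finitely_generated_image[OF group_AutF O.is_group outer_class_hom outer_class_surj
            finitely_generated_AutF])
    show "finitely_generated ?H"
    proof (rule finitely_generated_image[OF group_AutF O.subgroup_imp_group[OF H] _ _
          finitely_generated_AutF])
      show "extension_class a \<in> hom (AutF a) ?H" using iso by (simp add: iso_def)
    qed (simp add: H_def)
    show "(\<lambda>c. extension_class a (retraction_aut a c)) \<in> carrier (OutF (Suc a)) \<rightarrow> H"
      using retraction_aut_carrier by (auto simp: H_def)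
    show "extension_class a (retraction_aut a c) = c" if "c \<in> H" for c
      using extension_class_retraction_aut that subgroup.subset[OF H] by (auto simp: H_def)
    fix s assume s: "s \<in> carrier (OutF (Suc a))"
    have "(\<lambda>c. inv\<^bsub>OutF (Suc a)\<^esub> extension_class a (retraction_aut a c) \<otimes>\<^bsub>OutF (Suc a)\<^esub>
          extension_class a (retraction_aut a (c \<otimes>\<^bsub>OutF (Suc a)\<^esub> s))) ` carrier (OutF (Suc a)) =
        extension_class a ` (\<lambda>c. inv\<^bsub>AutF a\<^esub> retraction_aut a c \<otimes>\<^bsub>AutF a\<^esub>
          retraction_aut a (c \<otimes>\<^bsub>OutF (Suc a)\<^esub> s)) ` carrier (OutF (Suc a))"
      unfolding image_image using s retraction_aut_carrier by (intro image_cong) simp_all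
    then show "finite ((\<lambda>c. inv\<^bsub>OutF (Suc a)\<^esub> extension_class a (retraction_aut a c) \<otimes>\<^bsub>OutF (Suc a)\<^esub>
          extension_class a (retraction_aut a (c \<otimes>\<^bsub>OutF (Suc a)\<^esub> s))) ` carrier (OutF (Suc a)))"
      using retraction_differences_finite[OF s] by simp
  qed
  moreover have "undistorted (OutF (Suc a)) H"
    by (rule undistorted_of_retraction[OF O.is_group retr])
  ultimately show ?thesis using H unfolding n by auto
qed

end
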